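(* For every integer $k\ge 1$, the trajectory $(g,z):[0,t_f]\to SL_2(\mathbb{R})\times\mathfrak{h}$ of the smoothed regular $(6k+2)$-gon lifts to a Pontryagin extremal trajectory, and this extremal trajectory has a normal multiplier ($\lambda_{cost}=-1$).
   Context: State equations. Let $J=\begin{pmatrix}0&-1\\1&0\end{pmatrix}$, $R=\exp(J\pi/3)$. $SL_2(\mathbb{R})$ acts on the upper half-plane $\mathfrak h=\{x+iy: y>0\}$ by linear fractional transformations $\rho.z$. For $z=x+iy\in\mathfrak h$ put $X=X(z)=\begin{pmatrix}x/y&-x^2/y-y\\1/y&-x/y\end{pmatrix}\in\mathfrak{sl}_2(\mathbb{R})$. The control set is $U=\{(u_0,u_1,u_2)\in\mathbb{R}^3:\sum u_i=1,\ u_i\ge0\}$ with vertices $e_1=(1,0,0)$, $e_2=(0,1,0)$, $e_3=(0,0,1)$. For $u\in U$ let $a=(u_1-u_2)/\sqrt3$, $b=u_0/3-2u_1/3-2u_2/3$, $c=u_0$, and $$f_1(x,y;u)=\frac{y(b+2ax-cx^2+cy^2)}{b+2ax-cx^2-cy^2},\qquad f_2(x,y;u)=\frac{2(a-cx)y^2}{b+2ax-cx^2-cy^2}.$$ Let $\mathfrak h^\star=\{x+iy\in\mathfrak h: |x|<1/\sqrt3,\ x^2+y^2>1/3\}$ and $M=SL_2(\mathbb{R})\times\mathfrak h$. A trajectory with measurable control $u:[0,t_f]\to U$ is an absolutely continuous $(g,z):[0,t_f]\to M$, $z=x+iy$, with $x'=f_1(x,y;u)$, $y'=f_2(x,y;u)$,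 $g'=gX(z)$ a.e. It is admissible if: $z$ has image in $\mathfrak h^\star$; $g(0)=I$, $g(t_f)=R$, $z(t_f)=R^{-1}.z(0)$; and $g$ is homotopic in $SL_2(\mathbb{R})$ (with fixed endpoints) to $t\mapsto\exp(J\pi t/(3t_f))$. Pontryagin extremals. Using left-invariant vector fields and the form $\langle A,B\rangle=\mathrm{trace}(AB)$, a point of $T^*M$ is written $\lambda=((g,\Lambda),(z,\nu))$ with $\Lambda\in\mathfrak{sl}_2(\mathbb{R})$, $\nu=(\nu_1,\nu_2)\in\mathbb{R}^2$. With $\lambda_{cost}\in\mathbb{R}$, the Hamiltonian is $H(\lambda;u)=\langle\Lambda,X\rangle-\tfrac32\lambda_{cost}\langle J,X\rangle+\nu_1f_1(x,y;u)+\nu_2f_2(x,y;u)$, and $H^+(\lambda)=\max_{u\in U}H(\lambda;u)$. A lifted trajectory of an admissible trajectory $(g,z)$ with control $u$ is a Lipschitz $\lambda:[0,t_f]\to T^*M$ over $(g,z)$ with, a.e., $\Lambda'=[\Lambda,X]$, $\nu_1'=-\partial H/\partial x$, $\nu_2'=-\partial H/\partial y$ (derivatives at fixed $\Lambda,\nu$ and at $u=u(t)$). It is a Pontryagin extremal trajectory if: (i) $H(\lambda(t);u(t))=H^+(\lambda(t))=0$ for a.e. $t$; (ii) $(\lambda_{cost},\Lambda(t),\nu(t))\ne0$ for every $t$; (iii) $\lambda_{cost}\le0$ is constant, normalized so that $\lambda_{cost}\in\{0,-1\}$ ($-1$: normal multiplier; $0$: abnormal); (iv) transversality: $\Lambda(t_f)=R^{-1}\Lambda(0)R$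 and $F^t\nu(t_f)=\nu(0)$, where $F:T_{z(0)}\mathfrak h\to T_{z(t_f)}\mathfrak h$ is the differential of $z\mapsto R^{-1}.z$ at $z(0)$ and $F^t$ its transpose. The smoothed regular $(6k+2)$-gon. Let $\theta_k=\pi k/(3k+1)$. For $y_k>0$, $t_k>0$, let $(g^{(3)},z^{(3)})$ be the trajectory with constant control $e_3$, $g^{(3)}(0)=I$, $z^{(3)}(0)=iy_k$. The numbers $y_k\in(0,1)$, $t_k>0$ are determined by $z^{(3)}(t_k)=R^{-1}.(iy_k)$ and $\mathrm{trace}(R^{-1}g^{(3)}(t_k))=2\cos\theta_k$; explicitly $4/(1+3y_k^2)=2\cos\theta_k$ and $t_k=|\ln((1+3y_k^2)/4)|/(\sqrt3\,y_k)$. The trajectory of the smoothed regular $(6k+2)$-gon is the trajectory on $[0,t_f]$, $t_f=(3k+1)t_k$, with $g(0)=I$, $z(0)=iy_k$, consisting of $3k+1$ pieces of equal duration $t_k$, whose constant controls on the successive intervals $[jt_k,(j+1)t_k]$, $j=0,1,\dots,3k$, are $e_3,e_1,e_2,e_3,e_1,e_2,\dots,e_3$ (cyclically repeating). *)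

theory Defs
  imports "HOL-Analysis.Analysis"
begin

section \<open>Matrices and the upper half-plane\<close>

definition mat2 :: "real \<Rightarrow> real \<Rightarrow> real \<Rightarrow> real \<Rightarrow> real^2^2" where
  "mat2 a b c d = vector [vector [a, b], vector [c, d]]"

text \<open>The multiplication of the type class instance of \<^typ>\<open>real^2^2\<close> is entrywise, so the
  library function \<^const>\<open>exp\<close> is not the matrix exponential.\<close>

definition mexp :: "real^2^2 \<Rightarrow> real^2^2" where
  "mexp A = (\<Sum>n. (((**) A ^^ n) (mat 1)) /\<^sub>R fact n)"

definition bracket :: "real^2^2 \<Rightarrow> real^2^2 \<Rightarrow> real^2^2" where
  "bracket A B = A ** B - B ** A"

definition trace_form :: "real^2^2 \<Rightarrow> real^2^2 \<Rightarrow> real" where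
  "trace_form A B = trace (A ** B)"

definition SL2 :: "(real^2^2) set" where
  "SL2 = {A. det A = 1}"

definition sl2 :: "(real^2^2) set" where
  "sl2 = {A. trace A = 0}"

definition J :: "real^2^2" where
  "J = mat2 0 (-1) 1 0"

definition R :: "real^2^2" where
  "R = mexp ((pi / 3) *\<^sub>R J)"

definition upper_half_plane :: "complex set" where
  "upper_half_plane = {z. Im z > 0}"

definition upper_half_plane_star :: "complex set" where
  "upper_half_plane_star =
     {z \<in> upper_half_plane. \<bar>Re z\<bar> < 1 / sqrt 3 \<and> (Re z)\<^sup>2 + (Im z)\<^sup>2 > 1/3}"

definition moebius :: "real^2^2 \<Rightarrow> complex \<Rightarrow> complex" where
  "moebius A z = (of_real (A$1$1) * z + of_real (A$1$2)) / (of_real (A$2$1) * z + of_real (A$2$2))"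

definition X :: "complex \<Rightarrow> real^2^2" where
  "X z = (let x = Re z; y = Im z in mat2 (x / y) (- x\<^sup>2 / y - y) (1 / y) (- x / y))"

section \<open>Controls and state equations\<close>

type_synonym control = "real \<times> real \<times> real"

definition control_set :: "control set" where
  "control_set = {(u0, u1, u2). u0 + u1 + u2 = 1 \<and> u0 \<ge> 0 \<and> u1 \<ge> 0 \<and> u2 \<ge> 0}"

definition e1 :: control where "e1 = (1, 0, 0)"
definition e2 :: control where "e2 = (0, 1, 0)"
definition e3 :: control where "e3 = (0, 0, 1)"

definition ctrl_a :: "control \<Rightarrow> real" where
  "ctrl_a = (\<lambda>(u0, u1, u2). (u1 - u2) / sqrt 3)"

definition ctrl_b :: "control \<Rightarrow> real" where
  "ctrl_b = (\<lambda>(u0, u1, u2). u0 / 3 - 2 * u1 / 3 - 2 * u2 / 3)"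

definition ctrl_c :: "control \<Rightarrow> real" where
  "ctrl_c = (\<lambda>(u0, u1, u2). u0)"

definition f1 :: "real \<Rightarrow> real \<Rightarrow> control \<Rightarrow> real" where
  "f1 x y u = (let a = ctrl_a u; b = ctrl_b u; c = ctrl_c u in
     y * (b + 2 * a * x - c * x\<^sup>2 + c * y\<^sup>2) / (b + 2 * a * x - c * x\<^sup>2 - c * y\<^sup>2))"

definition f2 :: "real \<Rightarrow> real \<Rightarrow> control \<Rightarrow> real" where
  "f2 x y u = (let a = ctrl_a u; b = ctrl_b u; c = ctrl_c u in
     2 * (a - c * x) * y\<^sup>2 / (b + 2 * a * x - c * x\<^sup>2 - c * y\<^sup>2))"

text \<open>The library's \<open>absolutely_continuous\<close> is about measures; this is the notion for curves on
  a compact interval.\<close>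

definition abs_continuous_on :: "real \<Rightarrow> real \<Rightarrow> (real \<Rightarrow> 'a::metric_space) \<Rightarrow> bool" where
  "abs_continuous_on a b f \<longleftrightarrow>
     (\<forall>\<epsilon>>0. \<exists>\<delta>>0. \<forall>D. finite D \<and> (\<forall>(s, t)\<in>D. a \<le> s \<and> s < t \<and> t \<le> b) \<and>
        pairwise (\<lambda>(s, t) (s', t'). {s<..<t} \<inter> {s'<..<t'} = {}) D \<and>
        (\<Sum>(s, t)\<in>D. t - s) < \<delta>
        \<longrightarrow> (\<Sum>(s, t)\<in>D. dist (f s) (f t)) < \<epsilon>)"

definition trajectory ::
  "real \<Rightarrow> (real \<Rightarrow> control) \<Rightarrow> (real \<Rightarrow> real^2^2) \<Rightarrow> (real \<Rightarrow> complex) \<Rightarrow> bool" where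
  "trajectory tf u g z \<longleftrightarrow>
     tf > 0 \<and>
     u \<in> borel_measurable (lebesgue_on {0..tf}) \<and> u ` {0..tf} \<subseteq> control_set \<and>
     g ` {0..tf} \<subseteq> SL2 \<and> z ` {0..tf} \<subseteq> upper_half_plane \<and>
     abs_continuous_on 0 tf (\<lambda>t. (g t, z t)) \<and>
     (AE t in lebesgue_on {0..tf}.
        (z has_vector_derivative
           Complex (f1 (Re (z t)) (Im (z t)) (u t)) (f2 (Re (z t)) (Im (z t)) (u t)))
          (at t within {0..tf}) \<and>
        (g has_vector_derivative (g t ** X (z t))) (at t within {0..tf}))"

text \<open>The two curves compared by \<^const>\<open>homotopic_paths\<close> are reparametrized from
  \<open>[0, tf]\<close> to \<open>[0, 1]\<close>.\<close>

definition admissible ::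
  "real \<Rightarrow> (real \<Rightarrow> control) \<Rightarrow> (real \<Rightarrow> real^2^2) \<Rightarrow> (real \<Rightarrow> complex) \<Rightarrow> bool" where
  "admissible tf u g z \<longleftrightarrow>
     trajectory tf u g z \<and>
     z ` {0..tf} \<subseteq> upper_half_plane_star \<and>
     g 0 = mat 1 \<and> g tf = R \<and> z tf = moebius (matrix_inv R) (z 0) \<and>
     homotopic_paths SL2 (g \<circ> (\<lambda>s. tf * s))
       ((\<lambda>t. mexp ((pi * t / (3 * tf)) *\<^sub>R J)) \<circ> (\<lambda>s. tf * s))"

section \<open>Pontryagin extremals\<close>

text \<open>The covector \<open>(\<nu>\<^sub>1, \<nu>\<^sub>2)\<close> is the complex number \<open>\<nu>\<^sub>1 + i \<nu>\<^sub>2\<close>. Its pairing with a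
  tangent vector \<open>v\<^sub>1 + i v\<^sub>2\<close> is then the real inner product of \<^typ>\<open>complex\<close>, for which
  \<^const>\<open>adjoint\<close> is the transpose.\<close>

definition hamiltonian ::
  "real \<Rightarrow> real^2^2 \<Rightarrow> complex \<Rightarrow> complex \<Rightarrow> control \<Rightarrow> real" where
  "hamiltonian lcost \<Lambda> z \<nu> u =
     trace_form \<Lambda> (X z) - 3/2 * lcost * trace_form J (X z)
     + Re \<nu> * f1 (Re z) (Im z) u + Im \<nu> * f2 (Re z) (Im z) u"

text \<open>For \<open>z\<close> in \<^const>\<open>upper_half_plane_star\<close> the denominator of \<open>f1\<close>, \<open>f2\<close> does not
  vanish on the compact \<^const>\<open>control_set\<close>, so there the supremum is a maximum.\<close>

definition hamiltonian_max ::
  "real \<Rightarrow> real^2^2 \<Rightarrow> complex \<Rightarrow> complex \<Rightarrow> real" where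
  "hamiltonian_max lcost \<Lambda> z \<nu> = (SUP u\<in>control_set. hamiltonian lcost \<Lambda> z \<nu> u)"

definition lifted_trajectory ::
  "real \<Rightarrow> real \<Rightarrow> (real \<Rightarrow> control) \<Rightarrow> (real \<Rightarrow> real^2^2) \<Rightarrow> (real \<Rightarrow> complex)
    \<Rightarrow> (real \<Rightarrow> real^2^2) \<Rightarrow> (real \<Rightarrow> complex) \<Rightarrow> bool" where
  "lifted_trajectory lcost tf u g z \<Lambda> \<nu> \<longleftrightarrow>
     admissible tf u g z \<and>
     \<Lambda> ` {0..tf} \<subseteq> sl2 \<and>
     (\<exists>C. C-lipschitz_on {0..tf} (\<lambda>t. ((g t, \<Lambda> t), (z t, \<nu> t)))) \<and>
     (AE t in lebesgue_on {0..tf}.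
        (\<Lambda> has_vector_derivative bracket (\<Lambda> t) (X (z t))) (at t within {0..tf}) \<and>
        ((\<lambda>s. Re (\<nu> s)) has_real_derivative
           - deriv (\<lambda>x. hamiltonian lcost (\<Lambda> t) (Complex x (Im (z t))) (\<nu> t) (u t)) (Re (z t)))
          (at t within {0..tf}) \<and>
        ((\<lambda>s. Im (\<nu> s)) has_real_derivative
           - deriv (\<lambda>y. hamiltonian lcost (\<Lambda> t) (Complex (Re (z t)) y) (\<nu> t) (u t)) (Im (z t)))
          (at t within {0..tf}))"

definition pontryagin_extremal ::
  "real \<Rightarrow> real \<Rightarrow> (real \<Rightarrow> control) \<Rightarrow> (real \<Rightarrow> real^2^2) \<Rightarrow> (real \<Rightarrow> complex)
    \<Rightarrow> (real \<Rightarrow> real^2^2) \<Rightarrow> (real \<Rightarrow> complex) \<Rightarrow> bool" where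
  "pontryagin_extremal lcost tf u g z \<Lambda> \<nu> \<longleftrightarrow>
     lifted_trajectory lcost tf u g z \<Lambda> \<nu> \<and>
     (AE t in lebesgue_on {0..tf}.
        hamiltonian lcost (\<Lambda> t) (z t) (\<nu> t) (u t) = hamiltonian_max lcost (\<Lambda> t) (z t) (\<nu> t) \<and>
        hamiltonian_max lcost (\<Lambda> t) (z t) (\<nu> t) = 0) \<and>
     (\<forall>t\<in>{0..tf}. (lcost, \<Lambda> t, \<nu> t) \<noteq> 0) \<and>
     lcost \<in> {0, -1} \<and>
     \<Lambda> tf = matrix_inv R ** \<Lambda> 0 ** R \<and>
     adjoint (frechet_derivative (moebius (matrix_inv R)) (at (z 0))) (\<nu> tf) = \<nu> 0"

section \<open>The smoothed regular polygon with 6k+2 sides\<close>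

definition theta :: "nat \<Rightarrow> real" where
  "theta k = pi * real k / real (3 * k + 1)"

definition polygon_data :: "nat \<Rightarrow> real \<Rightarrow> real \<Rightarrow> bool" where
  "polygon_data k y \<tau> \<longleftrightarrow>
     0 < y \<and> y < 1 \<and> 0 < \<tau> \<and>
     (\<exists>g z. trajectory \<tau> (\<lambda>_. e3) g z \<and> g 0 = mat 1 \<and> z 0 = Complex 0 y \<and>
        z \<tau> = moebius (matrix_inv R) (Complex 0 y) \<and>
        trace (matrix_inv R ** g \<tau>) = 2 * cos (theta k))"

text \<open>Controls \<open>e3, e1, e2, e3, e1, e2, \<dots>\<close> on successive half-open intervals of length \<open>\<tau>\<close>;
  the values at the finitely many switching times are immaterial.\<close>

definition polygon_control :: "real \<Rightarrow> real \<Rightarrow> control" where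
  "polygon_control \<tau> t = [e3, e1, e2] ! (nat \<lfloor>t / \<tau>\<rfloor> mod 3)"

definition smoothed_polygon ::
  "nat \<Rightarrow> real \<Rightarrow> real \<Rightarrow> (real \<Rightarrow> real^2^2) \<Rightarrow> (real \<Rightarrow> complex) \<Rightarrow> bool" where
  "smoothed_polygon k y \<tau> g z \<longleftrightarrow>
     polygon_data k y \<tau> \<and>
     trajectory (real (3 * k + 1) * \<tau>) (polygon_control \<tau>) g z \<and>
     g 0 = mat 1 \<and> z 0 = Complex 0 y"

end

theory Submission
  imports Defs
begin

text \<open>
  Why the theorem holds. The rotation \<open>z \<mapsto> R\<^sup>-\<^sup>1.z\<close> (\<open>rotate_z\<close>) is a symmetry of the whole control
  problem: together with conjugation of \<open>\<Lambda>\<close> by \<open>R\<close>, the cotangent action on \<open>\<nu>\<close>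
  (\<open>rotate_costate\<close>) and the cyclic permutation \<open>e3, e1, e2\<close> of the vertices
  (\<open>rotate_control\<close>), it preserves the state equations, the Hamiltonian
  (\<open>hamiltonian_rotate\<close>) and the costate equations (\<open>hamilton_costate_rotate\<close>). The polygon
  trajectory is the orbit of its first piece under this symmetry. It therefore suffices to find, over
  the first piece, a costate that satisfies the equations and the maximum principle and whose end
  value is the rotated copy of its initial value. Gluing the rotated copies then gives the extremal,
  and transversality at the end is one more instance of the matching condition.

  The first piece. With \<open>C = sqrt 3 * y\<close> and \<open>e = exp (C * t)\<close> the control \<open>e3\<close> moves \<open>z\<close>
  along a ray, and \<open>g\<close> is a rational function of \<open>e\<close>. The final value of \<open>e\<close> is
  \<open>E = 4 / (1 + C\<^sup>2)\<close>, which is \<open>2 * cos \<theta>\<close> for the polygon, so that \<open>1 < E < 2\<close>. The equation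
  \<open>\<Lambda>' = [\<Lambda>, X]\<close> says \<open>\<Lambda> = g\<^sup>-\<^sup>1 \<Lambda>0 g\<close>. The matching condition for \<open>\<Lambda>\<close> says that \<open>\<Lambda>0\<close> commutes
  with the \<open>holonomy\<close> \<open>g(\<tau>) R\<^sup>-\<^sup>1\<close>, hence is a multiple of its trace-free part. Two conditions
  remain: \<open>e2\<close> ties with \<open>e3\<close> in the Hamiltonian at the initial time, and \<open>e1\<close> ties with \<open>e3\<close> at
  the final time. They fix the free constant of \<open>\<nu>\<close> and the multiple, which is \<open>q + 2\<close> in the
  notation below.

  The maximum principle. The Hamiltonian is a quotient of two affine functions of the control, and the
  denominator is negative, so its sign has to be checked at the three vertices only
  (\<open>hamiltonian_le_0\<close>). It vanishes at \<open>e3\<close>. At \<open>e2\<close> and \<open>e1\<close> it is a negative multiple of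
  \<open>profile t\<close> and of \<open>profile (\<tau> - t)\<close>, where
  \<open>profile t = 1 - e + 2 * ln e + 2 * q * (1 - 1 / e)\<close>. This function vanishes at the start, has no
  interior minimum, and is nonnegative at the end by a rational lower bound of the logarithm
  (\<open>ln_ge_rational\<close>).

  Admissibility. The holonomy is elliptic and rotates by \<open>- \<theta>\<close>; after \<open>3 * k + 1\<close> pieces it is
  \<open>(- 1) ^ k\<close>, and \<open>g\<close> ends at \<open>R\<close>. The homotopy class is found by deforming \<open>g\<close>
  linearly to a product of two one-parameter groups: in \<open>SL\<^sub>2\<close> this is possible whenever the two
  curves \<open>p, q\<close> satisfy \<open>trace (q\<^sup>-\<^sup>1 p) > - 2\<close> (\<open>homotopic_paths_SL2\<close>).

  Uniqueness. A trajectory solves its equations only almost everywhere. An absolutely continuous curve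
  whose derivative agrees almost everywhere with a continuous function is differentiable everywhere
  (\<open>has_vector_derivative_AE_continuous\<close>), so every trajectory with the given initial
  value is the explicit one.
\<close>

section \<open>Absolutely continuous curves\<close>

lemma AE_lebesgue_on_iff_negligible:
  fixes a b :: real
  shows "(AE t in lebesgue_on {a..b}. P t) \<longleftrightarrow> negligible {t\<in>{a..b}. \<not> P t}"
proof -
  have "(AE t in lebesgue_on {a..b}. P t) \<longleftrightarrow> (AE t in lebesgue. t \<in> {a..b} \<longrightarrow> P t)"
    by (rule AE_restrict_space_iff) simp
  also have "\<dots> \<longleftrightarrow> negligible {t\<in>{a..b}. \<not> P t}"
  proof
    assume "AE t in lebesgue. t \<in> {a..b} \<longrightarrow> P t"
    then obtain N where N: "N \<in> null_sets lebesgue" "{t\<in>space lebesgue. \<not> (t \<in> {a..b} \<longrightarrow> P t)} \<subseteq> N"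
      unfolding eventually_ae_filter by blast
    have "negligible N" using N(1) by (simp add: negligible_iff_null_sets)
    moreover have "{t\<in>{a..b}. \<not> P t} \<subseteq> N" using N(2) by auto
    ultimately show "negligible {t\<in>{a..b}. \<not> P t}" by (rule negligible_subset)
  next
    assume "negligible {t\<in>{a..b}. \<not> P t}"
    then have "{t\<in>{a..b}. \<not> P t} \<in> null_sets lebesgue" by (simp add: negligible_iff_null_sets)
    then show "AE t in lebesgue. t \<in> {a..b} \<longrightarrow> P t" by (rule AE_I') auto
  qed
  finally show ?thesis .
qed

definition short_family :: "real \<Rightarrow> real \<Rightarrow> real \<Rightarrow> (real \<times> real) set \<Rightarrow> bool" where
  "short_family a b \<delta> D \<longleftrightarrow> finite D \<and> (\<forall>(s, t)\<in>D. a \<le> s \<and> s < t \<and> t \<le> b) \<and>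
     pairwise (\<lambda>(s, t) (s', t'). {s<..<t} \<inter> {s'<..<t'} = {}) D \<and> (\<Sum>(s, t)\<in>D. t - s) < \<delta>"

lemma abs_continuous_on_iff:
  "abs_continuous_on a b f \<longleftrightarrow>
     (\<forall>\<epsilon>>0. \<exists>\<delta>>0. \<forall>D. short_family a b \<delta> D \<longrightarrow> (\<Sum>(s, t)\<in>D. dist (f s) (f t)) < \<epsilon>)"
  unfolding abs_continuous_on_def short_family_def ..

lemma abs_continuous_on_Lipschitz_bound:
  fixes f :: "real \<Rightarrow> 'a::metric_space" and h :: "real \<Rightarrow> 'b::metric_space"
  assumes f: "abs_continuous_on a b f"
    and h: "\<And>s t. \<lbrakk>s \<in> {a..b}; t \<in> {a..b}\<rbrakk> \<Longrightarrow> dist (h s) (h t) \<le> L * dist (f s) (f t)"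
  shows "abs_continuous_on a b h"
  unfolding abs_continuous_on_iff
proof (intro allI impI)
  fix e :: real assume "e > 0"
  define M where "M = \<bar>L\<bar> + 1"
  have M: "M > 0" "L \<le> M" by (auto simp: M_def)
  have "e / M > 0" using \<open>e > 0\<close> M by simp
  with f obtain d where d: "d > 0" and D: "\<And>D. short_family a b d D \<Longrightarrow> (\<Sum>(s, t)\<in>D. dist (f s) (f t)) < e / M"
    unfolding abs_continuous_on_iff by meson
  show "\<exists>d>0. \<forall>D. short_family a b d D \<longrightarrow> (\<Sum>(s, t)\<in>D. dist (h s) (h t)) < e"
  proof (intro exI[of _ d] conjI allI impI d)
    fix D assume D': "short_family a b d D"
    note * = D'[unfolded short_family_def]
    have "(\<Sum>(s, t)\<in>D. dist (h s) (h t)) \<le> (\<Sum>(s, t)\<in>D. M * dist (f s) (f t))"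
    proof (rule sum_mono, clarify)
      fix s t assume "(s, t) \<in> D"
      with * have "s \<in> {a..b}" "t \<in> {a..b}" by (force, force)
      then have "dist (h s) (h t) \<le> L * dist (f s) (f t)" by (rule h)
      also have "\<dots> \<le> M * dist (f s) (f t)" using M by (simp add: mult_right_mono)
      finally show "dist (h s) (h t) \<le> M * dist (f s) (f t)" .
    qed
    also have "\<dots> = M * (\<Sum>(s, t)\<in>D. dist (f s) (f t))"
      by (simp add: sum_distrib_left case_prod_unfold)
    also have "\<dots> < e" using D[OF D'] M by (simp add: field_simps)
    finally show "(\<Sum>(s, t)\<in>D. dist (h s) (h t)) < e" .
  qed
qed

lemma abs_continuous_on_Lipschitz:
  fixes f :: "real \<Rightarrow> 'a::metric_space"
  assumes "L-lipschitz_on {a..b} f"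
  shows "abs_continuous_on a b f"
proof -
  have "abs_continuous_on a b (\<lambda>t::real. t)"
    unfolding abs_continuous_on_iff
  proof (intro allI impI)
    fix e :: real assume "e > 0"
    have "(\<Sum>(s, t)\<in>D. dist s t) = (\<Sum>(s, t)\<in>D. t - s)" if "\<forall>(s, t)\<in>D. a \<le> s \<and> s < t \<and> t \<le> b" for D
      using that by (intro sum.cong) (auto simp: dist_real_def)
    with \<open>e > 0\<close> show "\<exists>d>0. \<forall>D. short_family a b d D \<longrightarrow> (\<Sum>(s, t)\<in>D. dist s t) < e"
      by (intro exI[of _ e]) (auto simp: short_family_def)
  qed
  then show ?thesis
    by (rule abs_continuous_on_Lipschitz_bound[where L = L])
       (use assms in \<open>auto simp: lipschitz_on_def\<close>)
qed

lemma abs_continuous_on_imp_continuous_on: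
  assumes "abs_continuous_on a b f"
  shows "continuous_on {a..b} f"
  unfolding continuous_on_iff
proof (intro ballI allI impI)
  fix x e :: real assume x: "x \<in> {a..b}" and "e > 0"
  with assms obtain d where d: "d > 0" and D: "\<And>D. short_family a b d D \<Longrightarrow> (\<Sum>(s, t)\<in>D. dist (f s) (f t)) < e"
    unfolding abs_continuous_on_iff by meson
  show "\<exists>d>0. \<forall>y\<in>{a..b}. dist y x < d \<longrightarrow> dist (f y) (f x) < e"
  proof (intro exI[of _ d] conjI d ballI impI)
    fix y assume y: "y \<in> {a..b}" "dist y x < d"
    consider "y = x" | "y < x" | "x < y" by linarith
    then show "dist (f y) (f x) < e"
    proof cases
      case 2 then show ?thesis using D[of "{(y, x)}"] x y by (auto simp: short_family_def dist_real_def)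
    next
      case 3 then show ?thesis using D[of "{(x, y)}"] x y by (auto simp: short_family_def dist_real_def dist_commute)
    qed (use \<open>e > 0\<close> in auto)
  qed
qed

lemma abs_continuous_on_subset_shift:
  assumes f: "abs_continuous_on a b f" and "a \<le> c" "c + l \<le> b"
  shows "abs_continuous_on 0 l (\<lambda>t. f (c + t))"
  unfolding abs_continuous_on_iff
proof (intro allI impI)
  fix e :: real assume "e > 0"
  with f obtain d where d: "d > 0" and D: "\<And>D. short_family a b d D \<Longrightarrow> (\<Sum>(s, t)\<in>D. dist (f s) (f t)) < e"
    unfolding abs_continuous_on_iff by meson
  define sh where "sh = (\<lambda>(s::real, t::real). (c + s, c + t))"
  have inj: "inj_on sh D" for D by (auto simp: inj_on_def sh_def)
  show "\<exists>d>0. \<forall>D. short_family 0 l d D \<longrightarrow> (\<Sum>(s, t)\<in>D. dist (f (c + s)) (f (c + t))) < e"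
  proof (intro exI[of _ d] conjI allI impI d)
    fix D assume "short_family 0 l d D"
    note * = this[unfolded short_family_def]
    have "pairwise (\<lambda>(s, t) (s', t'). {s<..<t} \<inter> {s'<..<t'} = {}) (sh ` D)"
    proof (rule pairwiseI)
      fix st st' assume st: "st \<in> sh ` D" "st' \<in> sh ` D" "st \<noteq> st'"
      then obtain s t s' t' where h: "(s, t) \<in> D" "(s', t') \<in> D" "st = (c + s, c + t)" "st' = (c + s', c + t')"
        by (auto simp: sh_def)
      with st have "(s, t) \<noteq> (s', t')" by auto
      with h(1,2) * have "(case (s, t) of (s, t) \<Rightarrow> \<lambda>(s', t'). {s<..<t} \<inter> {s'<..<t'} = {}) (s', t')"
        by (blast dest: pairwiseD)
      then have "x - c \<notin> {s<..<t} \<inter> {s'<..<t'}" for x by simp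
      then have "x \<notin> {c + s<..<c + t} \<inter> {c + s'<..<c + t'}" for x by (simp add: algebra_simps)
      with h show "(case st of (s, t) \<Rightarrow> \<lambda>(s', t'). {s<..<t} \<inter> {s'<..<t'} = {}) st'"
        by (simp only: prod.case) blast
    qed
    moreover have "(\<Sum>(s, t)\<in>sh ` D. t - s) = (\<Sum>(s, t)\<in>D. t - s)"
      by (subst sum.reindex[OF inj]) (auto simp: sh_def case_prod_unfold intro!: sum.cong)
    moreover have "(\<Sum>(s, t)\<in>sh ` D. dist (f s) (f t)) = (\<Sum>(s, t)\<in>D. dist (f (c + s)) (f (c + t)))"
      by (subst sum.reindex[OF inj]) (auto simp: sh_def case_prod_unfold intro!: sum.cong)
    moreover have "\<forall>(s, t)\<in>sh ` D. a \<le> s \<and> s < t \<and> t \<le> b"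
      using * assms(2,3) by (fastforce simp: sh_def)
    ultimately show "(\<Sum>(s, t)\<in>D. dist (f (c + s)) (f (c + t))) < e"
      using D[of "sh ` D"] * by (simp add: short_family_def)
  qed
qed

lemma abs_continuous_on_diff:
  fixes f g :: "real \<Rightarrow> 'a::real_normed_vector"
  assumes f: "abs_continuous_on a b f" and g: "abs_continuous_on a b g"
  shows "abs_continuous_on a b (\<lambda>t. f t - g t)"
  unfolding abs_continuous_on_iff
proof (intro allI impI)
  fix e :: real assume "e > 0"
  then have "e / 2 > 0" by simp
  with f obtain d1 where d1: "d1 > 0" and D1: "\<And>D. short_family a b d1 D \<Longrightarrow> (\<Sum>(s, t)\<in>D. dist (f s) (f t)) < e / 2"
    unfolding abs_continuous_on_iff by meson
  from g \<open>e / 2 > 0\<close> obtain d2 where d2: "d2 > 0" and D2: "\<And>D. short_family a b d2 D \<Longrightarrow> (\<Sum>(s, t)\<in>D. dist (g s) (g t)) < e / 2"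
    unfolding abs_continuous_on_iff by meson
  show "\<exists>d>0. \<forall>D. short_family a b d D \<longrightarrow> (\<Sum>(s, t)\<in>D. dist (f s - g s) (f t - g t)) < e"
  proof (intro exI[of _ "min d1 d2"] conjI allI impI)
    fix D assume *: "short_family a b (min d1 d2) D"
    have "dist (f s - g s) (f t - g t) \<le> dist (f s) (f t) + dist (g s) (g t)" for s t
      using norm_triangle_ineq4[of "f s - f t" "g s - g t"] by (simp add: dist_norm algebra_simps)
    then have "(\<Sum>(s, t)\<in>D. dist (f s - g s) (f t - g t))
        \<le> (\<Sum>(s, t)\<in>D. dist (f s) (f t) + dist (g s) (g t))"
      by (intro sum_mono) auto
    also have "\<dots> = (\<Sum>(s, t)\<in>D. dist (f s) (f t)) + (\<Sum>(s, t)\<in>D. dist (g s) (g t))"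
      by (simp add: sum.distrib case_prod_unfold)
    also have "\<dots> < e" using D1[of D] D2[of D] * by (auto simp: short_family_def)
    finally show "(\<Sum>(s, t)\<in>D. dist (f s - g s) (f t - g t)) < e" .
  qed (use d1 d2 in auto)
qed

text \<open>Take a division that is fine for the following gauge. At a tag where \<open>f\<close> has a derivative
  \<open>d \<ge> 0\<close>, the increment of \<open>f\<close> is at least \<open>- \<epsilon>\<close> times the length of the
  interval. The tags in the exceptional set are confined to an open set of small measure, where absolute
  continuity bounds the total increment by \<open>\<epsilon>\<close>.\<close>

lemma abs_continuous_increment_ge:
  fixes f :: "real \<Rightarrow> real"
  assumes ac: "abs_continuous_on a b f" and "a \<le> b"
    and ae: "AE t in lebesgue_on {a..b}. \<exists>d\<ge>0. (f has_real_derivative d) (at t within {a..b})"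
  shows "f a \<le> f b"
proof -
  define N where "N = {t\<in>{a..b}. \<not> (\<exists>d\<ge>0. (f has_real_derivative d) (at t within {a..b}))}"
  have N: "negligible N" using ae unfolding AE_lebesgue_on_iff_negligible N_def .
  have bound: "f b - f a \<ge> - (e * (b - a)) - e" if "e > 0" for e
  proof -
    from ac that obtain \<delta> where \<delta>: "\<delta> > 0" and D: "\<And>D. short_family a b \<delta> D \<Longrightarrow> (\<Sum>(s, t)\<in>D. dist (f s) (f t)) < e"
      unfolding abs_continuous_on_iff by meson
    have "N \<in> lmeasurable" "measure lebesgue N = 0"
      using N negligible_imp_measurable negligible_imp_measure0 by blast+
    obtain U where "open U" "N \<subseteq> U" and UN: "U - N \<in> lmeasurable" "emeasure lebesgue (U - N) < ennreal \<delta>"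
      using sets_lebesgue_outer_open[OF fmeasurableD[OF \<open>N \<in> lmeasurable\<close>] \<delta>] by metis
    then have U: "open U" "N \<subseteq> U" by blast+
    have mU: "U \<in> lmeasurable" "measure lebesgue U < \<delta>"
    proof -
      have Ueq: "U = (U - N) \<union> N" using \<open>N \<subseteq> U\<close> by blast
      show "U \<in> lmeasurable" using UN \<open>N \<in> lmeasurable\<close> by (subst Ueq) (rule fmeasurable.Un)
      have "measure lebesgue U \<le> measure lebesgue (U - N) + measure lebesgue N"
        using measure_Un_le[of "U - N" lebesgue N] UN \<open>N \<in> lmeasurable\<close> Ueq by (auto simp: fmeasurable_def)
      also have "\<dots> < \<delta>"
        using UN \<open>measure lebesgue N = 0\<close> \<delta> by (simp add: emeasure_eq_measure2 ennreal_less_iff)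
      finally show "measure lebesgue U < \<delta>" .
    qed
    note U = U mU
    have "\<exists>r>0. if x \<in> N then ball x r \<subseteq> U else
        (x \<in> {a..b} \<longrightarrow> (\<forall>y\<in>{a..b}. dist y x < r \<longrightarrow> (y - x) * (f y - f x) \<ge> - (e * (y - x)\<^sup>2)))" for x
    proof (cases "x \<in> N")
      case True with U show ?thesis by (auto simp: open_contains_ball)
    next
      case False
      show ?thesis
      proof (cases "x \<in> {a..b}")
        case True
        with False obtain d where d: "d \<ge> 0" "(f has_real_derivative d) (at x within {a..b})"
          by (auto simp: N_def)
        then have "(f has_derivative (\<lambda>h. d * h)) (at x within {a..b})"
          by (simp add: has_field_derivative_def mult_commute_abs)
        then obtain r where r: "r > 0" "\<And>y. \<lbrakk>y\<in>{a..b}; norm (y - x) < r\<rbrakk>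
             \<Longrightarrow> norm (f y - f x - d * (y - x)) \<le> e * norm (y - x)"
          using \<open>e > 0\<close> unfolding has_derivative_within_alt by blast
        have "(y - x) * (f y - f x) \<ge> - (e * (y - x)\<^sup>2)" if "y \<in> {a..b}" "dist y x < r" for y
        proof -
          have "\<bar>f y - f x - d * (y - x)\<bar> \<le> e * \<bar>y - x\<bar>"
            using r(2) that by (simp add: dist_norm)
          then have "\<bar>y - x\<bar> * \<bar>f y - f x - d * (y - x)\<bar> \<le> \<bar>y - x\<bar> * (e * \<bar>y - x\<bar>)"
            by (rule mult_left_mono) simp
          then have "\<bar>(y - x) * (f y - f x - d * (y - x))\<bar> \<le> e * (y - x)\<^sup>2"
            by (simp add: power2_eq_square mult.assoc mult.left_commute flip: abs_mult)
          then have "(y - x) * (f y - f x) - d * (y - x)\<^sup>2 \<ge> - (e * (y - x)\<^sup>2)"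
            by (simp add: power2_eq_square algebra_simps abs_le_iff)
          moreover have "d * (y - x)\<^sup>2 \<ge> 0" using d by simp
          ultimately show ?thesis by linarith
        qed
        with False r(1) show ?thesis by auto
      qed (use False in \<open>auto intro: exI[of _ 1]\<close>)
    qed
    then obtain r where r: "\<And>x. r x > 0" and rN: "\<And>x. x \<in> N \<Longrightarrow> ball x (r x) \<subseteq> U"
      and rG: "\<And>x y. \<lbrakk>x \<notin> N; x \<in> {a..b}; y \<in> {a..b}; dist y x < r x\<rbrakk>
         \<Longrightarrow> (y - x) * (f y - f x) \<ge> - (e * (y - x)\<^sup>2)"
      by metis
    have "gauge (\<lambda>x. ball x (r x))" using r by (simp add: gauge_ball_dependent)
    then obtain p where p: "p tagged_division_of {a..b}" "(\<lambda>x. ball x (r x)) fine p"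
      using fine_division_exists_real by blast
    note pd = tagged_division_ofD[OF p(1)]
    define G where "G = {xK\<in>p. fst xK \<notin> N}"
    define B where "B = {xK\<in>p. fst xK \<in> N \<and> Inf (snd xK) < Sup (snd xK)}"
    define I where "I = (\<lambda>xK::real \<times> real set. (Inf (snd xK), Sup (snd xK)) :: real \<times> real)"
    have K: "\<exists>u v. K = {u..v} \<and> u \<le> v \<and> Inf K = u \<and> Sup K = v \<and> a \<le> u \<and> v \<le> b \<and> u \<le> x \<and> x \<le> v \<and>
        {u..v} \<subseteq> ball x (r x)" if xK: "(x, K) \<in> p" for x K
    proof -
      obtain u v where uv: "K = {u..v}" using pd(4)[OF xK] by auto
      have "x \<in> K" "K \<subseteq> {a..b}" using pd xK by blast+
      moreover have "K \<subseteq> ball x (r x)" using p(2) xK by (auto simp: fine_def)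
      ultimately show ?thesis using uv by auto
    qed
    have good: "f (Sup K) - f (Inf K) \<ge> - (e * (Sup K - Inf K))" if "(x, K) \<in> p" "x \<notin> N" for x K
    proof -
      obtain u v where uv: "K = {u..v}" "u \<le> v" "Inf K = u" "Sup K = v" "a \<le> u" "v \<le> b" "u \<le> x" "x \<le> v"
        "{u..v} \<subseteq> ball x (r x)" using K[OF \<open>(x, K) \<in> p\<close>] by blast
      have "dist u x < r x" "dist v x < r x" using uv(2,9) by (auto simp: dist_commute subset_eq)
      then have 1: "(u - x) * (f u - f x) \<ge> - (e * (u - x)\<^sup>2)" "(v - x) * (f v - f x) \<ge> - (e * (v - x)\<^sup>2)"
        using rG[OF \<open>x \<notin> N\<close>] uv by auto
      have "f x - f u \<ge> - (e * (x - u))"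
      proof (cases "u = x")
        case False
        have "(x - u) * (f x - f u) \<ge> (x - u) * (- (e * (x - u)))"
          using 1(1) by (simp add: power2_eq_square algebra_simps)
        then show ?thesis by (rule mult_left_le_imp_le) (use False uv in simp)
      qed auto
      moreover have "f v - f x \<ge> - (e * (v - x))"
      proof (cases "v = x")
        case False
        have "(v - x) * (f v - f x) \<ge> (v - x) * (- (e * (v - x)))"
          using 1(2) by (simp add: power2_eq_square algebra_simps)
        then show ?thesis by (rule mult_left_le_imp_le) (use False uv in simp)
      qed auto
      ultimately show ?thesis using uv by (simp add: algebra_simps)
    qed
    have disj: "{Inf K<..<Sup K} \<inter> {Inf K'<..<Sup K'} = {}"
      if "(x, K) \<in> p" "(x', K') \<in> p" "(x, K) \<noteq> (x', K')" for x K x' K'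
    proof -
      have "interior L = {Inf L<..<Sup L}" if "(y, L) \<in> p" for y L
        using K[OF that] by (metis interior_atLeastAtMost_real)
      moreover have "interior K \<inter> interior K' = {}" using pd(5) that by blast
      ultimately show ?thesis using that(1,2) by metis
    qed
    have injI: "inj_on I B"
    proof (rule inj_onI, rule ccontr)
      fix xK xK' assume h: "xK \<in> B" "xK' \<in> B" "I xK = I xK'" "xK \<noteq> xK'"
      then have "{Inf (snd xK)<..<Sup (snd xK)} \<inter> {Inf (snd xK')<..<Sup (snd xK')} = {}"
        using disj[of "fst xK" "snd xK" "fst xK'" "snd xK'"] by (auto simp: B_def)
      with h show False by (auto simp: I_def B_def)
    qed
    have finp: "finite p" by (rule pd(1))
    then have finB: "finite B" by (simp add: B_def)
    have dI: "disjoint_family_on (\<lambda>(s, t). {s<..<t}) (I ` B)"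
      unfolding disjoint_family_on_def
    proof (intro ballI impI)
      fix st st' assume "st \<in> I ` B" "st' \<in> I ` B" "st \<noteq> st'"
      then obtain xK xK' where "xK \<in> B" "xK' \<in> B" "st = I xK" "st' = I xK'" "xK \<noteq> xK'" by blast
      then show "(case st of (s, t) \<Rightarrow> {s<..<t}) \<inter> (case st' of (s, t) \<Rightarrow> {s<..<t}) = {}"
        using disj[of "fst xK" "snd xK" "fst xK'" "snd xK'"] by (auto simp: B_def I_def)
    qed
    \<comment> \<open>The intervals with a tag in \<open>N\<close> are disjoint and lie in \<open>U\<close>, so their total length is below \<open>\<delta>\<close>.\<close>
    have "(\<Sum>(s, t)\<in>I ` B. t - s) = (\<Sum>st\<in>I ` B. measure lebesgue ((\<lambda>(s, t). {s<..<t}) st))"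
      by (intro sum.cong) (auto simp: B_def I_def)
    also have "\<dots> = measure lebesgue (\<Union>st\<in>I ` B. (\<lambda>(s, t). {s<..<t}) st)"
    proof (rule measure_finite_Union[symmetric])
      have "emeasure lebesgue {s<..<t} \<noteq> \<infinity>" for s t :: real
        by (cases "s \<le> t") auto
      then show "emeasure lebesgue (case st of (s, t) \<Rightarrow> {s<..<t}) \<noteq> \<infinity>" for st :: "real \<times> real"
        by (simp add: case_prod_unfold)
    qed (use finB dI in \<open>auto simp: case_prod_unfold\<close>)
    also have "\<dots> \<le> measure lebesgue U"
    proof (rule measure_mono_fmeasurable)
      show "(\<Union>st\<in>I ` B. (\<lambda>(s, t). {s<..<t}) st) \<subseteq> U"
      proof (rule UN_least)
        fix st assume "st \<in> I ` B"
        then obtain x L where xL: "(x, L) \<in> p" "x \<in> N" "st = (Inf L, Sup L)"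
          by (force simp: B_def I_def)
        from K[OF xL(1)] have "{Inf L<..<Sup L} \<subseteq> ball x (r x)" by (auto simp: subset_eq)
        with rN[OF xL(2)] xL(3) show "(case st of (s, t) \<Rightarrow> {s<..<t}) \<subseteq> U" by auto
      qed
      show "(\<Union>st\<in>I ` B. (\<lambda>(s, t). {s<..<t}) st) \<in> sets lebesgue"
        by (auto intro!: finB simp: case_prod_unfold)
    qed (rule U)
    finally have small: "(\<Sum>(s, t)\<in>I ` B. t - s) < \<delta>" using U by simp
    have "(\<Sum>(s, t)\<in>I ` B. dist (f s) (f t)) < e"
    proof (rule D, unfold short_family_def, intro conjI)
      show "\<forall>(s, t)\<in>I ` B. a \<le> s \<and> s < t \<and> t \<le> b"
        using K by (fastforce simp: B_def I_def)
      show "pairwise (\<lambda>(s, t) (s', t'). {s<..<t} \<inter> {s'<..<t'} = {}) (I ` B)"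
        using dI unfolding disjoint_family_on_def pairwise_def case_prod_unfold by blast
    qed (use finB small in auto)
    then have bad: "(\<Sum>xK\<in>B. \<bar>f (Sup (snd xK)) - f (Inf (snd xK))\<bar>) < e"
      by (subst (asm) sum.reindex[OF injI]) (simp add: I_def dist_real_def abs_minus_commute)
    have "f b - f a = (\<Sum>(x, K)\<in>p. f (Sup K) - f (Inf K))"
      using additive_tagged_division_1[OF \<open>a \<le> b\<close> p(1), of f] by simp
    also have "\<dots> = (\<Sum>xK\<in>p. f (Sup (snd xK)) - f (Inf (snd xK)))" by (simp add: case_prod_unfold)
    also have "\<dots> \<ge> (\<Sum>xK\<in>p. - (e * (Sup (snd xK) - Inf (snd xK)))
        - (if xK \<in> B then \<bar>f (Sup (snd xK)) - f (Inf (snd xK))\<bar> else 0))"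
    proof (rule sum_mono, clarify, goal_cases)
      case (1 x K)
      consider "x \<notin> N" | "(x, K) \<in> B" | "x \<in> N" "Inf K = Sup K"
        using 1 K[OF 1] by (force simp: B_def)
      then show ?case
      proof cases
        case 1 with good[OF \<open>(x, K) \<in> p\<close>] show ?thesis by (auto simp: B_def)
      next
        case 2
        have "e * (Sup K - Inf K) \<ge> 0" using 2 \<open>e > 0\<close> by (simp add: B_def)
        with 2 show ?thesis by auto
      next
        case 3 then show ?thesis by (auto simp: B_def)
      qed
    qed
    also have "(\<Sum>xK\<in>p. - (e * (Sup (snd xK) - Inf (snd xK)))
        - (if xK \<in> B then \<bar>f (Sup (snd xK)) - f (Inf (snd xK))\<bar> else 0))
      = - (e * (\<Sum>(x, K)\<in>p. Sup K - Inf K)) - (\<Sum>xK\<in>B. \<bar>f (Sup (snd xK)) - f (Inf (snd xK))\<bar>)"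
    proof -
      have "(\<Sum>xK\<in>p. if xK \<in> B then \<bar>f (Sup (snd xK)) - f (Inf (snd xK))\<bar> else 0) =
        (\<Sum>xK\<in>B. \<bar>f (Sup (snd xK)) - f (Inf (snd xK))\<bar>)"
        using finp by (subst sum.inter_filter[symmetric]) (auto simp: B_def intro!: sum.cong)
      then show ?thesis
        by (simp add: sum_subtractf sum_distrib_left sum_negf case_prod_unfold right_diff_distrib)
    qed
    also have "(\<Sum>(x, K)\<in>p. Sup K - Inf K) = b - a"
      using additive_tagged_division_1[OF \<open>a \<le> b\<close> p(1), of "\<lambda>x. x"] by simp
    finally show ?thesis using bad by linarith
  qed
  then have *: "f a - f b \<le> e * (b - a + 1)" if "e > 0" for e
    using bound[OF that] by (simp add: algebra_simps)
  show ?thesis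
  proof (rule ccontr)
    assume "\<not> ?thesis"
    then have less: "f b < f a" by simp
    define \<epsilon> where "\<epsilon> = (f a - f b) / (2 * (b - a + 1))"
    have "\<epsilon> > 0" using less \<open>a \<le> b\<close> by (simp add: \<epsilon>_def)
    then have "f a - f b \<le> \<epsilon> * (b - a + 1)" by (rule *)
    also have "\<dots> = (f a - f b) / 2" using \<open>a \<le> b\<close> by (simp add: \<epsilon>_def divide_simps)
    finally show False using less by simp
  qed
qed

lemma abs_continuous_on_subinterval:
  assumes f: "abs_continuous_on a' b' f" and sub: "a' \<le> a" "b \<le> b'"
  shows "abs_continuous_on a b f"
  unfolding abs_continuous_on_iff
proof (intro allI impI)
  fix e :: real assume "e > 0"
  with f obtain d where d: "d > 0" and D: "\<And>D. short_family a' b' d D \<Longrightarrow> (\<Sum>(s, t)\<in>D. dist (f s) (f t)) < e"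
    unfolding abs_continuous_on_iff by meson
  show "\<exists>d>0. \<forall>D. short_family a b d D \<longrightarrow> (\<Sum>(s, t)\<in>D. dist (f s) (f t)) < e"
  proof (intro exI[of _ d] conjI allI impI d)
    fix D assume *: "short_family a b d D"
    then have "short_family a' b' d D" using sub unfolding short_family_def by fastforce
    then show "(\<Sum>(s, t)\<in>D. dist (f s) (f t)) < e" by (rule D)
  qed
qed

lemma lipschitz_of_continuous_derivative:
  fixes f :: "real \<Rightarrow> 'a::real_normed_vector"
  assumes d: "\<And>t. t \<in> {a..b} \<Longrightarrow> (f has_vector_derivative f' t) (at t within {a..b})"
    and c: "continuous_on {a..b} f'"
  shows "\<exists>L. L-lipschitz_on {a..b} f"
proof -
  have "bounded (f' ` {a..b})" by (intro compact_imp_bounded compact_continuous_image c) simp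
  then obtain M where M: "\<And>t. t \<in> {a..b} \<Longrightarrow> norm (f' t) \<le> M" "M > 0"
    unfolding bounded_pos by (metis (no_types, lifting) image_eqI)
  have "M-lipschitz_on {a..b} f"
    by (rule bounded_derivative_imp_lipschitz[where f' = "\<lambda>t h. h *\<^sub>R f' t"])
       (use d M in \<open>auto simp: has_vector_derivative_def intro!: onorm_le simp: mult.commute[of _ "\<bar>_\<bar>"] mult_left_mono\<close>)
  then show ?thesis by blast
qed

text \<open>The difference of \<open>f\<close> and the indefinite integral of \<open>\<phi>\<close> is absolutely continuous with derivative
  zero almost everywhere. Both signs of the monotonicity statement, coordinate by coordinate, make it
  constant.\<close>

lemma has_vector_derivative_AE_continuous:
  fixes f \<phi> :: "real \<Rightarrow> 'a::euclidean_space"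
  assumes ac: "abs_continuous_on a b f" and \<phi>: "continuous_on {a..b} \<phi>"
    and ae: "AE t in lebesgue_on {a..b}. (f has_vector_derivative \<phi> t) (at t within {a..b})"
    and t: "t \<in> {a..b}"
  shows "(f has_vector_derivative \<phi> t) (at t within {a..b})"
proof -
  define G where "G = (\<lambda>t. integral {a..t} \<phi>)"
  have dG: "(G has_vector_derivative \<phi> t) (at t within {a..b})" if "t \<in> {a..b}" for t
    unfolding G_def by (rule integral_has_vector_derivative[OF \<phi> that])
  obtain L where "L-lipschitz_on {a..b} G"
    using lipschitz_of_continuous_derivative[OF dG \<phi>] by blast
  then have acG: "abs_continuous_on a b G" by (rule abs_continuous_on_Lipschitz)
  have const: "f s - G s = f a - G a" if s: "s \<in> {a..b}" for s
  proof (rule euclidean_eqI)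
    fix i :: 'a assume i: "i \<in> Basis"
    have 1: "c * ((f a - G a) \<bullet> i) \<le> c * ((f s - G s) \<bullet> i)" for c :: real
    proof (rule abs_continuous_increment_ge[where f = "\<lambda>t. c * ((f t - G t) \<bullet> i)"])
      have "abs_continuous_on a b (\<lambda>t. c * ((f t - G t) \<bullet> i))"
      proof (rule abs_continuous_on_Lipschitz_bound[OF abs_continuous_on_diff[OF ac acG], where L = "\<bar>c\<bar>"])
        fix s t
        have "\<bar>(f s - G s) \<bullet> i - (f t - G t) \<bullet> i\<bar> \<le> norm ((f s - G s) - (f t - G t))"
          using Basis_le_norm[OF i, of "(f s - G s) - (f t - G t)"] by (simp add: inner_diff_left)
        then show "dist (c * ((f s - G s) \<bullet> i)) (c * ((f t - G t) \<bullet> i)) \<le> \<bar>c\<bar> * dist (f s - G s) (f t - G t)"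
          by (simp add: dist_norm right_diff_distrib[symmetric] abs_mult mult_left_mono)
      qed
      then show "abs_continuous_on a s (\<lambda>t. c * ((f t - G t) \<bullet> i))"
        by (rule abs_continuous_on_subinterval) (use s in auto)
      have "{t \<in> {a..s}. \<not> (\<exists>d\<ge>0. ((\<lambda>t. c * ((f t - G t) \<bullet> i)) has_real_derivative d) (at t within {a..s}))}
        \<subseteq> {t\<in>{a..b}. \<not> (f has_vector_derivative \<phi> t) (at t within {a..b})}"
      proof (safe, goal_cases)
        case (2 t)
        then have t: "t \<in> {a..b}" using s by auto
        have "((\<lambda>t. f t - G t) has_vector_derivative \<phi> t - \<phi> t) (at t within {a..b})"
          by (intro has_vector_derivative_diff 2 dG t)
        then have "((\<lambda>t. f t - G t) has_vector_derivative 0) (at t within {a..b})" by simp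
        then have "((\<lambda>t. f t - G t) has_vector_derivative 0) (at t within {a..s})"
          by (rule has_vector_derivative_within_subset) (use s in auto)
        then have "((\<lambda>t. (f t - G t) \<bullet> i) has_vector_derivative 0 \<bullet> i) (at t within {a..s})"
          by (rule bounded_linear.has_vector_derivative[OF bounded_linear_inner_left])
        then have "((\<lambda>t. c * ((f t - G t) \<bullet> i)) has_real_derivative c * 0) (at t within {a..s})"
          by (intro DERIV_cmult) (simp add: has_real_derivative_iff_has_vector_derivative)
        then show False using 2 by auto
      qed (use s in auto)
      then show "AE t in lebesgue_on {a..s}. \<exists>d\<ge>0. ((\<lambda>t. c * ((f t - G t) \<bullet> i)) has_real_derivative d) (at t within {a..s})"
        using ae unfolding AE_lebesgue_on_iff_negligible by (rule negligible_subset[rotated])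
    qed (use s in auto)
    from 1[of 1] 1[of "-1"] show "(f s - G s) \<bullet> i = (f a - G a) \<bullet> i" by simp
  qed
  have "((\<lambda>s. G s + (f a - G a)) has_vector_derivative \<phi> t + 0) (at t within {a..b})"
    by (intro has_vector_derivative_add dG t has_vector_derivative_const)
  then have "((\<lambda>s. G s + (f a - G a)) has_vector_derivative \<phi> t) (at t within {a..b})" by simp
  moreover have "f s = G s + (f a - G a)" if "s \<in> {a..b}" for s
    unfolding const[OF that, symmetric] by simp
  ultimately show ?thesis
    by (rule has_vector_derivative_transform[OF t, rotated])
qed

section \<open>Two by two matrices\<close>

lemma mat2_nth [simp]:
  "mat2 a b c d $ 1 $ 1 = a" "mat2 a b c d $ 1 $ 2 = b"
  "mat2 a b c d $ 2 $ 1 = c" "mat2 a b c d $ 2 $ 2 = d"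
  by (simp_all add: mat2_def)

lemma mat2_eqI:
  fixes A B :: "real^2^2"
  assumes "A$1$1 = B$1$1" "A$1$2 = B$1$2" "A$2$1 = B$2$1" "A$2$2 = B$2$2"
  shows "A = B"
  using assms by (simp add: vec_eq_iff forall_2)

lemma mat2_cases:
  fixes A :: "real^2^2"
  obtains a b c d where "A = mat2 a b c d"
  by (rule that[of "A$1$1" "A$1$2" "A$2$1" "A$2$2"]) (rule mat2_eqI; simp)

lemma mat2_mult: "mat2 a b c d ** mat2 a' b' c' d' =
    mat2 (a * a' + b * c') (a * b' + b * d') (c * a' + d * c') (c * b' + d * d')"
  by (rule mat2_eqI) (simp_all add: matrix_matrix_mult_def sum_2)

lemma mat2_mat: "mat x = mat2 x 0 0 x"
  by (rule mat2_eqI) (simp_all add: mat_def)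

lemma mat2_add: "mat2 a b c d + mat2 a' b' c' d' = mat2 (a + a') (b + b') (c + c') (d + d')"
  and mat2_diff: "mat2 a b c d - mat2 a' b' c' d' = mat2 (a - a') (b - b') (c - c') (d - d')"
  and mat2_scaleR: "r *\<^sub>R mat2 a b c d = mat2 (r * a) (r * b) (r * c) (r * d)"
  and mat2_uminus: "- mat2 a b c d = mat2 (- a) (- b) (- c) (- d)"
  by (rule mat2_eqI; simp)+

lemma mat2_det: "det (mat2 a b c d) = a * d - b * c"
  and mat2_trace: "trace (mat2 a b c d) = a + d"
  by (simp_all add: det_2 trace_def sum_2)

lemma mat2_eq_iff: "mat2 a b c d = mat2 a' b' c' d' \<longleftrightarrow> a = a' \<and> b = b' \<and> c = c' \<and> d = d'"
  by (metis mat2_nth)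

lemmas mat2_simps = mat2_mult mat2_mat mat2_add mat2_diff mat2_scaleR mat2_uminus mat2_det
  mat2_trace mat2_eq_iff

lemma mat2_expand: "mat2 p q r s =
    p *\<^sub>R mat2 1 0 0 0 + q *\<^sub>R mat2 0 1 0 0 + r *\<^sub>R mat2 0 0 1 0 + s *\<^sub>R mat2 0 0 0 1"
  by (simp add: mat2_simps)

definition rot :: "real \<Rightarrow> real^2^2" where
  "rot \<phi> = mat2 (cos \<phi>) (- sin \<phi>) (sin \<phi>) (cos \<phi>)"

lemma rot_add: "rot (\<phi> + \<psi>) = rot \<phi> ** rot \<psi>"
  by (simp add: rot_def mat2_simps cos_add sin_add)

lemma mexp_J: "mexp (\<phi> *\<^sub>R J) = rot \<phi>"
proof -
  define \<iota> where "\<iota> = (\<lambda>w. mat2 (Re w) (- Im w) (Im w) (Re w))"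
  have lin: "linear \<iota>" by (rule linearI) (simp_all add: \<iota>_def mat2_simps)
  then have bl: "bounded_linear \<iota>" by (simp add: linear_conv_bounded_linear)
  have mult: "\<iota> (v * w) = \<iota> v ** \<iota> w" for v w by (simp add: \<iota>_def mat2_simps)
  have J: "\<phi> *\<^sub>R J = \<iota> (\<i> * of_real \<phi>)" by (simp add: \<iota>_def J_def mat2_simps)
  have "((**) (\<phi> *\<^sub>R J) ^^ n) (mat 1) = \<iota> ((\<i> * of_real \<phi>) ^ n)" for n
    by (induction n) (auto simp: mult[symmetric] J, simp add: \<iota>_def mat2_simps)
  then have "(((**) (\<phi> *\<^sub>R J) ^^ n) (mat 1)) /\<^sub>R fact n = \<iota> ((\<i> * of_real \<phi>) ^ n /\<^sub>R fact n)" for n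
    by (simp add: linear_scale[OF lin])
  moreover have "(\<lambda>n. \<iota> ((\<i> * of_real \<phi>) ^ n /\<^sub>R fact n)) sums \<iota> (exp (\<i> * of_real \<phi>))"
    by (intro bounded_linear.sums[OF bl] exp_converges)
  ultimately have "mexp (\<phi> *\<^sub>R J) = \<iota> (exp (\<i> * of_real \<phi>))"
    unfolding mexp_def by (simp add: sums_iff)
  also have "exp (\<i> * of_real \<phi>) = cis \<phi>" by (simp add: cis_conv_exp)
  finally show ?thesis by (simp add: \<iota>_def rot_def)
qed

lemma R_eq_rot: "R = rot (pi / 3)"
  by (simp add: R_def mexp_J)

lemma R_eq: "R = mat2 (1/2) (- sqrt 3 / 2) (sqrt 3 / 2) (1/2)"
  by (simp add: R_eq_rot rot_def cos_60 sin_60)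

lemma matrix_inv_eqI:
  fixes A B :: "real^'n^'n"
  assumes "A ** B = mat 1"
  shows "matrix_inv A = B"
proof -
  have "B ** A = mat 1" using assms matrix_left_right_inverse by blast
  with assms have "A ** matrix_inv A = mat 1 \<and> matrix_inv A ** A = mat 1"
    unfolding matrix_inv_def by (intro someI[of "\<lambda>A'. A ** A' = mat 1 \<and> A' ** A = mat 1"]) simp
  moreover have "matrix_inv A ** (A ** B) = (matrix_inv A ** A) ** B" by (rule matrix_mul_assoc)
  ultimately show ?thesis using assms by simp
qed

lemma inv_R_eq: "matrix_inv R = mat2 (1/2) (sqrt 3 / 2) (- sqrt 3 / 2) (1/2)"
  by (rule matrix_inv_eqI) (simp add: R_eq mat2_simps)

lemma R_inverse: "R ** matrix_inv R = mat 1" "matrix_inv R ** R = mat 1"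
  unfolding inv_R_eq unfolding R_eq by (simp_all add: mat2_simps)

section \<open>The three-fold symmetry of the control problem\<close>

text \<open>The action of \<open>R\<^sup>-\<^sup>1\<close> is a rotation of the half-plane by a third of a turn about \<open>\<i>\<close>. The
  automorphy factor is normalised so that the denominators of \<open>R\<^sup>-\<^sup>1\<close> disappear; the derivative of the
  rotation is \<open>4\<close> divided by its square.\<close>

definition rotate_z :: "complex \<Rightarrow> complex" where
  "rotate_z z = moebius (matrix_inv R) z"

definition automorphy :: "complex \<Rightarrow> complex" where
  "automorphy z = 1 - of_real (sqrt 3) * z"

definition rotate_control :: "control \<Rightarrow> control" where
  "rotate_control = (\<lambda>(u0, u1, u2). (u2, u0, u1))"

text \<open>With \<open>Z\<^sub>u = (a, b; c, - a)\<close> the velocity is the vector field \<open>b + 2 a z - c z\<^sup>2\<close> of the flow of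
  \<open>Z\<^sub>u\<close> on the half-plane, divided by \<open>trace (Z\<^sub>u X(z))\<close>, and \<open>field_den\<close> is that trace times
  \<open>Im z\<close>. In this form the invariance under rotations is visible.\<close>

definition field_num :: "control \<Rightarrow> complex \<Rightarrow> complex" where
  "field_num u z = of_real (ctrl_b u) + 2 * of_real (ctrl_a u) * z - of_real (ctrl_c u) * z\<^sup>2"

definition field_den :: "control \<Rightarrow> complex \<Rightarrow> real" where
  "field_den u z = ctrl_b u + 2 * ctrl_a u * Re z - ctrl_c u * ((Re z)\<^sup>2 + (Im z)\<^sup>2)"

definition velocity :: "control \<Rightarrow> complex \<Rightarrow> complex" where
  "velocity u z = of_real (Im z / field_den u z) * field_num u z"

lemma Complex_f1_f2: "Complex (f1 (Re z) (Im z) u) (f2 (Re z) (Im z) u) = velocity u z"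
  by (simp add: velocity_def f1_def f2_def field_num_def field_den_def Let_def complex_eq_iff
      power2_eq_square algebra_simps)

lemma f1_eq: "f1 (Re z) (Im z) u = Re (velocity u z)"
  and f2_eq: "f2 (Re z) (Im z) u = Im (velocity u z)"
  by (simp_all add: Complex_f1_f2[symmetric])

lemma hamiltonian_eq:
  "hamiltonian lc \<Lambda> z \<nu> u =
     trace_form \<Lambda> (X z) - 3/2 * lc * trace_form J (X z) + \<nu> \<bullet> velocity u z"
  by (simp add: hamiltonian_def f1_eq f2_eq inner_complex_def)

text \<open>The rotation has no pole off the real axis.\<close>

lemma automorphy_nonzero: "Im z \<noteq> 0 \<Longrightarrow> automorphy z \<noteq> 0"
  by (auto simp: automorphy_def complex_eq_iff)

lemma rotate_z_eq: "rotate_z z = (z + of_real (sqrt 3)) / automorphy z"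
proof -
  have "rotate_z z = (1/2 * (z + of_real (sqrt 3))) / (1/2 * automorphy z)"
    by (simp add: rotate_z_def moebius_def inv_R_eq automorphy_def field_simps)
  also have "\<dots> = (z + of_real (sqrt 3)) / automorphy z"
    by (rule mult_divide_mult_cancel_left) simp
  finally show ?thesis .
qed

lemma sqrt3_sq: "complex_of_real (sqrt 3) * complex_of_real (sqrt 3) = 3"
  by (simp flip: of_real_mult)

lemma norm_automorphy: "(norm (automorphy z))\<^sup>2 = 1 - 2 * sqrt 3 * Re z + 3 * ((Re z)\<^sup>2 + (Im z)\<^sup>2)"
  unfolding automorphy_def cmod_power2 by (simp add: power2_eq_square algebra_simps)

lemma Re_rotate_z: "Re (rotate_z z) =
    (sqrt 3 - sqrt 3 * ((Re z)\<^sup>2 + (Im z)\<^sup>2) - 2 * Re z) / (norm (automorphy z))\<^sup>2"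
  and Im_rotate_z: "Im (rotate_z z) = 4 * Im z / (norm (automorphy z))\<^sup>2"
  by (simp_all add: rotate_z_eq Re_divide' Im_divide',
      simp_all add: automorphy_def power2_eq_square algebra_simps)

lemma norm_rotate_z: "(Re (rotate_z z))\<^sup>2 + (Im (rotate_z z))\<^sup>2 =
    ((Re z)\<^sup>2 + (Im z)\<^sup>2 + 2 * sqrt 3 * Re z + 3) / (norm (automorphy z))\<^sup>2"
proof -
  have "(norm (rotate_z z))\<^sup>2 = (norm (z + of_real (sqrt 3)))\<^sup>2 / (norm (automorphy z))\<^sup>2"
    by (simp add: rotate_z_eq norm_divide power_divide)
  moreover have "(norm (z + of_real (sqrt 3)))\<^sup>2 = (Re z)\<^sup>2 + (Im z)\<^sup>2 + 2 * sqrt 3 * Re z + 3"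
    unfolding cmod_power2 by (simp add: power2_eq_square algebra_simps)
  ultimately show ?thesis by (simp only: cmod_power2[of "rotate_z z"])
qed

lemma Im_rotate_z_pos: "Im z > 0 \<Longrightarrow> Im (rotate_z z) > 0"
  by (simp add: Im_rotate_z automorphy_nonzero)

lemma rotate_z_has_derivative:
  assumes "Im z \<noteq> 0"
  shows "(rotate_z has_field_derivative 4 / (automorphy z)\<^sup>2) (at z within S)"
proof -
  have "1 - of_real (sqrt 3) * z \<noteq> 0" using automorphy_nonzero[OF assms] by (simp add: automorphy_def)
  then have "((\<lambda>z. (z + of_real (sqrt 3)) / (1 - of_real (sqrt 3) * z)) has_field_derivative
      4 / (1 - of_real (sqrt 3) * z)\<^sup>2) (at z within S)"
    by (auto intro!: derivative_eq_intros simp: power2_eq_square algebra_simps sqrt3_sq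
        simp flip: mult.assoc)
  then show ?thesis by (simp add: rotate_z_eq[abs_def] automorphy_def)
qed

text \<open>\<open>R\<^sup>3 = - 1\<close> acts trivially. The cocycle identity carries the same information for the covectors:
  it makes the third power of the cotangent action trivial as well.\<close>

lemma rotate_z_cube:
  assumes "Im z > 0"
  shows "rotate_z (rotate_z (rotate_z z)) = z"
    and automorphy_cocycle: "automorphy z * automorphy (rotate_z z) * automorphy (rotate_z (rotate_z z)) = - 8"
proof -
  define s where "s = complex_of_real (sqrt 3)"
  have s: "s * s = 3" by (simp add: s_def sqrt3_sq)
  have nz: "automorphy z \<noteq> 0" "automorphy (rotate_z z) \<noteq> 0" "automorphy (rotate_z (rotate_z z)) \<noteq> 0"
    using assms Im_rotate_z_pos[of z] Im_rotate_z_pos[of "rotate_z z"] by (auto intro!: automorphy_nonzero)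
  \<comment> \<open>\<open>R\<^sup>-\<^sup>2\<close> and \<open>R\<^sup>-\<^sup>3\<close> have the lower rows \<open>(- s / 2, - 1 / 2)\<close> and \<open>(0, - 1)\<close>.\<close>
  have 1: "automorphy (rotate_z z) = (- 2 - 2 * s * z) / automorphy z"
    using nz(1) s unfolding rotate_z_eq by (simp add: automorphy_def s_def[symmetric] divide_simps) algebra
  with nz have nz': "- 2 - 2 * s * z \<noteq> 0" by auto
  have 2: "rotate_z (rotate_z z) = (z + s + s * automorphy z) / (- 2 - 2 * s * z)"
    unfolding rotate_z_eq[of "rotate_z z"] 1 using nz nz'
    by (simp add: rotate_z_eq s_def[symmetric] divide_simps)
  have 3: "automorphy (rotate_z (rotate_z z)) = - 8 / (- 2 - 2 * s * z)"
    unfolding automorphy_def[of "rotate_z (rotate_z z)"] 2 using nz' s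
    by (simp add: automorphy_def s_def[symmetric] divide_simps) algebra
  show "automorphy z * automorphy (rotate_z z) * automorphy (rotate_z (rotate_z z)) = - 8"
  proof -
    have "a * (w / a) * (- 8 / w) = - 8" if "a \<noteq> 0" "w \<noteq> 0" for a w :: complex using that by simp
    from this[OF nz(1) nz'] show ?thesis unfolding 3 unfolding 1 .
  qed
  show "rotate_z (rotate_z (rotate_z z)) = z"
    apply (subst rotate_z_eq, subst 3, subst 2) using nz' s
    by (simp add: automorphy_def s_def[symmetric] divide_simps) algebra
qed

lemma X_eq: "X z = mat2 (Re z / Im z) (- ((Re z)\<^sup>2 + (Im z)\<^sup>2) / Im z) (1 / Im z) (- Re z / Im z)"
  by (simp add: X_def Let_def mat2_simps power2_eq_square divide_simps)

lemma X_rotate_z: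
  assumes "Im z > 0"
  shows "X (rotate_z z) = matrix_inv R ** X z ** R"
proof -
  define s where "s = sqrt 3"
  have s: "s * s = 3" by (simp add: s_def)
  define x where "x = Re z"
  define y where "y = Im z"
  define n where "n = x\<^sup>2 + y\<^sup>2"
  define D where "D = (norm (automorphy z))\<^sup>2"
  have D: "D \<noteq> 0" using automorphy_nonzero[of z] assms by (auto simp: D_def)
  have DD: "D = 1 - 2 * s * x + s * s * n" by (simp add: D_def norm_automorphy s n_def x_def y_def, simp add: s_def)
  have y: "y \<noteq> 0" using assms by (simp add: y_def)
  have "X (rotate_z z) = mat2 ((s - s * n - 2 * x) / (4 * y)) (- (n + 2 * s * x + 3) / (4 * y))
      (D / (4 * y)) (- (s - s * n - 2 * x) / (4 * y))"
    unfolding X_eq norm_rotate_z unfolding Re_rotate_z Im_rotate_z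
    unfolding x_def[symmetric] y_def[symmetric] unfolding n_def[symmetric] D_def[symmetric] s_def[symmetric]
    using D y by (simp add: mat2_eq_iff)
  also have "\<dots> = mat2 ((s - s * n + x - s * s * x) / (4 * y)) (- (n + 2 * s * x + s * s) / (4 * y))
      ((1 - 2 * s * x + s * s * n) / (4 * y)) (- (s - s * n + x - s * s * x) / (4 * y))"
    unfolding DD by (simp add: s)
  also have "\<dots> = mat2 (1/2) (s / 2) (- s / 2) (1/2) ** mat2 (x / y) (- n / y) (1 / y) (- x / y) **
      mat2 (1/2) (- s / 2) (s / 2) (1/2)"
    unfolding mat2_mult mat2_eq_iff using y by (simp add: divide_simps) (simp add: algebra_simps)
  also have "\<dots> = matrix_inv R ** X z ** R"
    unfolding inv_R_eq X_eq unfolding R_eq n_def x_def y_def s_def ..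
  finally show ?thesis .
qed

lemma trace_form_conj: "trace_form (matrix_inv R ** A ** R) (matrix_inv R ** B ** R) = trace_form A B"
proof -
  have "(matrix_inv R ** A ** R) ** (matrix_inv R ** B ** R) =
      matrix_inv R ** A ** (R ** matrix_inv R) ** B ** R"
    by (simp only: matrix_mul_assoc)
  also have "\<dots> = (matrix_inv R ** (A ** B)) ** R" by (simp add: R_inverse matrix_mul_assoc)
  finally show ?thesis
    by (simp add: trace_form_def trace_mul_sym[of _ R]) (simp add: matrix_mul_assoc R_inverse)
qed

lemma conj_R_J: "matrix_inv R ** J ** R = J"
  unfolding inv_R_eq unfolding R_eq by (simp add: J_def mat2_simps)

text \<open>With barycentric coordinates divided by three the coefficients become integral polynomials, which
  keeps the two covariance identities below free of fractions.\<close>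

lemma ctrl_thirds:
  "ctrl_a (3 * p, 3 * q, 3 * r) = (q - r) * sqrt 3"
  "ctrl_b (3 * p, 3 * q, 3 * r) = p - 2 * q - 2 * r"
  "ctrl_c (3 * p, 3 * q, 3 * r) = 3 * p"
  by (simp_all add: ctrl_a_def ctrl_b_def ctrl_c_def field_simps)

lemma control_thirds:
  fixes u :: control
  obtains p q r where "u = (3 * p, 3 * q, 3 * r)"
  by (rule that[of "fst u / 3" "fst (snd u) / 3" "snd (snd u) / 3"]) simp

text \<open>The permutation of the vertices is conjugation of \<open>Z\<^sub>u\<close> by \<open>R\<close>, and the vector field of a
  conjugated matrix is the push-forward of the vector field.\<close>

lemma field_num_rotate:
  assumes "Im z > 0"
  shows "field_num (rotate_control u) (rotate_z z) = 4 * field_num u z / (automorphy z)\<^sup>2"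
proof -
  obtain p' q' r' where u: "u = (3 * p', 3 * q', 3 * r')" by (rule control_thirds)
  define s where "s = complex_of_real (sqrt 3)"
  have s: "s * s = 3" by (simp add: s_def sqrt3_sq)
  define p where "p = complex_of_real p'"
  define q where "q = complex_of_real q'"
  define r where "r = complex_of_real r'"
  define D where "D = automorphy z"
  have D: "D \<noteq> 0" using automorphy_nonzero[of z] assms by (auto simp: D_def)
  have zD: "D = 1 - s * z" by (simp add: D_def automorphy_def s_def)
  have "field_num (rotate_control u) (rotate_z z) =
      (r - 2 * p - 2 * q) + 2 * ((p - q) * s) * ((z + s) / D) - 3 * r * ((z + s) / D)\<^sup>2"
    unfolding u
    by (simp add: field_num_def rotate_control_def ctrl_thirds rotate_z_eq
        flip: s_def p_def q_def r_def D_def)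
  also have "\<dots> * D\<^sup>2 =
     (r - 2 * p - 2 * q) * D\<^sup>2 + 2 * ((p - q) * s) * (z + s) * D - 3 * r * (z + s)\<^sup>2"
    using D by (simp add: field_simps power2_eq_square)
  also have "\<dots> = 4 * ((p - 2 * q - 2 * r) + 2 * ((q - r) * s) * z - 3 * p * z\<^sup>2) +
      (s * s - 3) * (p * (2 - 4 * z\<^sup>2 - 2 * s * z) + q * (2 * s * z - 2) + r * (z\<^sup>2 - 3))"
    unfolding zD by (simp add: algebra_simps power2_eq_square)
  also have "\<dots> = 4 * ((p - 2 * q - 2 * r) + 2 * ((q - r) * s) * z - 3 * p * z\<^sup>2)" by (simp add: s)
  also have "(p - 2 * q - 2 * r) + 2 * ((q - r) * s) * z - 3 * p * z\<^sup>2 = field_num u z"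
    unfolding u by (simp add: field_num_def ctrl_thirds flip: s_def p_def q_def r_def)
  finally show ?thesis using D by (simp add: D_def field_simps)
qed

lemma field_den_rotate:
  assumes "Im z > 0"
  shows "field_den (rotate_control u) (rotate_z z) = 4 * field_den u z / (norm (automorphy z))\<^sup>2"
proof -
  obtain p q r where u: "u = (3 * p, 3 * q, 3 * r)" by (rule control_thirds)
  define s where "s = sqrt 3"
  have s: "s * s = 3" by (simp add: s_def)
  define D where "D = (norm (automorphy z))\<^sup>2"
  have D: "D \<noteq> 0" using automorphy_nonzero[of z] assms by (auto simp: D_def)
  define n where "n = (Re z)\<^sup>2 + (Im z)\<^sup>2"
  have DD: "D = 1 - 2 * s * Re z + 3 * n" by (simp add: D_def norm_automorphy s_def n_def)
  have "field_den (rotate_control u) (rotate_z z) =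
     (r - 2 * p - 2 * q) + 2 * ((p - q) * s) * ((s - s * n - 2 * Re z) / D)
      - 3 * r * ((n + 2 * s * Re z + 3) / D)"
    unfolding u field_den_def norm_rotate_z unfolding Re_rotate_z
    by (simp add: rotate_control_def ctrl_thirds flip: s_def D_def n_def)
  also have "\<dots> * D = (r - 2 * p - 2 * q) * D + 2 * ((p - q) * s) * (s - s * n - 2 * Re z)
      - 3 * r * (n + 2 * s * Re z + 3)"
    using D by (simp add: field_simps)
  also have "\<dots> = 4 * ((p - 2 * q - 2 * r) + 2 * ((q - r) * s) * Re z - 3 * p * n) +
      (s * s - 3) * (2 * (p - q) * (1 - n))"
    unfolding DD by (simp add: algebra_simps)
  also have "\<dots> = 4 * ((p - 2 * q - 2 * r) + 2 * ((q - r) * s) * Re z - 3 * p * n)" by (simp add: s)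
  also have "(p - 2 * q - 2 * r) + 2 * ((q - r) * s) * Re z - 3 * p * n = field_den u z"
    unfolding u by (simp add: field_den_def ctrl_thirds flip: s_def n_def)
  finally show ?thesis using D by (simp add: D_def field_simps)
qed

lemma velocity_rotate:
  assumes "Im z > 0"
  shows "velocity (rotate_control u) (rotate_z z) = 4 / (automorphy z)\<^sup>2 * velocity u z"
proof -
  have "(norm (automorphy z))\<^sup>2 \<noteq> 0" using automorphy_nonzero[of z] assms by auto
  then have "Im (rotate_z z) / field_den (rotate_control u) (rotate_z z) = Im z / field_den u z"
    by (simp add: Im_rotate_z field_den_rotate[OF assms])
  then show ?thesis
    unfolding velocity_def field_num_rotate[OF assms]
    by (simp only: times_divide_eq_left times_divide_eq_right mult_ac)
qed

text \<open>The inverse transpose of the differential of the rotation at \<open>z\<close>. The differential is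
  multiplication by a complex number, so its transpose is multiplication by the conjugate.\<close>

definition rotate_costate :: "complex \<Rightarrow> complex \<Rightarrow> complex" where
  "rotate_costate z \<nu> = \<nu> * (cnj (automorphy z))\<^sup>2 / 4"

lemma inner_mult_complex: "(a * b) \<bullet> c = a \<bullet> (cnj b * c)" for a b c :: complex
  by (simp add: inner_complex_def algebra_simps)

lemma inner_rotate_costate:
  assumes "Im z > 0"
  shows "rotate_costate z \<nu> \<bullet> (4 / (automorphy z)\<^sup>2 * v) = \<nu> \<bullet> v"
proof -
  have "rotate_costate z \<nu> = \<nu> * cnj ((automorphy z)\<^sup>2 / 4)" by (simp add: rotate_costate_def)
  moreover have "(automorphy z)\<^sup>2 / 4 * (4 / (automorphy z)\<^sup>2 * v) = v"
    using automorphy_nonzero[of z] assms by simp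
  ultimately show ?thesis by (simp only: inner_mult_complex complex_cnj_cnj)
qed

lemma hamiltonian_rotate:
  assumes "Im z > 0"
  shows "hamiltonian lc (matrix_inv R ** \<Lambda> ** R) (rotate_z z) (rotate_costate z \<nu>) (rotate_control u)
    = hamiltonian lc \<Lambda> z \<nu> u"
proof -
  have "trace_form J (matrix_inv R ** X z ** R) = trace_form J (X z)"
    using trace_form_conj[of J "X z"] unfolding conj_R_J .
  then show ?thesis
    by (simp only: hamiltonian_eq X_rotate_z[OF assms] trace_form_conj velocity_rotate[OF assms]
        inner_rotate_costate[OF assms])
qed

text \<open>Both costate equations in one: \<open>\<nu>'\<close> is the negative gradient of the Hamiltonian in the variable
  \<open>z\<close>. Differentiability is included, so that the chain rule can be used.\<close>

definition hamilton_costate ::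
  "real \<Rightarrow> real^2^2 \<Rightarrow> complex \<Rightarrow> complex \<Rightarrow> control \<Rightarrow> complex \<Rightarrow> bool" where
  "hamilton_costate lc \<Lambda> z \<nu> u \<nu>' \<longleftrightarrow>
     ((\<lambda>w. hamiltonian lc \<Lambda> w \<nu> u) has_derivative (\<lambda>v. - \<nu>' \<bullet> v)) (at z)"

lemma hamilton_costate_partials:
  assumes "hamilton_costate lc \<Lambda> z \<nu> u \<nu>'"
  shows "Re \<nu>' = - deriv (\<lambda>x. hamiltonian lc \<Lambda> (Complex x (Im z)) \<nu> u) (Re z)"
    and "Im \<nu>' = - deriv (\<lambda>y. hamiltonian lc \<Lambda> (Complex (Re z) y) \<nu> u) (Im z)"
proof -
  have H: "((\<lambda>w. hamiltonian lc \<Lambda> w \<nu> u) has_derivative (\<lambda>v. - \<nu>' \<bullet> v)) (at (Complex (Re z) (Im z)))"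
    using assms by (simp only: hamilton_costate_def complex.collapse)
  have "((\<lambda>x. Complex x (Im z)) has_derivative (\<lambda>h. of_real h)) (at (Re z))"
    unfolding Complex_eq by (auto intro!: derivative_eq_intros)
  then have "((\<lambda>x. hamiltonian lc \<Lambda> (Complex x (Im z)) \<nu> u) has_derivative (\<lambda>h. - \<nu>' \<bullet> of_real h)) (at (Re z))"
    by (rule has_derivative_compose[where f = "\<lambda>x. Complex x (Im z)" and x = "Re z", OF _ H])
  moreover have "(\<lambda>h. - \<nu>' \<bullet> of_real h) = (*) (- Re \<nu>')"
    by (simp add: fun_eq_iff inner_complex_def)
  ultimately have "((\<lambda>x. hamiltonian lc \<Lambda> (Complex x (Im z)) \<nu> u) has_real_derivative (- Re \<nu>')) (at (Re z))"
    by (simp only: has_field_derivative_def)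
  then show "Re \<nu>' = - deriv (\<lambda>x. hamiltonian lc \<Lambda> (Complex x (Im z)) \<nu> u) (Re z)"
    by (simp add: DERIV_imp_deriv)
  have "((\<lambda>y. Complex (Re z) y) has_derivative (\<lambda>h. \<i> * of_real h)) (at (Im z))"
    unfolding Complex_eq by (auto intro!: derivative_eq_intros)
  then have "((\<lambda>y. hamiltonian lc \<Lambda> (Complex (Re z) y) \<nu> u) has_derivative (\<lambda>h. - \<nu>' \<bullet> (\<i> * of_real h))) (at (Im z))"
    by (rule has_derivative_compose[where f = "\<lambda>y. Complex (Re z) y" and x = "Im z", OF _ H])
  moreover have "(\<lambda>h. - \<nu>' \<bullet> (\<i> * of_real h)) = (*) (- Im \<nu>')"
    by (simp add: fun_eq_iff inner_complex_def)
  ultimately have "((\<lambda>y. hamiltonian lc \<Lambda> (Complex (Re z) y) \<nu> u) has_real_derivative (- Im \<nu>')) (at (Im z))"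
    by (simp only: has_field_derivative_def)
  then show "Im \<nu>' = - deriv (\<lambda>y. hamiltonian lc \<Lambda> (Complex (Re z) y) \<nu> u) (Im z)"
    by (simp add: DERIV_imp_deriv)
qed

text \<open>The new Hamiltonian near the rotated point is the old one composed with the inverse rotation \<open>G\<close>,
  taken at a covector \<open>N(p)\<close> that varies with the base point because the new covector is held
  fixed. Since the Hamiltonian is affine in the covector, the variation contributes
  \<open>(N(p) - \<nu>) \<bullet> velocity u p\<close>, whose derivative at \<open>z\<close> only involves the derivative of \<open>N\<close>. The
  last term in the conclusion is the product rule term in the derivative of \<open>rotate_costate\<close> along
  the trajectory.\<close>

lemma hamilton_costate_rotate:
  assumes H: "hamilton_costate lc \<Lambda> z \<nu> u \<nu>'" and z: "Im z > 0" and den: "field_den u z \<noteq> 0"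
  shows "hamilton_costate lc (matrix_inv R ** \<Lambda> ** R) (rotate_z z) (rotate_costate z \<nu>) (rotate_control u)
     (\<nu>' * (cnj (automorphy z))\<^sup>2 / 4
        - \<nu> * cnj (automorphy z) * of_real (sqrt 3) * cnj (velocity u z) / 2)"
proof -
  define s where "s = complex_of_real (sqrt 3)"
  have cs: "cnj s = s" by (simp add: s_def)
  define D where "D = automorphy z"
  have D: "D \<noteq> 0" using automorphy_nonzero[of z] z by (simp add: D_def)
  define N where "N = (\<lambda>p. \<nu> * (cnj D)\<^sup>2 / (cnj (automorphy p))\<^sup>2)"
  define G where "G = (\<lambda>w. rotate_z (rotate_z w))"
  have Gz: "G (rotate_z z) = z" using z by (simp add: G_def rotate_z_cube)
  have zz: "Im (rotate_z z) > 0" using z by (rule Im_rotate_z_pos)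
  have dN: "(N has_derivative (\<lambda>v. 2 * s * \<nu> * cnj v / cnj D)) (at z)"
  proof -
    define d where "d = cnj D"
    have d: "1 - s * cnj z = d" by (simp add: d_def D_def automorphy_def cs flip: s_def)
    have "d \<noteq> 0" using D by (simp add: d_def)
    have "((\<lambda>w. \<nu> * d\<^sup>2 / (1 - s * w)\<^sup>2) has_field_derivative 2 * s * \<nu> / d) (at (cnj z))"
      by (rule derivative_eq_intros refl | simp add: d \<open>d \<noteq> 0\<close>)+
         (simp add: \<open>d \<noteq> 0\<close> field_simps power2_eq_square power4_eq_xxxx)
    then have "((\<lambda>w. \<nu> * d\<^sup>2 / (1 - s * w)\<^sup>2) has_derivative (\<lambda>v. 2 * s * \<nu> / d * v)) (at (cnj z))"
      unfolding has_field_derivative_def .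
    from has_derivative_compose[OF bounded_linear_imp_has_derivative[OF bounded_linear_cnj] this]
    show ?thesis by (simp add: N_def d_def automorphy_def cs flip: s_def)
  qed
  have dv: "\<exists>dv. (velocity u has_derivative dv) (at z)"
  proof -
    have ReIm: "Re differentiable at z" "Im differentiable at z"
      by (simp_all add: bounded_linear_imp_differentiable bounded_linear_Re bounded_linear_Im)
    have "(\<lambda>z. Im z / field_den u z) differentiable at z"
      using den ReIm unfolding field_den_def by (auto intro!: derivative_intros)
    then obtain d1 where d1: "((\<lambda>z. Im z / field_den u z) has_derivative d1) (at z)"
      by (auto simp: differentiable_def)
    have "field_num u differentiable at z"
      unfolding field_num_def by (auto intro!: derivative_intros)
    then obtain d2 where d2: "(field_num u has_derivative d2) (at z)"
      by (auto simp: differentiable_def)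
    show ?thesis
      unfolding velocity_def using has_derivative_mult[OF has_derivative_of_real[OF d1] d2] by blast
  qed
  then obtain dv where dv: "(velocity u has_derivative dv) (at z)" by blast
  have "((\<lambda>p. hamiltonian lc \<Lambda> p \<nu> u + (N p - \<nu>) \<bullet> velocity u p) has_derivative
      (\<lambda>v. - \<nu>' \<bullet> v + (2 * s * \<nu> * cnj v / cnj D) \<bullet> velocity u z)) (at z)"
  proof -
    have "N z = \<nu>" using D by (simp add: N_def D_def)
    with has_derivative_add[OF H[unfolded hamilton_costate_def]
        has_derivative_inner[OF has_derivative_diff[OF dN has_derivative_const[of \<nu>]] dv]]
    show ?thesis by simp
  qed
  also have "(\<lambda>v. - \<nu>' \<bullet> v + (2 * s * \<nu> * cnj v / cnj D) \<bullet> velocity u z) =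
     (\<lambda>v. (- \<nu>' + 2 * s * \<nu> * cnj (velocity u z) / cnj D) \<bullet> v)"
  proof
    fix v
    define c where "c = 2 * s * \<nu> / cnj D"
    have "(c * cnj v) \<bullet> velocity u z = (c * cnj (velocity u z)) \<bullet> v"
      by (simp add: inner_complex_def algebra_simps)
    then show "- \<nu>' \<bullet> v + (2 * s * \<nu> * cnj v / cnj D) \<bullet> velocity u z =
        (- \<nu>' + 2 * s * \<nu> * cnj (velocity u z) / cnj D) \<bullet> v"
      by (simp add: c_def inner_diff_left)
  qed
  finally have 1: "((\<lambda>p. hamiltonian lc \<Lambda> p \<nu> u + (N p - \<nu>) \<bullet> velocity u p) has_derivative
     (\<lambda>v. (- \<nu>' + 2 * s * \<nu> * cnj (velocity u z) / cnj D) \<bullet> v)) (at (G (rotate_z z)))"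
    by (simp add: Gz)
  have "(G has_field_derivative D\<^sup>2 / 4) (at (rotate_z z))"
  proof -
    define w where "w = rotate_z z"
    have w: "Im w > 0" using zz by (simp add: w_def)
    then have nz: "automorphy w \<noteq> 0" "automorphy (rotate_z w) \<noteq> 0"
      using Im_rotate_z_pos[of w] by (auto intro!: automorphy_nonzero)
    have "(G has_field_derivative 4 / (automorphy (rotate_z w))\<^sup>2 * (4 / (automorphy w)\<^sup>2)) (at w)"
      unfolding G_def using w Im_rotate_z_pos[OF w]
      by (intro DERIV_chain2[where f = rotate_z and g = rotate_z] rotate_z_has_derivative) auto
    also have "4 / (automorphy (rotate_z w))\<^sup>2 * (4 / (automorphy w)\<^sup>2) =
        16 / (automorphy w * automorphy (rotate_z w))\<^sup>2"
      by (simp add: power_mult_distrib)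
    also have "automorphy w * automorphy (rotate_z w) = - 8 / D"
      using automorphy_cocycle[OF z] D by (simp add: w_def D_def field_simps)
    also have "16 / (- 8 / D)\<^sup>2 = D\<^sup>2 / 4" by (simp add: power_divide)
    finally show ?thesis by (simp add: w_def)
  qed
  then have "(G has_derivative (\<lambda>v. D\<^sup>2 / 4 * v)) (at (rotate_z z))"
    unfolding has_field_derivative_def .
  from has_derivative_compose[OF this 1]
  have "((\<lambda>w. hamiltonian lc \<Lambda> (G w) \<nu> u + (N (G w) - \<nu>) \<bullet> velocity u (G w)) has_derivative
     (\<lambda>v. (- \<nu>' + 2 * s * \<nu> * cnj (velocity u z) / cnj D) \<bullet> (D\<^sup>2 / 4 * v))) (at (rotate_z z))" .
  moreover have "(\<lambda>v. (- \<nu>' + 2 * s * \<nu> * cnj (velocity u z) / cnj D) \<bullet> (D\<^sup>2 / 4 * v)) =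
     (\<lambda>v. - (\<nu>' * (cnj D)\<^sup>2 / 4 - \<nu> * cnj D * s * cnj (velocity u z) / 2) \<bullet> v)"
  proof
    fix v
    have "(- \<nu>' + 2 * s * \<nu> * cnj (velocity u z) / cnj D) * cnj (D\<^sup>2 / 4) =
       - (\<nu>' * (cnj D)\<^sup>2 / 4 - \<nu> * cnj D * s * cnj (velocity u z) / 2)"
      using D by (simp add: field_simps power2_eq_square)
    then show "(- \<nu>' + 2 * s * \<nu> * cnj (velocity u z) / cnj D) \<bullet> (D\<^sup>2 / 4 * v) =
      - (\<nu>' * (cnj D)\<^sup>2 / 4 - \<nu> * cnj D * s * cnj (velocity u z) / 2) \<bullet> v"
      by (metis complex_cnj_cnj inner_mult_complex)
  qed
  ultimately have 2: "((\<lambda>w. hamiltonian lc \<Lambda> (G w) \<nu> u + (N (G w) - \<nu>) \<bullet> velocity u (G w)) has_derivative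
     (\<lambda>v. - (\<nu>' * (cnj D)\<^sup>2 / 4 - \<nu> * cnj D * s * cnj (velocity u z) / 2) \<bullet> v)) (at (rotate_z z))"
    by simp
  have 3: "hamiltonian lc (matrix_inv R ** \<Lambda> ** R) w (rotate_costate z \<nu>) (rotate_control u)
     = hamiltonian lc \<Lambda> (G w) \<nu> u + (N (G w) - \<nu>) \<bullet> velocity u (G w)" if w: "w \<in> {w. Im w > 0}" for w
  proof -
    have Gw: "Im (G w) > 0" using w by (simp add: G_def Im_rotate_z_pos)
    have "w = rotate_z (G w)" using w by (simp add: G_def rotate_z_cube)
    moreover have "rotate_costate z \<nu> = rotate_costate (G w) (N (G w))"
      using automorphy_nonzero[of "G w"] Gw by (simp add: rotate_costate_def N_def D_def)
    ultimately have "hamiltonian lc (matrix_inv R ** \<Lambda> ** R) w (rotate_costate z \<nu>) (rotate_control u)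
       = hamiltonian lc \<Lambda> (G w) (N (G w)) u"
      using hamiltonian_rotate[OF Gw] by metis
    also have "\<dots> = hamiltonian lc \<Lambda> (G w) \<nu> u + (N (G w) - \<nu>) \<bullet> velocity u (G w)"
      by (simp add: hamiltonian_eq inner_diff_left)
    finally show ?thesis .
  qed
  show ?thesis
    unfolding hamilton_costate_def
    by (rule has_derivative_transform_within_open[OF 2[unfolded D_def s_def] open_halfspace_Im_gt[of 0]])
       (use zz 3 in auto)
qed

section \<open>The first piece\<close>

lemma has_vector_derivative_Complex:
  assumes "(f has_real_derivative f') F" "(g has_real_derivative g') F"
  shows "((\<lambda>t. Complex (f t) (g t)) has_vector_derivative Complex f' g') F"
  using assms by (simp add: has_vector_derivative_complex_iff)

lemma has_vector_derivative_mat2: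
  assumes "(a has_real_derivative a') F" "(b has_real_derivative b') F"
    and "(c has_real_derivative c') F" "(d has_real_derivative d') F"
  shows "((\<lambda>t. mat2 (a t) (b t) (c t) (d t)) has_vector_derivative mat2 a' b' c' d') F"
proof -
  have *: "((\<lambda>t. h t *\<^sub>R M) has_vector_derivative h' *\<^sub>R M) F"
    if "(h has_real_derivative h') F" for h h' and M :: "real^2^2"
    using bounded_linear.has_vector_derivative[OF bounded_linear_scaleR_left
      that[unfolded has_real_derivative_iff_has_vector_derivative]] .
  show ?thesis
    unfolding mat2_expand[of "a _"] mat2_expand[of a'] by (intro has_vector_derivative_add * assms)
qed

text \<open>The adjugate: the inverse on matrices of determinant one, but linear in the entries.\<close>

definition adj2 :: "real^2^2 \<Rightarrow> real^2^2" where
  "adj2 A = mat2 (A$2$2) (- A$1$2) (- A$2$1) (A$1$1)"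

text \<open>Under the control \<open>e3\<close> the ratio of \<open>Im z\<close> and \<open>Re z + 1 / sqrt 3\<close> is constant, so the
  solution through \<open>\<i> C / sqrt 3\<close> is an expanding dilation with centre \<open>- 1 / sqrt 3\<close>.\<close>

definition piece_z :: "real \<Rightarrow> real \<Rightarrow> complex" where
  "piece_z C t = Complex ((exp (C * t) - 1) / sqrt 3) (C * exp (C * t) / sqrt 3)"

text \<open>If \<open>P\<close> generates this dilation, then \<open>X(z(t)) = exp (t P) X(z(0)) exp (- t P)\<close>, and
  \<open>g(t) = exp (t (X(z(0)) + P)) exp (- t P)\<close>. The first exponent is lower triangular and
  the second one is upper triangular; their product is the matrix below.\<close>

definition piece_g :: "real \<Rightarrow> real \<Rightarrow> real^2^2" where
  "piece_g C t = mat2 1 (- (exp (C * t) - 1) / sqrt 3) ((1 - exp (- (C * t))) * sqrt 3 / C\<^sup>2)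
     (1 - (exp (C * t) - 2 + exp (- (C * t))) / C\<^sup>2)"

lemma velocity_e3:
  "velocity e3 z = of_real (Im z) * (z + of_real (1 / sqrt 3)) / of_real (Re z + 1 / sqrt 3)"
proof -
  have 1: "field_num e3 z = - (2 / of_real (sqrt 3)) * (z + of_real (1 / sqrt 3))"
    by (simp add: field_num_def e3_def ctrl_a_def ctrl_b_def ctrl_c_def field_simps sqrt3_sq)
  have 2: "field_den e3 z = - (2 / sqrt 3) * (Re z + 1 / sqrt 3)"
    by (simp add: field_den_def e3_def ctrl_a_def ctrl_b_def ctrl_c_def field_simps)
  have 3: "complex_of_real (sqrt 3) \<noteq> 0" by simp
  have "velocity e3 z = of_real (Im z) * (- (2 / of_real (sqrt 3)) * (z + of_real (1 / sqrt 3))) /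
      (- (2 / of_real (sqrt 3)) * of_real (Re z + 1 / sqrt 3))"
    unfolding velocity_def 1 2 by simp
  also have "\<dots> = of_real (Im z) * (z + of_real (1 / sqrt 3)) / of_real (Re z + 1 / sqrt 3)"
    using 3 mult_divide_mult_cancel_left[of "- (2 / complex_of_real (sqrt 3))"
       "of_real (Im z) * (z + of_real (1 / sqrt 3))" "of_real (Re z + 1 / sqrt 3)"]
    by (simp only: mult.left_commute) simp
  finally show ?thesis .
qed

lemma velocity_piece_z: "velocity e3 (piece_z C t) =
    Complex (C * exp (C * t) / sqrt 3) (C\<^sup>2 * exp (C * t) / sqrt 3)"
proof -
  define e where "e = exp (C * t)"
  have "e \<noteq> 0" by (simp add: e_def)
  have "Re (piece_z C t) + 1 / sqrt 3 = e / sqrt 3" by (simp add: piece_z_def e_def field_simps)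
  moreover have "piece_z C t + of_real (1 / sqrt 3) = Complex (e / sqrt 3) (C * e / sqrt 3)"
    by (simp add: piece_z_def complex_eq_iff flip: e_def) (simp add: field_simps)
  moreover have "Im (piece_z C t) = C * e / sqrt 3" by (simp add: piece_z_def e_def)
  ultimately show ?thesis
    unfolding velocity_e3 using \<open>e \<noteq> 0\<close>
    by (simp add: complex_eq_iff power2_eq_square flip: e_def)
qed

lemma piece_z_has_derivative:
  "(piece_z C has_vector_derivative velocity e3 (piece_z C t)) (at t within S)"
proof -
  have "((\<lambda>t. exp (C * t) - 1) has_real_derivative C * exp (C * t)) (at t within S)"
    by (auto intro!: derivative_eq_intros)
  moreover have "((\<lambda>t. C * exp (C * t)) has_real_derivative C\<^sup>2 * exp (C * t)) (at t within S)"
    by (auto intro!: derivative_eq_intros simp: power2_eq_square)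
  ultimately have "((\<lambda>t. Complex ((exp (C * t) - 1) / sqrt 3) (C * exp (C * t) / sqrt 3))
    has_vector_derivative Complex (C * exp (C * t) / sqrt 3) (C\<^sup>2 * exp (C * t) / sqrt 3)) (at t within S)"
    by (intro has_vector_derivative_Complex DERIV_cdivide)
  then show ?thesis unfolding velocity_piece_z by (simp only: piece_z_def[abs_def])
qed

lemma piece_z_0: "piece_z C 0 = Complex 0 (C / sqrt 3)"
  by (simp add: piece_z_def)

lemma Im_piece_z_pos: "C > 0 \<Longrightarrow> Im (piece_z C t) > 0"
  by (simp add: piece_z_def)

lemma piece_z_norm: "(Re (piece_z C t))\<^sup>2 + (Im (piece_z C t))\<^sup>2 =
    ((1 + C\<^sup>2) * (exp (C * t))\<^sup>2 - 2 * exp (C * t) + 1) / 3"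
  by (simp add: piece_z_def power_divide power2_eq_square algebra_simps add_divide_distrib diff_divide_distrib)

lemma X_piece_z:
  assumes "C > 0"
  shows "X (piece_z C t) = mat2 ((1 - exp (- (C * t))) / C)
    (- ((1 + C\<^sup>2) * exp (C * t) - 2 + exp (- (C * t))) / (sqrt 3 * C))
    (sqrt 3 * exp (- (C * t)) / C) (- (1 - exp (- (C * t))) / C)"
proof -
  define e where "e = exp (C * t)"
  have e: "e \<noteq> 0" "exp (- (C * t)) = 1 / e" by (simp_all add: e_def exp_minus inverse_eq_divide)
  have s: "sqrt 3 * sqrt 3 = 3" by simp
  show ?thesis
    unfolding X_eq piece_z_norm mat2_eq_iff e(2) unfolding piece_z_def e_def[symmetric] complex.sel
    using e(1) assms s by (simp add: divide_simps) (simp add: algebra_simps power2_eq_square)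
qed

lemma piece_g_0: "piece_g C 0 = mat 1"
  by (simp add: piece_g_def mat2_mat)

lemma det_piece_g:
  assumes "C > 0"
  shows "det (piece_g C t) = 1"
proof -
  define e where "e = exp (C * t)"
  have e: "e \<noteq> 0" "exp (- (C * t)) = 1 / e" by (simp_all add: e_def exp_minus inverse_eq_divide)
  show ?thesis
    unfolding piece_g_def mat2_det e(2) e_def[symmetric]
    using e(1) assms by (simp add: divide_simps) (simp add: algebra_simps power2_eq_square)
qed

lemma piece_g_has_derivative:
  assumes "C > 0"
  shows "(piece_g C has_vector_derivative piece_g C t ** X (piece_z C t)) (at t within S)"
proof -
  define e where "e = exp (C * t)"
  have e: "e \<noteq> 0" "exp (- (C * t)) = 1 / e" by (simp_all add: e_def exp_minus inverse_eq_divide)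
  have eq: "piece_g C t ** X (piece_z C t) =
     mat2 0 (- (C * exp (C * t)) / sqrt 3) (C * exp (- (C * t)) * sqrt 3 / C\<^sup>2)
     (0 - (C * exp (C * t) - C * exp (- (C * t))) / C\<^sup>2)"
    unfolding X_piece_z[OF assms] piece_g_def mat2_mult mat2_eq_iff e(2) e_def[symmetric]
    using e(1) assms by (simp add: divide_simps) (simp add: algebra_simps power2_eq_square)
  have "((\<lambda>t. - (exp (C * t) - 1)) has_real_derivative - (C * exp (C * t))) (at t within S)"
    "((\<lambda>t. (1 - exp (- (C * t))) * sqrt 3) has_real_derivative C * exp (- (C * t)) * sqrt 3) (at t within S)"
    "((\<lambda>t. exp (C * t) - 2 + exp (- (C * t))) has_real_derivative C * exp (C * t) - C * exp (- (C * t))) (at t within S)"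
    by (auto intro!: derivative_eq_intros)
  then show ?thesis
    unfolding eq unfolding piece_g_def[abs_def]
    by (intro has_vector_derivative_mat2 DERIV_cdivide DERIV_diff[OF DERIV_const] DERIV_const)
qed

section \<open>The costate over the first piece\<close>

text \<open>The difference of the logarithm and the rational function vanishes at \<open>1\<close>, and the numerator of
  its derivative factors as \<open>(w - 1)\<^sup>2 * (4 - w) * (2 * w\<^sup>2 + 4)\<close>. A cruder bound would not do:
  applied to \<open>E\<close>, which tends to \<open>1\<close> for large \<open>k\<close>, it estimates a quantity of third order in
  \<open>E - 1\<close>.\<close>

lemma ln_ge_rational:
  fixes x :: real
  assumes "1 \<le> x" "x \<le> 2"
  shows "(x - 1) * (8 - x - x\<^sup>2) \<le> ln x * (4 + 4 * x - 2 * x\<^sup>2)"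
proof -
  define Q where "Q = (\<lambda>x::real. 4 + 4 * x - 2 * x\<^sup>2)"
  define P where "P = (\<lambda>x::real. (x - 1) * (8 - x - x\<^sup>2))"
  have Q: "Q w > 0" if "1 \<le> w" "w \<le> 2" for w
  proof -
    have "0 \<le> w * (2 - w)" using that by simp
    then show ?thesis by (simp add: Q_def power2_eq_square algebra_simps)
  qed
  have "ln 1 - P 1 / Q 1 \<le> ln x - P x / Q x"
  proof (rule DERIV_nonneg_imp_nondecreasing[OF assms(1)])
    fix w :: real assume w: "1 \<le> w" "w \<le> x"
    then have Qw: "Q w > 0" and "w \<le> 2" using Q[of w] assms by auto
    have "((\<lambda>x. ln x - P x / Q x) has_real_derivative
      1 / w - ((9 - 3 * w\<^sup>2) * Q w - P w * (4 - 4 * w)) / (Q w * Q w)) (at w)"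
      using w Qw unfolding P_def Q_def
      by (auto intro!: derivative_eq_intros simp: power2_eq_square algebra_simps)
    moreover have "1 / w - ((9 - 3 * w\<^sup>2) * Q w - P w * (4 - 4 * w)) / (Q w * Q w) =
       (w - 1)\<^sup>2 * (4 - w) * (2 * w\<^sup>2 + 4) / (w * (Q w)\<^sup>2)"
    proof -
      have "(Q w)\<^sup>2 - w * ((9 - 3 * w\<^sup>2) * Q w - P w * (4 - 4 * w)) =
        (w - 1)\<^sup>2 * (4 - w) * (2 * w\<^sup>2 + 4)"
        unfolding P_def Q_def by (simp add: power2_eq_square algebra_simps)
      then show ?thesis using w Qw by (simp add: field_simps power2_eq_square)
    qed
    moreover have "\<dots> \<ge> 0" using w Qw \<open>w \<le> 2\<close> by simp
    ultimately show "\<exists>y. ((\<lambda>x. ln x - P x / Q x) has_real_derivative y) (at w) \<and> 0 \<le> y" by metis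
  qed
  then have "P x / Q x \<le> ln x" by (simp add: P_def)
  then show ?thesis using Q[OF assms] by (simp add: P_def Q_def divide_le_eq)
qed

lemma sqrt3_mult: "sqrt 3 * sqrt 3 = 3" "sqrt 3 * (sqrt 3 * x) = 3 * x"
  by (simp_all flip: mult.assoc)

text \<open>The hypothesis holds when the piece ends at the rotated starting point. The condition on the trace in
  the definition of the polygon then says \<open>exp (C * \<tau>) = 2 * cos \<theta>\<close>.\<close>

lemma trace_inv_R_piece_g:
  assumes C: "C > 0" and \<tau>: "exp (C * \<tau>) * (1 + C\<^sup>2) = 4"
  shows "trace (matrix_inv R ** piece_g C \<tau>) = exp (C * \<tau>)"
proof -
  have K: "1 + C\<^sup>2 \<noteq> 0" using C by (simp add: add_nonneg_eq_0_iff)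
  then have E: "exp (C * \<tau>) = 4 / (1 + C\<^sup>2)" using \<tau> by (simp add: field_simps)
  then have e: "exp (- (C * \<tau>)) = (1 + C\<^sup>2) / 4" by (simp add: exp_minus)
  show ?thesis
    unfolding inv_R_eq piece_g_def mat2_mult mat2_trace e E
    using K C by (simp add: divide_simps) (simp add: sqrt3_mult algebra_simps power2_eq_square)
qed

text \<open>The numbers of a first piece that ends at the rotated starting point. The
  condition \<open>1 < C\<^sup>2\<close> is \<open>E < 2\<close> and keeps the piece in the star domain, while \<open>C\<^sup>2 < 3\<close> is
  \<open>E > 1\<close> and makes the duration positive.\<close>

locale polygon_piece =
  fixes C \<tau> :: real
  assumes C_pos: "C > 0" and C_gt: "1 < C\<^sup>2" and C_lt: "C\<^sup>2 < 3"
    and \<tau>: "exp (C * \<tau>) * (1 + C\<^sup>2) = 4"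
begin

definition E :: real where "E = exp (C * \<tau>)"

lemma E_eq: "E = 4 / (1 + C\<^sup>2)"
proof -
  have "1 + C\<^sup>2 \<noteq> 0" using C_gt by simp
  then show ?thesis using \<tau> by (simp add: E_def field_simps)
qed

lemma C_sq: "C\<^sup>2 = 4 / E - 1"
  using C_gt by (simp add: E_eq field_simps)

lemma E_bounds: "1 < E" "E < 2"
  using C_gt C_lt by (simp_all add: E_eq field_simps)

lemma \<tau>_pos: "\<tau> > 0"
  using E_bounds(1) C_pos by (simp add: E_def zero_less_mult_iff)

lemma ln_E: "ln E = C * \<tau>"
  by (simp add: E_def)

lemma piece_z_end: "piece_z C \<tau> = rotate_z (piece_z C 0)"
proof -
  have n: "(norm (automorphy (piece_z C 0)))\<^sup>2 = 1 + C\<^sup>2"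
    by (simp add: norm_automorphy piece_z_0 power_divide)
  have "1 + C\<^sup>2 \<noteq> 0" using C_gt by simp
  moreover have s: "sqrt 3 * sqrt 3 = 3" by simp
  ultimately have "Re (piece_z C \<tau>) = Re (rotate_z (piece_z C 0))" "Im (piece_z C \<tau>) = Im (rotate_z (piece_z C 0))"
    unfolding Re_rotate_z Im_rotate_z n unfolding piece_z_def complex.sel E_def[symmetric] E_eq
    by (simp_all add: divide_simps power2_eq_square) (simp_all add: algebra_simps)
  then show ?thesis by (simp add: complex_eq_iff)
qed

text \<open>The parameter of the costate. Its value makes \<open>e1\<close> and \<open>e3\<close> tie at the end of the piece; it is
  the only one for which \<open>energy_profile\<close> holds.\<close>

definition q :: real where "q = (5/2 * E - 4 - 2 * (C * \<tau>)) / (4 - E)"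

definition \<rho> :: real where "\<rho> = (C\<^sup>2 - 1) * (C\<^sup>2 + 3) / (4 * C ^ 4)"

text \<open>The direction is that of the trace-free part of the holonomy; the factor \<open>q + 2\<close> is the free
  scale.\<close>

definition \<Lambda>0 :: "real^2^2" where "\<Lambda>0 = (q + 2) *\<^sub>R mat2 0 1 (- (3 * \<rho>)) 0"

text \<open>The second costate coordinate times the positive function \<open>C ^ 3 * exp (C * t) / 3\<close>. It vanishes at
  \<open>0\<close> since there \<open>e2\<close> and \<open>e3\<close> give the same value of the Hamiltonian.\<close>

definition profile :: "real \<Rightarrow> real" where
  "profile t = 1 - exp (C * t) + 2 * C * t + 2 * q * (1 - exp (- (C * t)))"

text \<open>The part of the Hamiltonian that depends on neither the control nor \<open>\<nu>\<close>, times \<open>C / sqrt 3\<close>. The first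
  costate coordinate is then forced by the vanishing of the Hamiltonian at \<open>e3\<close>.\<close>

definition energy :: "real \<Rightarrow> real" where
  "energy t = ((q * (1 + C\<^sup>2) + 2) * (exp (C * t) + E * exp (- (C * t))) + 4 - 5 * E - 2 * E * q)
     * (1 + C\<^sup>2) / (4 * C\<^sup>2)"

definition piece_\<nu> :: "real \<Rightarrow> complex" where
  "piece_\<nu> t = Complex (- (3 * energy t + 3 * profile t) * exp (- (C * t)) / C\<^sup>2)
     (3 * profile t * exp (- (C * t)) / C ^ 3)"

definition piece_\<Lambda> :: "real \<Rightarrow> real^2^2" where
  "piece_\<Lambda> t = adj2 (piece_g C t) ** \<Lambda>0 ** piece_g C t"

lemma q_eq: "2 * (C * \<tau>) = 5/2 * E - 4 - q * (4 - E)"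
proof -
  have "4 - E \<noteq> 0" using E_bounds by simp
  then show ?thesis by (simp add: q_def)
qed

lemma profile_0: "profile 0 = 0" by (simp add: profile_def)

lemma profile_end_nonneg: "profile \<tau> \<ge> 0"
proof -
  have eq: "profile \<tau> = 1 - E + 2 * ln E + 2 * q * (1 - 1 / E)"
    by (simp add: profile_def E_def exp_minus inverse_eq_divide)
  have "E * (4 - E) * profile \<tau> = (4 - E) * (E - E\<^sup>2 + 2 * E * ln E) + 2 * (q * (4 - E)) * (E - 1)"
    unfolding eq using E_bounds by (simp add: field_simps power2_eq_square)
  also have "q * (4 - E) = 5/2 * E - 4 - 2 * ln E"
    using q_eq by (simp add: ln_E)
  also have "(4 - E) * (E - E\<^sup>2 + 2 * E * ln E) + 2 * (5/2 * E - 4 - 2 * ln E) * (E - 1) =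
     ln E * (4 + 4 * E - 2 * E\<^sup>2) - (E - 1) * (8 - E - E\<^sup>2)"
    by (simp add: power2_eq_square algebra_simps)
  also have "\<dots> \<ge> 0" using ln_ge_rational[of E] E_bounds by simp
  finally have "0 \<le> E * (4 - E) * profile \<tau>" .
  moreover have "0 < E * (4 - E)" using E_bounds by simp
  ultimately show ?thesis by (metis zero_le_mult_iff not_less)
qed

lemma profile_has_derivative:
  "(profile has_real_derivative C * (2 * exp (C * s) - (exp (C * s))\<^sup>2 + 2 * q) * exp (- (C * s)))
     (at s within S)"
  unfolding profile_def[abs_def]
  by (auto intro!: derivative_eq_intros simp: power2_eq_square exp_minus field_simps)

text \<open>The derivative has the sign of \<open>1 + 2 * q - (e - 1)\<^sup>2\<close>, which changes at most once, from positive to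
  negative. So \<open>profile\<close> is bounded below by its value at the start or at the end.\<close>

lemma profile_nonneg:
  assumes t: "t \<in> {0..\<tau>}"
  shows "profile t \<ge> 0"
proof (cases "2 * exp (C * t) - (exp (C * t))\<^sup>2 + 2 * q \<ge> 0")
  case True
  have "profile 0 \<le> profile t"
  proof (rule DERIV_nonneg_imp_nondecreasing[of 0 t])
    fix s :: real assume s: "0 \<le> s" "s \<le> t"
    have "(exp (C * s) - 1)\<^sup>2 \<le> (exp (C * t) - 1)\<^sup>2"
      using s C_pos by (intro power_mono) (auto simp: mult_left_mono)
    with True have "2 * exp (C * s) - (exp (C * s))\<^sup>2 + 2 * q \<ge> 0"
      by (simp add: power2_eq_square algebra_simps)
    then have "C * (2 * exp (C * s) - (exp (C * s))\<^sup>2 + 2 * q) * exp (- (C * s)) \<ge> 0"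
      using C_pos by simp
    with profile_has_derivative[of s UNIV]
    show "\<exists>y. (profile has_real_derivative y) (at s) \<and> 0 \<le> y" by blast
  qed (use t in auto)
  then show ?thesis by (simp add: profile_0)
next
  case False
  have "profile \<tau> \<le> profile t"
  proof (rule DERIV_nonpos_imp_nonincreasing[of t \<tau>])
    fix s :: real assume s: "t \<le> s" "s \<le> \<tau>"
    have "(exp (C * t) - 1)\<^sup>2 \<le> (exp (C * s) - 1)\<^sup>2"
      using s t C_pos by (intro power_mono) (auto simp: mult_left_mono)
    with False have "2 * exp (C * s) - (exp (C * s))\<^sup>2 + 2 * q \<le> 0"
      by (simp add: power2_eq_square algebra_simps)
    then have "C * (2 * exp (C * s) - (exp (C * s))\<^sup>2 + 2 * q) * exp (- (C * s)) \<le> 0"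
      using C_pos by (simp add: mult_le_0_iff)
    with profile_has_derivative[of s UNIV]
    show "\<exists>y. (profile has_real_derivative y) (at s) \<and> y \<le> 0" by blast
  qed (use t in auto)
  with profile_end_nonneg show ?thesis by linarith
qed

text \<open>The two ties at the ends of the piece are exchanged by time reversal. The identity expresses this
  symmetry, and it gives the sign of the Hamiltonian at \<open>e1\<close> from the sign of \<open>profile\<close>.\<close>

lemma energy_profile: "energy t = - (1 + C\<^sup>2) / (2 * C\<^sup>2) * (profile t + profile (\<tau> - t))"
proof -
  define e where "e = exp (C * t)"
  have e: "e \<noteq> 0" "exp (- (C * t)) = 1 / e" by (simp_all add: e_def exp_minus inverse_eq_divide)
  have 1: "exp (C * (\<tau> - t)) = E / e" "exp (- (C * (\<tau> - t))) = e / E"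
    by (simp_all add: e_def E_def right_diff_distrib exp_diff)
  have "profile t + profile (\<tau> - t) =
     2 - e - E / e + 2 * (C * \<tau>) + 2 * q * (2 - 1 / e - e / E)"
    unfolding profile_def 1 e(2) e_def[symmetric] by (simp add: sqrt3_mult algebra_simps)
  also have "\<dots> = 2 - e - E / e + (5/2 * E - 4 - q * (4 - E)) + 2 * q * (2 - 1 / e - e / E)"
    unfolding q_eq ..
  finally have 2: "profile t + profile (\<tau> - t) =
    2 - e - E / e + (5/2 * E - 4 - q * (4 - E)) + 2 * q * (2 - 1 / e - e / E)" .
  have "1 + C\<^sup>2 \<noteq> 0" using C_gt by simp
  then show ?thesis
    unfolding 2 energy_def e(2) e_def[symmetric] E_eq
    using C_pos e(1) by (simp add: divide_simps) (simp add: sqrt3_mult algebra_simps power2_eq_square)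
qed

text \<open>\<open>exp (- (C * t)) * W t / C\<^sup>2\<close> is the lower right entry of \<open>piece_g C t\<close>. Naming it keeps the
  entries of the costate small.\<close>

definition W :: "real \<Rightarrow> real" where
  "W t = exp (C * t) * C\<^sup>2 - (exp (C * t) - 1)\<^sup>2"

lemma piece_\<Lambda>_eq:
  "piece_\<Lambda> t = (q + 2) *\<^sub>R mat2
     (sqrt 3 * (exp (C * t) - 1) * (W t * (exp (- (C * t)))\<^sup>2 / C ^ 4 - \<rho>))
     ((W t)\<^sup>2 * (exp (- (C * t)))\<^sup>2 / C ^ 4 + \<rho> * (exp (C * t) - 1)\<^sup>2)
     (- 3 * ((1 - exp (- (C * t)))\<^sup>2 / C ^ 4 + \<rho>))
     (- (sqrt 3 * (exp (C * t) - 1) * (W t * (exp (- (C * t)))\<^sup>2 / C ^ 4 - \<rho>)))"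
proof -
  define e where "e = exp (C * t)"
  have e: "e \<noteq> 0" "exp (- (C * t)) = 1 / e" by (simp_all add: e_def exp_minus inverse_eq_divide)
  define w where "w = W t"
  have 1: "1 - (e - 2 + 1 / e) / C\<^sup>2 = w / (e * C\<^sup>2)"
    using e(1) C_pos by (simp add: w_def W_def field_simps power2_eq_square flip: e_def)
  show ?thesis
    unfolding piece_\<Lambda>_def adj2_def \<Lambda>0_def piece_g_def mat2_nth mat2_simps e(2)
    unfolding e_def[symmetric] w_def[symmetric] 1
    using e(1) C_pos by (simp add: divide_simps power2_eq_square power4_eq_xxxx) (simp add: sqrt3_mult algebra_simps)
qed

lemma trace_form_piece_\<Lambda>_alone:
  "trace_form (piece_\<Lambda> t) (X (piece_z C t)) =
    sqrt 3 / C * ((q + 2) * ((1 + C\<^sup>2)\<^sup>2 * exp (C * t) - 8 + 4 * (1 + C\<^sup>2) * exp (- (C * t))) / (4 * C\<^sup>2))"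
proof -
  define e where "e = exp (C * t)"
  have e: "e \<noteq> 0" "exp (- (C * t)) = 1 / e" by (simp_all add: e_def exp_minus inverse_eq_divide)
  define w where "w = W t"
  have "trace_form (piece_\<Lambda> t) (X (piece_z C t)) =
    sqrt 3 / C * ((q + 2) * ((2 * (e - 1)\<^sup>2 * (w / (e\<^sup>2 * C ^ 4) - \<rho>) + w\<^sup>2 / (e\<^sup>2 * C ^ 4) + \<rho> * (e - 1)\<^sup>2
      + ((e - 1)\<^sup>2 / (e\<^sup>2 * C ^ 4) + \<rho>) * ((1 + C\<^sup>2) * e\<^sup>2 - 2 * e + 1)) / e))"
    unfolding piece_\<Lambda>_eq X_piece_z[OF C_pos] trace_form_def mat2_simps e(2) e_def[symmetric] w_def[symmetric]
    using e(1) C_pos by (simp add: divide_simps power2_eq_square power4_eq_xxxx) (simp add: sqrt3_mult algebra_simps)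
  also have "2 * (e - 1)\<^sup>2 * (w / (e\<^sup>2 * C ^ 4) - \<rho>) + w\<^sup>2 / (e\<^sup>2 * C ^ 4) + \<rho> * (e - 1)\<^sup>2
      + ((e - 1)\<^sup>2 / (e\<^sup>2 * C ^ 4) + \<rho>) * ((1 + C\<^sup>2) * e\<^sup>2 - 2 * e + 1) =
     ((w + (e - 1)\<^sup>2)\<^sup>2 + (e - 1)\<^sup>2 * C\<^sup>2 * e\<^sup>2) / (e\<^sup>2 * C ^ 4) + \<rho> * C\<^sup>2 * e\<^sup>2"
    using e(1) C_pos by (simp add: divide_simps) (simp add: power2_eq_square algebra_simps)
  also have "w + (e - 1)\<^sup>2 = e * C\<^sup>2" by (simp add: w_def W_def e_def)
  also have "(((e * C\<^sup>2)\<^sup>2 + (e - 1)\<^sup>2 * C\<^sup>2 * e\<^sup>2) / (e\<^sup>2 * C ^ 4) + \<rho> * C\<^sup>2 * e\<^sup>2) / e =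
     ((1 + C\<^sup>2)\<^sup>2 * e - 8 + 4 * (1 + C\<^sup>2) * (1 / e)) / (4 * C\<^sup>2)"
    using e(1) C_pos by (simp add: \<rho>_def divide_simps power2_eq_square power4_eq_xxxx) (simp add: sqrt3_mult algebra_simps)
  finally show ?thesis unfolding e(2) e_def[symmetric] by simp
qed

lemma trace_form_piece_\<Lambda>:
  "trace_form (piece_\<Lambda> t) (X (piece_z C t)) - 3/2 * (-1) * trace_form J (X (piece_z C t)) = sqrt 3 / C * energy t"
proof -
  define e where "e = exp (C * t)"
  have e: "e \<noteq> 0" "exp (- (C * t)) = 1 / e" by (simp_all add: e_def exp_minus inverse_eq_divide)
  have K: "1 + C\<^sup>2 \<noteq> 0" using C_gt by simp
  define k where "k = sqrt 3 / C"
  define m where "m = (1 + C\<^sup>2) * e - 2 + 4 / e"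
  have "trace_form J (X (piece_z C t)) = - (k * (m / 3))"
    unfolding k_def m_def
    unfolding trace_form_def J_def X_piece_z[OF C_pos] mat2_simps e(2) e_def[symmetric]
    using e(1) C_pos by (simp add: divide_simps) (simp add: sqrt3_mult algebra_simps)
  then have "trace_form (piece_\<Lambda> t) (X (piece_z C t)) - 3/2 * (-1) * trace_form J (X (piece_z C t)) =
     k * ((q + 2) * ((1 + C\<^sup>2)\<^sup>2 * e - 8 + 4 * (1 + C\<^sup>2) * (1 / e)) / (4 * C\<^sup>2) - m / 2)"
    unfolding trace_form_piece_\<Lambda>_alone e(2) e_def[symmetric] k_def[symmetric]
    by (simp add: right_diff_distrib)
  also have "(q + 2) * ((1 + C\<^sup>2)\<^sup>2 * e - 8 + 4 * (1 + C\<^sup>2) * (1 / e)) / (4 * C\<^sup>2) - m / 2 = energy t"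
    unfolding m_def energy_def e(2) E_eq e_def[symmetric]
    using e(1) C_pos K by (simp add: divide_simps) (simp add: sqrt3_mult algebra_simps power2_eq_square)
  finally show ?thesis by (simp add: k_def)
qed

lemma velocity_inner_piece_\<nu>:
  "piece_\<nu> t \<bullet> velocity e3 (piece_z C t) = - (sqrt 3 / C * energy t)"
proof -
  define e where "e = exp (C * t)"
  have e: "e \<noteq> 0" "exp (- (C * t)) = 1 / e" by (simp_all add: e_def exp_minus inverse_eq_divide)
  show ?thesis
    unfolding velocity_piece_z piece_\<nu>_def inner_complex_def complex.sel e(2) e_def[symmetric]
    using e(1) C_pos
    by (simp add: divide_simps power2_eq_square power3_eq_cube)
qed

lemma hamiltonian_piece: "hamiltonian (-1) (piece_\<Lambda> t) (piece_z C t) (piece_\<nu> t) v =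
    sqrt 3 / C * energy t + piece_\<nu> t \<bullet> velocity v (piece_z C t)"
  unfolding hamiltonian_eq using trace_form_piece_\<Lambda>[of t] by simp

lemma hamiltonian_piece_e3: "hamiltonian (-1) (piece_\<Lambda> t) (piece_z C t) (piece_\<nu> t) e3 = 0"
  unfolding hamiltonian_piece velocity_inner_piece_\<nu> by simp

lemma exp_bounds:
  assumes "t \<in> {0..\<tau>}"
  shows "1 \<le> exp (C * t)" "exp (C * t) \<le> E"
  using assms C_pos by (simp_all add: E_def mult_left_mono)

lemma field_den_e3_neg: "field_den e3 (piece_z C t) < 0"
proof -
  have "field_den e3 (piece_z C t) = - (2 / 3) * exp (C * t)"
    by (simp add: field_den_def e3_def ctrl_a_def ctrl_b_def ctrl_c_def piece_z_def field_simps)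
  then show ?thesis by simp
qed

lemma field_den_e2:
  "field_den e2 (piece_z C t) = - (2 / 3) * (2 - exp (C * t))"
    by (simp add: field_den_def e2_def ctrl_a_def ctrl_b_def ctrl_c_def piece_z_def field_simps)

lemma field_den_e1:
  "field_den e1 (piece_z C t) = - (exp (C * t) * ((1 + C\<^sup>2) * exp (C * t) - 2) / 3)"
proof -
  have "field_den e1 (piece_z C t) = 1 / 3 - ((Re (piece_z C t))\<^sup>2 + (Im (piece_z C t))\<^sup>2)"
    by (simp add: field_den_def e1_def ctrl_a_def ctrl_b_def ctrl_c_def)
  then show ?thesis unfolding piece_z_norm by (simp add: field_simps power2_eq_square)
qed

lemma field_den_e2_neg: "t \<in> {0..\<tau>} \<Longrightarrow> field_den e2 (piece_z C t) < 0"
  unfolding field_den_e2 using exp_bounds[of t] E_bounds by simp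

lemma field_den_e1_neg:
  assumes "t \<in> {0..\<tau>}"
  shows "field_den e1 (piece_z C t) < 0"
proof -
  have "2 * 1 < (1 + C\<^sup>2) * exp (C * t)"
    using exp_bounds[OF assms] C_gt by (intro mult_less_le_imp_less) auto
  then show ?thesis unfolding field_den_e1 by simp
qed

lemma hamiltonian_piece_e2:
  assumes "t \<in> {0..\<tau>}"
  shows "hamiltonian (-1) (piece_\<Lambda> t) (piece_z C t) (piece_\<nu> t) e2 \<le> 0"
proof -
  define e where "e = exp (C * t)"
  have e: "e > 0" "e < 2" "exp (- (C * t)) = 1 / e"
    using exp_bounds[OF assms] E_bounds by (simp_all add: e_def exp_minus inverse_eq_divide)
  have vel: "velocity e2 (piece_z C t) = Complex (C * e / sqrt 3) (- (C\<^sup>2 * e\<^sup>2 / (sqrt 3 * (2 - e))))"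
  proof -
    have fn: "field_num e2 (piece_z C t) =
       Complex (- (2/3) * (2 - e)) (2 * C * e / 3)"
      by (simp add: field_num_def e2_def ctrl_a_def ctrl_b_def ctrl_c_def piece_z_def complex_eq_iff e_def[symmetric])
         (simp add: field_simps)
    have im: "Im (piece_z C t) = C * e / sqrt 3" by (simp add: piece_z_def e_def)
    show ?thesis
      unfolding velocity_def fn im field_den_e2 e_def[symmetric] using e(2)
      by (simp add: complex_eq_iff divide_simps power2_eq_square)
  qed
  have "hamiltonian (-1) (piece_\<Lambda> t) (piece_z C t) (piece_\<nu> t) e2 =
     - (2 * sqrt 3 * profile t / (C * (2 - e)))"
    unfolding hamiltonian_piece vel unfolding piece_\<nu>_def inner_complex_def complex.sel e(3)
    using e C_pos by (simp add: divide_simps power2_eq_square power3_eq_cube) (simp add: sqrt3_mult algebra_simps power2_eq_square power3_eq_cube)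
  also have "\<dots> \<le> 0" using profile_nonneg[OF assms] e C_pos by simp
  finally show ?thesis .
qed

lemma hamiltonian_piece_e1:
  assumes "t \<in> {0..\<tau>}"
  shows "hamiltonian (-1) (piece_\<Lambda> t) (piece_z C t) (piece_\<nu> t) e1 \<le> 0"
proof -
  define e where "e = exp (C * t)"
  have e: "e > 0" "e < 2" "exp (- (C * t)) = 1 / e"
    using exp_bounds[OF assms] E_bounds by (simp_all add: e_def exp_minus inverse_eq_divide)
  define d where "d = (1 + C\<^sup>2) * e - 2"
  have d: "d > 0" using field_den_e1_neg[OF assms] e unfolding field_den_e1 e_def[symmetric] d_def
    by (simp add: zero_less_mult_iff)
  have vel: "velocity e1 (piece_z C t) = Complex (- (C * (2 - e + C\<^sup>2 * e) * e / (sqrt 3 * d))) (2 * (e - 1) * C\<^sup>2 * e / (sqrt 3 * d))"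
  proof -
    have fn: "field_num e1 (piece_z C t) = Complex (e * (2 - e + C\<^sup>2 * e) / 3) (- (2 * (e - 1) * C * e / 3))"
      by (simp add: field_num_def e1_def ctrl_a_def ctrl_b_def ctrl_c_def piece_z_def complex_eq_iff e_def[symmetric])
         (simp add: field_simps power2_eq_square)
    have im: "Im (piece_z C t) = C * e / sqrt 3" by (simp add: piece_z_def e_def)
    show ?thesis
      unfolding velocity_def fn im field_den_e1 e_def[symmetric] d_def[symmetric] using e(1) d
      by (simp add: complex_eq_iff divide_simps power2_eq_square)
  qed
  have "hamiltonian (-1) (piece_\<Lambda> t) (piece_z C t) (piece_\<nu> t) e1 =
     2 * sqrt 3 * C * e / d * (energy t + (1 + C\<^sup>2) / (2 * C\<^sup>2) * profile t)"
    unfolding hamiltonian_piece vel unfolding piece_\<nu>_def inner_complex_def complex.sel e(3)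
    using e C_pos d by (simp add: divide_simps power2_eq_square power3_eq_cube) (simp add: sqrt3_mult d_def algebra_simps power2_eq_square power3_eq_cube)
  also have "energy t + (1 + C\<^sup>2) / (2 * C\<^sup>2) * profile t = - ((1 + C\<^sup>2) / (2 * C\<^sup>2) * profile (\<tau> - t))"
  proof -
    define k where "k = (1 + C\<^sup>2) / (2 * C\<^sup>2)"
    have "- (1 + C\<^sup>2) / (2 * C\<^sup>2) = - k"
      unfolding k_def by (rule minus_divide_left[symmetric])
    then show ?thesis unfolding energy_profile k_def[symmetric] by (simp add: algebra_simps)
  qed
  also have "2 * sqrt 3 * C * e / d * \<dots> \<le> 0"
    using profile_nonneg[of "\<tau> - t"] assms e d C_pos by (simp add: mult_nonneg_nonpos)
  finally show ?thesis .
qed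

text \<open>The negative gradient of the Hamiltonian for \<open>e3\<close>, computed from
  \<open>H = (2 a x + b - c (x\<^sup>2 + y\<^sup>2)) / y + \<nu>1 y + \<nu>2 y\<^sup>2 / (x + 1 / sqrt 3)\<close>
  where \<open>y / (x + 1 / sqrt 3) = C\<close> and the value \<open>sqrt 3 / C * energy t\<close> of the first fraction
  are inserted after differentiation.\<close>

definition piece_\<nu>' :: "real \<Rightarrow> complex" where
  "piece_\<nu>' t = (let a = piece_\<Lambda> t $ 1 $ 1; c = piece_\<Lambda> t $ 2 $ 1 + 3/2; x = Re (piece_z C t); y = Im (piece_z C t);
      \<nu>1 = Re (piece_\<nu> t); \<nu>2 = Im (piece_\<nu> t) in
     Complex (- (2 * (a - c * x) / y) + C\<^sup>2 * \<nu>2) (sqrt 3 / C * energy t / y + 2 * c - \<nu>1 - 2 * C * \<nu>2))"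

lemma piece_\<nu>_has_derivative:
  "(piece_\<nu> has_vector_derivative piece_\<nu>' t) (at t within S)"
proof -
  define e where "e = exp (C * t)"
  have e: "e \<noteq> 0" "exp (- (C * t)) = 1 / e" by (simp_all add: e_def exp_minus inverse_eq_divide)
  have K: "1 + C\<^sup>2 \<noteq> 0" using C_gt by simp
  have dprof: "(profile has_real_derivative C * (2 * e - e\<^sup>2 + 2 * q) / e) (at t within S)"
    using profile_has_derivative[of t S] unfolding e(2) e_def[symmetric] by simp
  define den where "den = C * ((q * (1 + C\<^sup>2) + 2) * (e - E / e)) * (1 + C\<^sup>2) / (4 * C\<^sup>2)"
  have denergy: "(energy has_real_derivative den) (at t within S)"
    unfolding energy_def[abs_def] den_def
    by (intro DERIV_cdivide) (auto intro!: derivative_eq_intros simp: e_def exp_minus field_simps)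
  have dinv: "((\<lambda>t. exp (- (C * t))) has_real_derivative - C / e) (at t within S)"
    by (auto intro!: derivative_eq_intros simp: e_def exp_minus field_simps)
  have 1: "((\<lambda>t. - (3 * energy t + 3 * profile t) * exp (- (C * t)) / C\<^sup>2) has_real_derivative
     (- (3 * den + 3 * (C * (2 * e - e\<^sup>2 + 2 * q) / e)) * exp (- (C * t))
       + (- C / e) * (- (3 * energy t + 3 * profile t))) / C\<^sup>2) (at t within S)"
    by (intro DERIV_cdivide DERIV_mult DERIV_minus DERIV_add DERIV_cmult denergy dprof dinv)
  have 2: "((\<lambda>t. 3 * profile t * exp (- (C * t)) / C ^ 3) has_real_derivative
     (3 * (C * (2 * e - e\<^sup>2 + 2 * q) / e) * exp (- (C * t)) + (- C / e) * (3 * profile t)) / C ^ 3) (at t within S)"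
    by (intro DERIV_cdivide DERIV_mult DERIV_cmult dprof dinv)
  define c where "c = 3/2 - 3 * (q + 2) * ((1 - 1 / e)\<^sup>2 / C ^ 4 + \<rho>)"
  define w where "w = W t"
  have w: "w = e * C\<^sup>2 - (e - 1)\<^sup>2" by (simp add: w_def W_def e_def)
  have ac: "piece_\<Lambda> t $ 1 $ 1 = (q + 2) * (sqrt 3 * (e - 1) * (w * (1 / e)\<^sup>2 / C ^ 4 - \<rho>))"
    "piece_\<Lambda> t $ 2 $ 1 + 3/2 = c"
    unfolding piece_\<Lambda>_eq mat2_simps mat2_nth e(2) e_def[symmetric] c_def w_def[symmetric]
    by (simp_all add: algebra_simps)
  have xy: "Re (piece_z C t) = (e - 1) / sqrt 3" "Im (piece_z C t) = C * e / sqrt 3"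
    by (simp_all add: piece_z_def e_def)
  have re: "Re (piece_\<nu>' t) = - (2 * (e - 1) * (3 * (q + 2) * (w * (1 / e)\<^sup>2 / C ^ 4 - \<rho>) - c) / (e * C))
      + 3 * profile t / (C * e)"
    unfolding piece_\<nu>'_def Let_def ac xy piece_\<nu>_def complex.sel e(2)
    using e(1) C_pos by (simp add: divide_simps power2_eq_square power3_eq_cube)
      (simp add: sqrt3_mult algebra_simps)
  have im: "Im (piece_\<nu>' t) = 3 * energy t / (C\<^sup>2 * e) + 2 * c + 3 * (energy t + profile t) / (C\<^sup>2 * e) - 6 * profile t / (C\<^sup>2 * e)"
    unfolding piece_\<nu>'_def Let_def ac xy piece_\<nu>_def complex.sel e(2)
    using e(1) C_pos by (simp add: divide_simps power2_eq_square power3_eq_cube)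
  have en: "energy t = ((q * (1 + C\<^sup>2) + 2) * ((1 + C\<^sup>2) * e + 4 / e) + 4 * (1 + C\<^sup>2) - 20 - 8 * q) / (4 * C\<^sup>2)"
    unfolding energy_def e(2) E_eq e_def[symmetric] using e(1) C_pos K
    by (simp add: divide_simps) (simp add: algebra_simps power2_eq_square)
  have den: "den = (q * (1 + C\<^sup>2) + 2) * ((1 + C\<^sup>2) * e - 4 / e) / (4 * C)"
    unfolding den_def E_eq using e(1) C_pos K
    by (simp add: divide_simps power2_eq_square)
  have "(- (3 * den + 3 * (C * (2 * e - e\<^sup>2 + 2 * q) / e)) * exp (- (C * t))
       + (- C / e) * (- (3 * energy t + 3 * profile t))) / C\<^sup>2 = Re (piece_\<nu>' t)"
    unfolding re e(2) en den c_def w \<rho>_def using e(1) C_pos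
    by (simp add: divide_simps power2_eq_square power4_eq_xxxx) (simp add: algebra_simps)
  moreover have "(3 * (C * (2 * e - e\<^sup>2 + 2 * q) / e) * exp (- (C * t)) + (- C / e) * (3 * profile t)) / C ^ 3
      = Im (piece_\<nu>' t)"
    unfolding im e(2) en c_def \<rho>_def using e(1) C_pos
    by (simp add: divide_simps power2_eq_square power3_eq_cube power4_eq_xxxx) (simp add: algebra_simps)
  ultimately show ?thesis
    using has_vector_derivative_Complex[OF 1 2] unfolding piece_\<nu>_def[abs_def] by simp
qed

lemma piece_z_Re_pos: "Re (piece_z C t) + 1 / sqrt 3 = exp (C * t) / sqrt 3"
  by (simp add: piece_z_def field_simps)

lemma piece_hamilton_costate:
  "hamilton_costate (-1) (piece_\<Lambda> t) (piece_z C t) (piece_\<nu> t) e3 (piece_\<nu>' t)"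
proof -
  define z where "z = piece_z C t"
  define x where "x = Re z"
  define y where "y = Im z"
  define a where "a = piece_\<Lambda> t $ 1 $ 1"
  define b where "b = piece_\<Lambda> t $ 1 $ 2 - 3/2"
  define c where "c = piece_\<Lambda> t $ 2 $ 1 + 3/2"
  define \<nu>1 where "\<nu>1 = Re (piece_\<nu> t)"
  define \<nu>2 where "\<nu>2 = Im (piece_\<nu> t)"
  define h where "h = (\<lambda>w. (2 * a * Re w + b - c * ((Re w)\<^sup>2 + (Im w)\<^sup>2)) / Im w
      + \<nu>1 * Im w + \<nu>2 * (Im w)\<^sup>2 / (Re w + 1 / sqrt 3))"
  have y: "y > 0" using Im_piece_z_pos[OF C_pos] by (simp add: y_def z_def)
  have p: "x + 1 / sqrt 3 > 0" "y = C * (x + 1 / sqrt 3)"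
    by (simp_all add: x_def y_def z_def piece_z_Re_pos, simp add: piece_z_def)
  have \<Lambda>: "piece_\<Lambda> t = mat2 a (b + 3/2) (c - 3/2) (- a)"
    by (rule mat2_eqI) (simp_all add: a_def b_def c_def, simp add: piece_\<Lambda>_eq mat2_simps)
  have tr: "trace_form (piece_\<Lambda> t) (X w) - 3/2 * (-1) * trace_form J (X w) =
      (2 * a * Re w + b - c * ((Re w)\<^sup>2 + (Im w)\<^sup>2)) / Im w" if "Im w > 0" for w
    unfolding \<Lambda> trace_form_def J_def X_eq mat2_simps using that
    by (simp add: divide_simps) (simp add: algebra_simps)
  have H: "hamiltonian (-1) (piece_\<Lambda> t) w (piece_\<nu> t) e3 = h w"
    if w: "w \<in> {w. Im w > 0} \<inter> {w. Re w > - (1 / sqrt 3)}" for w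
  proof -
    have "velocity e3 w = Complex (Im w) ((Im w)\<^sup>2 / (Re w + 1 / sqrt 3))"
      unfolding velocity_e3 using w by (simp add: complex_eq_iff power2_eq_square)
    moreover have "Im w > 0" using w by simp
    ultimately show ?thesis
      unfolding hamiltonian_eq by (simp only: tr h_def) (simp add: inner_complex_def \<nu>1_def \<nu>2_def)
  qed
  have A: "(2 * a * x + b - c * (x\<^sup>2 + y\<^sup>2)) / y = sqrt 3 / C * energy t"
    using tr[of z] trace_form_piece_\<Lambda>[of t] y unfolding z_def[symmetric] x_def y_def by simp
  define p where "p = x + 1 / sqrt 3"
  have p: "p > 0" "y = C * p" using p by (simp_all add: p_def)
  have dh: "(h has_derivative (\<lambda>v. ((2 * a - 2 * c * x) / y - \<nu>2 * (y / p)\<^sup>2) * Re v +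
      (- (2 * a * x + b - c * x\<^sup>2) / y\<^sup>2 - c + \<nu>1 + 2 * \<nu>2 * (y / p)) * Im v)) (at z)"
  proof -
    have re: "(Re has_derivative Re) (at z)" and im: "(Im has_derivative Im) (at z)"
      by (simp_all add: bounded_linear_imp_has_derivative bounded_linear_Re bounded_linear_Im)
    have sq: "((\<lambda>w. (f w)\<^sup>2) has_derivative (\<lambda>v. 2 * f z * f' v)) (at z)"
      if "(f has_derivative f') (at z)" for f f' :: "complex \<Rightarrow> real"
      using has_derivative_power[OF that, of 2] by (simp add: mult_ac)
    have num: "((\<lambda>w. 2 * a * Re w + b - c * ((Re w)\<^sup>2 + (Im w)\<^sup>2)) has_derivative
        (\<lambda>v. 2 * a * Re v + 0 - c * (2 * Re z * Re v + 2 * Im z * Im v))) (at z)"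
      by (intro has_derivative_diff has_derivative_add has_derivative_mult_right has_derivative_const re im sq)
    have den: "((\<lambda>w. Re w + 1 / sqrt 3) has_derivative (\<lambda>v. Re v + 0)) (at z)"
      by (intro has_derivative_add has_derivative_const re)
    have nz: "Im z \<noteq> 0" "Re z + 1 / sqrt 3 \<noteq> 0" using y p(1) by (auto simp: y_def p_def x_def)
    note d = has_derivative_add[OF has_derivative_add[OF has_derivative_divide[OF num im nz(1)]
        has_derivative_mult_right[OF im, of \<nu>1]]
        has_derivative_divide[OF has_derivative_mult_right[OF sq[OF im], of \<nu>2] den nz(2)]]
    show ?thesis
      unfolding h_def
      by (rule has_derivative_eq_rhs[OF d])
         (use y p(1) in \<open>simp add: fun_eq_iff field_simps power2_eq_square flip: x_def y_def p_def\<close>)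
  qed
  have G: "(2 * a - 2 * c * x) / y - \<nu>2 * (y / p)\<^sup>2 = - Re (piece_\<nu>' t)"
    unfolding piece_\<nu>'_def Let_def complex.sel
    unfolding a_def[symmetric] c_def[symmetric] z_def[symmetric] x_def[symmetric] y_def[symmetric] \<nu>2_def[symmetric]
    using p by (simp add: right_diff_distrib)
  have "- (2 * a * x + b - c * x\<^sup>2) / y\<^sup>2 = - ((2 * a * x + b - c * (x\<^sup>2 + y\<^sup>2)) / y) / y - c"
    using y by (simp add: field_simps power2_eq_square)
  then have "- (2 * a * x + b - c * x\<^sup>2) / y\<^sup>2 - c + \<nu>1 + 2 * \<nu>2 * (y / p) = - Im (piece_\<nu>' t)"
    unfolding A piece_\<nu>'_def Let_def complex.sel
    unfolding c_def[symmetric] z_def[symmetric] y_def[symmetric] \<nu>2_def[symmetric] \<nu>1_def[symmetric]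
    using p by simp
  from dh[unfolded G this]
  have "(h has_derivative (\<lambda>v. - Re (piece_\<nu>' t) * Re v + - Im (piece_\<nu>' t) * Im v)) (at z)" .
  then have "(h has_derivative (\<lambda>v. - piece_\<nu>' t \<bullet> v)) (at z)"
    by (simp only: inner_complex_def uminus_complex.sel)
  moreover have "open ({w. Im w > 0} \<inter> {w. Re w > - (1 / sqrt 3)})"
    by (intro open_Int open_halfspace_Im_gt open_halfspace_Re_gt)
  moreover have "z \<in> {w. Im w > 0} \<inter> {w. Re w > - (1 / sqrt 3)}"
    using y p(1) by (simp add: x_def y_def p_def)
  ultimately show ?thesis
    unfolding hamilton_costate_def z_def[symmetric]
    by (rule has_derivative_transform_within_open) (simp add: H)
qed

text \<open>By \<open>energy_profile\<close> both sides are multiples of \<open>profile \<tau>\<close>: one of the two coordinates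
  of this matching condition is conservation of the Hamiltonian, the other one fixes \<open>q\<close>.\<close>

lemma piece_\<nu>_end: "piece_\<nu> \<tau> = rotate_costate (piece_z C 0) (piece_\<nu> 0)"
proof -
  have i: "exp (- (C * \<tau>)) = 1 / E" by (simp add: E_def exp_minus inverse_eq_divide)
  have K: "1 + C\<^sup>2 \<noteq> 0" using C_gt by simp
  have e: "energy 0 = - (1 + C\<^sup>2) / (2 * C\<^sup>2) * profile \<tau>" "energy \<tau> = - (1 + C\<^sup>2) / (2 * C\<^sup>2) * profile \<tau>"
    using energy_profile[of 0] energy_profile[of \<tau>] by (simp_all add: profile_0)
  have a: "cnj (automorphy (piece_z C 0)) = Complex 1 C"
    by (simp add: automorphy_def piece_z_0 complex_eq_iff)
  show ?thesis
    unfolding rotate_costate_def a piece_\<nu>_def e i E_eq profile_0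
    using C_pos K
    by (simp add: complex_eq_iff power2_eq_square power3_eq_cube divide_simps) (simp add: algebra_simps)
qed

text \<open>The curve \<open>g\<close> over the rotated piece is \<open>holonomy ** g ** R\<close>: conjugation by \<open>R\<close> comes from the
  symmetry, and left multiplication makes the pieces fit.\<close>

definition holonomy :: "real^2^2" where "holonomy = piece_g C \<tau> ** matrix_inv R"

lemma holonomy_mult_R: "holonomy ** R = piece_g C \<tau>"
  by (simp add: holonomy_def R_inverse flip: matrix_mul_assoc)

lemma holonomy_eq: "holonomy = mat2 (E / 2) (E * C\<^sup>2 / (2 * sqrt 3)) (- (3 * \<rho>) * (E * C\<^sup>2 / (2 * sqrt 3))) (E / 2)"
proof -
  have i: "exp (- (C * \<tau>)) = 1 / E" by (simp add: E_def exp_minus inverse_eq_divide)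
  have K: "1 + C\<^sup>2 \<noteq> 0" using C_gt by simp
  show ?thesis
    unfolding holonomy_def piece_g_def inv_R_eq mat2_simps i E_def[symmetric] unfolding E_eq \<rho>_def
    using C_pos K by (simp add: divide_simps power2_eq_square power4_eq_xxxx sqrt3_mult) (simp add: sqrt3_mult algebra_simps)
qed

lemma det_holonomy: "det holonomy = 1"
  unfolding holonomy_def by (simp add: det_mul det_piece_g[OF C_pos] inv_R_eq mat2_simps)

lemma holonomy_\<Lambda>0_commute: "holonomy ** \<Lambda>0 = \<Lambda>0 ** holonomy"
  unfolding holonomy_eq \<Lambda>0_def mat2_simps by simp

end

section \<open>Linear matrix differential equations\<close>

lemma bounded_bilinear_matrix_mult: "bounded_bilinear ((**) :: real^2^2 \<Rightarrow> real^2^2 \<Rightarrow> real^2^2)"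
proof -
  have "bilinear ((**) :: real^2^2 \<Rightarrow> real^2^2 \<Rightarrow> real^2^2)"
    unfolding bilinear_def
    by (intro conjI allI linearI; rule mat2_eqI) (simp_all add: matrix_matrix_mult_def sum_2 algebra_simps)
  then show ?thesis by (simp add: bilinear_conv_bounded_bilinear)
qed

lemmas has_vector_derivative_matrix_mult =
  bounded_bilinear.has_vector_derivative[OF bounded_bilinear_matrix_mult]
lemmas continuous_on_matrix_mult [continuous_intros] =
  bounded_bilinear.continuous_on[OF bounded_bilinear_matrix_mult]

lemma bounded_linear_adj2: "bounded_linear adj2"
proof -
  have "linear adj2" by (rule linearI) (simp_all add: adj2_def mat2_simps)
  then show ?thesis by (simp add: linear_conv_bounded_linear)
qed

lemma adj2_mult: "adj2 (A ** B) = adj2 B ** adj2 A"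
  by (rule mat2_cases[of A], rule mat2_cases[of B]) (simp add: adj2_def mat2_simps algebra_simps)

lemma adj2_inverse: "det A = 1 \<Longrightarrow> A ** adj2 A = mat 1" "det A = 1 \<Longrightarrow> adj2 A ** A = mat 1"
  by (rule mat2_cases[of A], simp add: adj2_def mat2_simps algebra_simps)+

lemma adj2_tracefree: "trace A = 0 \<Longrightarrow> adj2 A = - A"
  by (rule mat2_cases[of A]) (simp add: adj2_def mat2_simps)

lemma adj2_R: "adj2 R = matrix_inv R"
  unfolding inv_R_eq unfolding R_eq by (simp add: adj2_def)

lemma trace_X: "trace (X z) = 0"
  by (simp add: X_eq mat2_simps)

lemma matrix_mult_minus: "A ** (- B) = - (A ** B)" "(- A) ** B = - (A ** B)" for A B :: "real^2^2"
  by (rule mat2_cases[of A], rule mat2_cases[of B], simp add: mat2_simps)+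

text \<open>The quotient \<open>g1 g2\<^sup>-\<^sup>1\<close> has derivative zero.\<close>

lemma matrix_ode_unique:
  fixes g1 g2 \<Xi> :: "real \<Rightarrow> real^2^2"
  assumes g1: "\<And>t. t \<in> {0..T} \<Longrightarrow> (g1 has_vector_derivative g1 t ** \<Xi> t) (at t within {0..T})"
    and g2: "\<And>t. t \<in> {0..T} \<Longrightarrow> (g2 has_vector_derivative g2 t ** \<Xi> t) (at t within {0..T})"
    and tr: "\<And>t. t \<in> {0..T} \<Longrightarrow> trace (\<Xi> t) = 0"
    and det: "\<And>t. t \<in> {0..T} \<Longrightarrow> det (g2 t) = 1"
    and init: "g1 0 = g2 0" and t: "t \<in> {0..T}"
  shows "g1 t = g2 t"
proof -
  have d: "((\<lambda>t. g1 t ** adj2 (g2 t)) has_derivative (\<lambda>_. 0)) (at t within {0..T})"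
    if t: "t \<in> {0..T}" for t
  proof -
    have "((\<lambda>t. g1 t ** adj2 (g2 t)) has_vector_derivative
        g1 t ** adj2 (g2 t ** \<Xi> t) + (g1 t ** \<Xi> t) ** adj2 (g2 t)) (at t within {0..T})"
      by (intro has_vector_derivative_matrix_mult g1 t
          bounded_linear.has_vector_derivative[OF bounded_linear_adj2] g2)
    also have "g1 t ** adj2 (g2 t ** \<Xi> t) + (g1 t ** \<Xi> t) ** adj2 (g2 t) = 0"
      using tr[OF t] by (simp add: adj2_mult adj2_tracefree matrix_mult_minus matrix_mul_assoc)
    finally show ?thesis by (simp add: has_vector_derivative_def)
  qed
  have "\<exists>c. \<forall>t\<in>{0..T}. g1 t ** adj2 (g2 t) = c"
    using has_derivative_zero_constant[of "{0..T}" "\<lambda>t. g1 t ** adj2 (g2 t)"] d by auto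
  moreover have 0: "0 \<in> {0..T}" using t by simp
  ultimately have "g1 t ** adj2 (g2 t) = g1 0 ** adj2 (g2 0)" using t by metis
  also have "\<dots> = mat 1" using init adj2_inverse(1)[OF det[OF 0]] by simp
  finally have "(g1 t ** adj2 (g2 t)) ** g2 t = g2 t" by simp
  then show ?thesis using adj2_inverse(2)[OF det[OF t]] by (simp flip: matrix_mul_assoc)
qed

section \<open>Concatenation of curves\<close>

text \<open>At a junction the later piece is used. A match of the pieces makes the value independent of this
  choice.\<close>

definition glue :: "real \<Rightarrow> (nat \<Rightarrow> real \<Rightarrow> 'a) \<Rightarrow> real \<Rightarrow> 'a" where
  "glue \<tau> F t = F (nat \<lfloor>t / \<tau>\<rfloor>) (t - real (nat \<lfloor>t / \<tau>\<rfloor>) * \<tau>)"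

lemma nat_floor_piece:
  assumes "\<tau> > 0" "real j * \<tau> \<le> t" "t < real (Suc j) * \<tau>"
  shows "nat \<lfloor>t / \<tau>\<rfloor> = j"
proof -
  have "\<lfloor>t / \<tau>\<rfloor> = int j"
    using assms by (intro floor_unique) (simp_all add: field_simps)
  then show ?thesis by simp
qed

lemma glue_eq:
  assumes "\<tau> > 0" "F (Suc j) 0 = F j \<tau>" "real j * \<tau> \<le> t" "t \<le> real (Suc j) * \<tau>"
  shows "glue \<tau> F t = F j (t - real j * \<tau>)"
proof (cases "t < real (Suc j) * \<tau>")
  case True
  then show ?thesis using nat_floor_piece[of \<tau> j t] assms by (simp add: glue_def)
next
  case False
  then have t: "t = real (Suc j) * \<tau>" using assms by linarith
  have "nat \<lfloor>t / \<tau>\<rfloor> = Suc j"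
    by (rule nat_floor_piece) (use assms t in \<open>auto simp: algebra_simps\<close>)
  then show ?thesis using assms t by (simp add: glue_def algebra_simps)
qed

lemma piece_cases:
  assumes "\<tau> > 0" "t \<in> {0..real n * \<tau>}" "n > 0"
  obtains j where "j < n" "real j * \<tau> \<le> t" "t \<le> real (Suc j) * \<tau>"
proof (cases "t = real n * \<tau>")
  case True
  with assms show ?thesis by (intro that[of "n - 1"]) (auto simp: algebra_simps)
next
  case False
  define j where "j = nat \<lfloor>t / \<tau>\<rfloor>"
  have "0 \<le> t / \<tau>" "t / \<tau> < real n" using assms False by (auto simp: field_simps)
  then have "real j \<le> t / \<tau>" "t / \<tau> < real j + 1" "j < n"
    unfolding j_def by linarith+
  with assms show ?thesis by (intro that[of j]) (auto simp: field_simps)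
qed

lemma glue_lipschitz:
  fixes F :: "nat \<Rightarrow> real \<Rightarrow> 'a::metric_space"
  assumes \<tau>: "\<tau> > 0" and match: "\<And>j. F (Suc j) 0 = F j \<tau>"
    and lip: "\<And>j. \<exists>L. L-lipschitz_on {0..\<tau>} (F j)"
  shows "\<exists>L. L-lipschitz_on {0..real n * \<tau>} (glue \<tau> F)"
proof (induction n)
  case 0
  show ?case by (rule exI[of _ 0]) (simp add: lipschitz_on_def)
next
  case (Suc n)
  then obtain L where L: "L-lipschitz_on {0..real n * \<tau>} (glue \<tau> F)" by blast
  obtain M where M: "M-lipschitz_on {0..\<tau>} (F n)" using lip by blast
  have "M-lipschitz_on {real n * \<tau>..real (Suc n) * \<tau>} (glue \<tau> F)"
  proof (rule lipschitz_onI)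
    fix s t assume st: "s \<in> {real n * \<tau>..real (Suc n) * \<tau>}" "t \<in> {real n * \<tau>..real (Suc n) * \<tau>}"
    then have "glue \<tau> F s = F n (s - real n * \<tau>)" "glue \<tau> F t = F n (t - real n * \<tau>)"
      using glue_eq[of \<tau> F n, OF \<tau> match] by auto
    then show "dist (glue \<tau> F s) (glue \<tau> F t) \<le> M * dist s t"
      using lipschitz_onD[OF M, of "s - real n * \<tau>" "t - real n * \<tau>"] st
      by (simp add: dist_real_def algebra_simps)
  qed (rule lipschitz_on_nonneg[OF M])
  from lipschitz_on_concat_max[OF L this refl]
  show ?case by auto
qed

lemma glue_has_vector_derivative:
  fixes F :: "nat \<Rightarrow> real \<Rightarrow> 'a::real_normed_vector"
  assumes \<tau>: "\<tau> > 0" and t: "real j * \<tau> < t" "t < real (Suc j) * \<tau>"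
    and d: "(F j has_vector_derivative d) (at (t - real j * \<tau>) within {0..\<tau>})"
  shows "(glue \<tau> F has_vector_derivative d) (at t within S)"
proof -
  have "t - real j * \<tau> \<in> interior {0..\<tau>}" using t by (simp add: algebra_simps)
  then have "(F j has_vector_derivative d) (at (t - real j * \<tau>))"
    using d at_within_interior by metis
  moreover have "((\<lambda>t. t - real j * \<tau>) has_vector_derivative 1) (at t)"
    by (auto intro!: derivative_eq_intros)
  ultimately have "((F j \<circ> (\<lambda>t. t - real j * \<tau>)) has_vector_derivative 1 *\<^sub>R d) (at t)"
    by (intro vector_diff_chain_at) auto
  then have "((\<lambda>t. F j (t - real j * \<tau>)) has_vector_derivative d) (at t)" by (simp add: o_def)
  then have "(glue \<tau> F has_vector_derivative d) (at t)"
  proof (rule has_vector_derivative_transform_within_open[where S = "{real j * \<tau><..<real (Suc j) * \<tau>}"])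
    fix s assume "s \<in> {real j * \<tau><..<real (Suc j) * \<tau>}"
    then show "F j (s - real j * \<tau>) = glue \<tau> F s"
      using nat_floor_piece[OF \<tau>, of j s] by (simp add: glue_def)
  qed (use t in auto)
  then show ?thesis by (rule has_vector_derivative_at_within)
qed

lemma AE_off_switching_times:
  assumes \<tau>: "\<tau> > 0" and n: "n > 0"
    and P: "\<And>j t. \<lbrakk>j < n; real j * \<tau> < t; t < real (Suc j) * \<tau>\<rbrakk> \<Longrightarrow> P t"
  shows "AE t in lebesgue_on {0..real n * \<tau>}. P t"
  unfolding AE_lebesgue_on_iff_negligible
proof (rule negligible_subset)
  show "negligible ((\<lambda>j. real j * \<tau>) ` {..n})" by (intro negligible_finite) simp
  show "{t \<in> {0..real n * \<tau>}. \<not> P t} \<subseteq> (\<lambda>j. real j * \<tau>) ` {..n}"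
  proof
    fix t assume "t \<in> {t \<in> {0..real n * \<tau>}. \<not> P t}"
    then have t: "t \<in> {0..real n * \<tau>}" "\<not> P t" by auto
    obtain j where j: "j < n" "real j * \<tau> \<le> t" "t \<le> real (Suc j) * \<tau>"
      using piece_cases[OF \<tau> t(1) n] .
    with P[OF j(1)] t(2) have "t = real j * \<tau> \<or> t = real (Suc j) * \<tau>" by force
    then show "t \<in> (\<lambda>j. real j * \<tau>) ` {..n}"
    proof
      assume "t = real j * \<tau>"
      then show ?thesis by (rule image_eqI) (use j(1) in simp)
    next
      assume "t = real (Suc j) * \<tau>"
      then show ?thesis by (rule image_eqI) (use j(1) in simp)
    qed
  qed
qed

section \<open>Uniqueness of trajectories\<close>

lemma abs_continuous_on_linear:
  assumes "abs_continuous_on a b f" "bounded_linear T"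
  shows "abs_continuous_on a b (\<lambda>t. T (f t))"
proof -
  obtain K where K: "\<And>x. norm (T x) \<le> norm x * K"
    using bounded_linear.bounded[OF assms(2)] by blast
  show ?thesis
    by (rule abs_continuous_on_Lipschitz_bound[OF assms(1), where L = K])
       (use K in \<open>simp add: dist_norm mult.commute flip: linear_diff[OF bounded_linear.linear[OF assms(2)]]\<close>)
qed

text \<open>The half of the notion of trajectory that concerns \<open>z\<close> alone, with a constant control. It is
  transported by \<open>rotate_z\<close>, which reduces the uniqueness on every piece to the first piece.\<close>

definition flow :: "real \<Rightarrow> control \<Rightarrow> (real \<Rightarrow> complex) \<Rightarrow> bool" where
  "flow T u z \<longleftrightarrow> abs_continuous_on 0 T z \<and> (\<forall>t\<in>{0..T}. Im (z t) > 0) \<and>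
     (AE t in lebesgue_on {0..T}. (z has_vector_derivative velocity u (z t)) (at t within {0..T}))"

text \<open>The velocity is discontinuous along \<open>Re z = - 1 / sqrt 3\<close>, where the denominator vanishes and the
  quotient has the conventional value \<open>0\<close>. The real part of the velocity is nonnegative even there, so
  the trajectory moves away from this line and the equation holds everywhere.\<close>

lemma flow_e3_unique:
  assumes fl: "flow T e3 z" and C: "C > 0" and init: "z 0 = piece_z C 0" and t: "t \<in> {0..T}"
  shows "z t = piece_z C t"
proof -
  have ac: "abs_continuous_on 0 T z" and im: "\<And>t. t \<in> {0..T} \<Longrightarrow> Im (z t) > 0"
    and ae: "AE t in lebesgue_on {0..T}. (z has_vector_derivative velocity e3 (z t)) (at t within {0..T})"
    using fl by (auto simp: flow_def)
  have re: "Re (z t) \<ge> 0" if t: "t \<in> {0..T}" for t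
  proof -
    have "Re (z 0) \<le> Re (z t)"
    proof (rule abs_continuous_increment_ge[where f = "\<lambda>t. Re (z t)" and a = 0 and b = t])
      show "abs_continuous_on 0 t (\<lambda>t. Re (z t))"
        by (rule abs_continuous_on_subinterval[OF abs_continuous_on_linear[OF ac bounded_linear_Re]])
           (use t in auto)
      have "{s \<in> {0..t}. \<not> (\<exists>d\<ge>0. ((\<lambda>t. Re (z t)) has_real_derivative d) (at s within {0..t}))}
        \<subseteq> {s \<in> {0..T}. \<not> (z has_vector_derivative velocity e3 (z s)) (at s within {0..T})}"
      proof (safe, goal_cases)
        case (2 s)
        have s: "s \<in> {0..T}" using 2(1) t by auto
        have "(z has_vector_derivative velocity e3 (z s)) (at s within {0..t})"
          using 2(3) by (rule has_vector_derivative_within_subset) (use t in auto)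
        then have "((\<lambda>t. Re (z t)) has_real_derivative Re (velocity e3 (z s))) (at s within {0..t})"
          by (simp add: has_vector_derivative_complex_iff)
        moreover have "Re (velocity e3 (z s)) \<ge> 0"
          unfolding velocity_e3 using im[OF s] by (simp add: zero_le_divide_iff zero_le_mult_iff)
        ultimately show ?case using 2(2) by blast
      qed (use t in auto)
      then show "AE s in lebesgue_on {0..t}. \<exists>d\<ge>0. ((\<lambda>t. Re (z t)) has_real_derivative d) (at s within {0..t})"
        using ae unfolding AE_lebesgue_on_iff_negligible by (rule negligible_subset[rotated])
    qed (use t in auto)
    then show ?thesis by (simp add: init piece_z_def)
  qed
  define p where "p = (\<lambda>t. Re (z t) + 1 / sqrt 3)"
  have p: "p t > 0" if "t \<in> {0..T}" for t
    using re[OF that] by (simp add: p_def add_nonneg_pos)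
  have cz: "continuous_on {0..T} z" by (rule abs_continuous_on_imp_continuous_on[OF ac])
  have pne: "Re (z t) + 1 / sqrt 3 \<noteq> 0" if "t \<in> {0..T}" for t
    using p[OF that] by (simp add: p_def)
  have "continuous_on {0..T} (\<lambda>t. velocity e3 (z t))"
    unfolding velocity_e3
    by (intro continuous_intros cz ballI) (simp only: of_real_eq_0_iff pne not_False_eq_True)
  then have dz: "(z has_vector_derivative velocity e3 (z t)) (at t within {0..T})" if "t \<in> {0..T}" for t
    by (rule has_vector_derivative_AE_continuous[OF ac _ ae that])
  have vel: "velocity e3 (z t) = Complex (Im (z t)) ((Im (z t))\<^sup>2 / p t)" if "t \<in> {0..T}" for t
    unfolding velocity_e3 using p[OF that] by (simp add: p_def complex_eq_iff power2_eq_square)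
  have dRe: "((\<lambda>t. Re (z t)) has_real_derivative Im (z t)) (at t within {0..T})"
    and dIm: "((\<lambda>t. Im (z t)) has_real_derivative (Im (z t))\<^sup>2 / p t) (at t within {0..T})" if "t \<in> {0..T}" for t
    using dz[OF that] unfolding vel[OF that] has_vector_derivative_complex_iff by simp_all
  have dp: "(p has_real_derivative Im (z t)) (at t within {0..T})" if "t \<in> {0..T}" for t
    using DERIV_add[OF dRe[OF that] DERIV_const[of "1 / sqrt 3"]] by (simp add: p_def[abs_def])
  have 0: "0 \<in> {0..T}" using t by auto
  have "((\<lambda>t. Im (z t) / p t) has_real_derivative 0) (at t within {0..T})" if "t \<in> {0..T}" for t
    using DERIV_divide[OF dIm[OF that] dp[OF that]] p[OF that] by (simp add: power2_eq_square)
  then have "\<exists>c. \<forall>t\<in>{0..T}. Im (z t) / p t = c"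
    by (intro has_field_derivative_zero_constant) auto
  then have ratio: "Im (z t) / p t = Im (z 0) / p 0" if "t \<in> {0..T}" for t
    using 0 that by metis
  have Imz: "Im (z t) = C * p t" if "t \<in> {0..T}" for t
    using ratio[OF that] p[OF that] by (simp add: init piece_z_def p_def field_simps)
  have "((\<lambda>t. p t * exp (- (C * t))) has_real_derivative 0) (at t within {0..T})" if "t \<in> {0..T}" for t
    using dp[OF that] Imz[OF that] by (auto intro!: derivative_eq_intros)
  then have "\<exists>c. \<forall>t\<in>{0..T}. p t * exp (- (C * t)) = c"
    by (intro has_field_derivative_zero_constant) auto
  then have "p t * exp (- (C * t)) = p 0 * exp (- (C * 0))" using 0 t by metis
  moreover have "p 0 = 1 / sqrt 3" by (simp add: p_def init piece_z_def)
  ultimately have "p t * exp (- (C * t)) = 1 / sqrt 3" by simp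
  then have "p t * (exp (- (C * t)) * exp (C * t)) = exp (C * t) / sqrt 3" by (simp flip: mult.assoc)
  then have pt: "p t = exp (C * t) / sqrt 3" by (simp flip: exp_add)
  then have "Re (z t) = exp (C * t) / sqrt 3 - 1 / sqrt 3" unfolding p_def by linarith
  then have "Re (z t) = (exp (C * t) - 1) / sqrt 3" by (simp only: diff_divide_distrib)
  with Imz[OF t] pt show ?thesis by (simp add: piece_z_def complex_eq_iff)
qed

text \<open>The rotation is Lipschitz continuous on the compact image of \<open>z\<close>, hence preserves absolute
  continuity.\<close>

lemma flow_rotate:
  assumes fl: "flow T u z"
  shows "flow T (rotate_control u) (\<lambda>t. rotate_z (z t))"
proof -
  have ac: "abs_continuous_on 0 T z" and im: "\<And>t. t \<in> {0..T} \<Longrightarrow> Im (z t) > 0"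
    and ae: "AE t in lebesgue_on {0..T}. (z has_vector_derivative velocity u (z t)) (at t within {0..T})"
    using fl by (auto simp: flow_def)
  have cz: "continuous_on {0..T} z" by (rule abs_continuous_on_imp_continuous_on[OF ac])
  have "\<exists>m>0. \<forall>t\<in>{0..T}. m \<le> norm (automorphy (z t))"
  proof (cases "{0..T} = {}")
    case False
    have "continuous_on {0..T} (\<lambda>t. norm (automorphy (z t)))"
      unfolding automorphy_def by (intro continuous_intros cz)
    from continuous_attains_inf[OF compact_Icc False this]
    obtain t0 where t0: "t0 \<in> {0..T}" "\<forall>t\<in>{0..T}. norm (automorphy (z t0)) \<le> norm (automorphy (z t))" by blast
    moreover have "norm (automorphy (z t0)) > 0" using im[OF t0(1)] by (simp add: automorphy_nonzero)
    ultimately show ?thesis by blast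
  qed (auto intro: exI[of _ 1])
  then obtain m where m: "m > 0" "\<And>t. t \<in> {0..T} \<Longrightarrow> m \<le> norm (automorphy (z t))" by blast
  have "abs_continuous_on 0 T (\<lambda>t. rotate_z (z t))"
  proof (rule abs_continuous_on_Lipschitz_bound[OF ac, where L = "4 / (m * m)"])
    fix s t assume st: "s \<in> {0..T}" "t \<in> {0..T}"
    define D where "D = automorphy (z s)"
    define D' where "D' = automorphy (z t)"
    have nz: "D \<noteq> 0" "D' \<noteq> 0"
      using im[OF st(1)] im[OF st(2)] by (auto simp: D_def D'_def dest!: automorphy_nonzero[OF less_imp_neq[THEN not_sym]])
    have "rotate_z (z s) - rotate_z (z t) =
        ((z s + of_real (sqrt 3)) * D' - (z t + of_real (sqrt 3)) * D) / (D * D')"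
      unfolding rotate_z_eq D_def[symmetric] D'_def[symmetric] using nz by (simp add: field_simps)
    also have "(z s + of_real (sqrt 3)) * D' - (z t + of_real (sqrt 3)) * D = 4 * (z s - z t)"
      unfolding D_def D'_def automorphy_def using sqrt3_sq by (simp add: algebra_simps flip: mult.assoc)
    finally have "dist (rotate_z (z s)) (rotate_z (z t)) = 4 / (norm D * norm D') * dist (z s) (z t)"
      by (simp add: dist_norm norm_divide norm_mult del: right_diff_distrib_numeral)
    also have "\<dots> \<le> 4 / (m * m) * dist (z s) (z t)"
      using m st nz by (intro mult_right_mono divide_left_mono mult_mono mult_pos_pos)
        (auto simp: D_def D'_def)
    finally show "dist (rotate_z (z s)) (rotate_z (z t)) \<le> 4 / (m * m) * dist (z s) (z t)" .
  qed
  moreover have "AE t in lebesgue_on {0..T}. ((\<lambda>t. rotate_z (z t)) has_vector_derivative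
      velocity (rotate_control u) (rotate_z (z t))) (at t within {0..T})"
    using ae unfolding AE_lebesgue_on_iff_negligible
  proof (rule negligible_subset, safe, goal_cases)
    case (1 t)
    have "Im (z t) > 0" using im 1 by simp
    then have "((rotate_z \<circ> z) has_vector_derivative velocity u (z t) * (4 / (automorphy (z t))\<^sup>2)) (at t within {0..T})"
      by (intro field_vector_diff_chain_within 1 rotate_z_has_derivative) simp
    with 1 show ?case
      by (simp add: velocity_rotate[OF \<open>Im (z t) > 0\<close>] o_def mult.commute)
  qed
  ultimately show ?thesis using im by (simp add: flow_def Im_rotate_z_pos)
qed

section \<open>Maximality over the control set\<close>

lemma continuous_on_mat2 [continuous_intros]:
  assumes "continuous_on S a" "continuous_on S b" "continuous_on S c" "continuous_on S d"
  shows "continuous_on S (\<lambda>x. mat2 (a x) (b x) (c x) (d x))"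
  unfolding mat2_expand[of "a _"] by (intro continuous_intros assms)

lemma continuous_on_X:
  assumes z: "continuous_on S z" and im: "\<And>t. t \<in> S \<Longrightarrow> Im (z t) > 0"
  shows "continuous_on S (\<lambda>t. X (z t))"
proof -
  have "Im (z t) \<noteq> 0" if "t \<in> S" for t using im[OF that] by simp
  then show ?thesis
    unfolding X_eq by (intro continuous_intros z continuous_on_mat2) auto
qed

lemma rotate_control_vertices [simp]:
  "rotate_control e3 = e1" "rotate_control e1 = e2" "rotate_control e2 = e3"
  by (simp_all add: rotate_control_def e1_def e2_def e3_def)

lemma rotate_control_cube: "rotate_control (rotate_control (rotate_control u)) = u"
  by (simp add: rotate_control_def split: prod.splits)

lemma rotate_control_in_control_set: "u \<in> control_set \<Longrightarrow> rotate_control u \<in> control_set"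
  by (auto simp: rotate_control_def control_set_def)

lemma vertices_in_control_set: "e1 \<in> control_set" "e2 \<in> control_set" "e3 \<in> control_set"
  by (simp_all add: control_set_def e1_def e2_def e3_def)

lemma rotate_control_funpow: "(rotate_control ^^ j) e3 = [e3, e1, e2] ! (j mod 3)"
proof (induction j)
  case (Suc j)
  have "j mod 3 = 0 \<or> j mod 3 = 1 \<or> j mod 3 = 2" by linarith
  then show ?case using Suc by (auto simp: mod_Suc numeral_2_eq_2)
qed simp

lemma field_den_vertices:
  "field_den (u0, u1, u2) z = u0 * field_den e1 z + u1 * field_den e2 z + u2 * field_den e3 z"
  by (simp add: field_den_def ctrl_a_def ctrl_b_def ctrl_c_def e1_def e2_def e3_def
      algebra_simps add_divide_distrib diff_divide_distrib)

lemma field_num_vertices: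
  "field_num (u0, u1, u2) z =
     of_real u0 * field_num e1 z + of_real u1 * field_num e2 z + of_real u2 * field_num e3 z"
  by (simp add: field_num_def ctrl_a_def ctrl_b_def ctrl_c_def e1_def e2_def e3_def
      algebra_simps add_divide_distrib diff_divide_distrib)

lemma field_den_neg:
  assumes neg: "field_den e1 z < 0" "field_den e2 z < 0" "field_den e3 z < 0" and u: "u \<in> control_set"
  shows "field_den u z < 0"
proof -
  obtain u0 u1 u2 where uu: "u = (u0, u1, u2)" "u0 + u1 + u2 = 1" "u0 \<ge> 0" "u1 \<ge> 0" "u2 \<ge> 0"
    using u by (auto simp: control_set_def)
  define m where "m = Max {field_den e1 z, field_den e2 z, field_den e3 z}"
  have m: "m < 0" "field_den e1 z \<le> m" "field_den e2 z \<le> m" "field_den e3 z \<le> m"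
    using neg by (auto simp: m_def)
  have "field_den u z \<le> u0 * m + u1 * m + u2 * m"
    unfolding uu(1) field_den_vertices using uu m by (intro add_mono mult_left_mono) auto
  also have "\<dots> = m" using uu(2) by (simp flip: distrib_right)
  finally show ?thesis using m by simp
qed

text \<open>After multiplication by the negative denominator the Hamiltonian becomes a linear function \<open>L\<close> of
  the barycentric coordinates.\<close>

lemma hamiltonian_le_0:
  assumes neg: "field_den e1 z < 0" "field_den e2 z < 0" "field_den e3 z < 0" and u: "u \<in> control_set"
    and H: "hamiltonian lc \<Lambda> z \<nu> e1 \<le> 0" "hamiltonian lc \<Lambda> z \<nu> e2 \<le> 0" "hamiltonian lc \<Lambda> z \<nu> e3 \<le> 0"
  shows "hamiltonian lc \<Lambda> z \<nu> u \<le> 0"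
proof -
  \<comment> \<open>The product of the Hamiltonian and \<open>field_den\<close>.\<close>
  define L where "L = (\<lambda>u. (trace_form \<Lambda> (X z) - 3/2 * lc * trace_form J (X z)) * field_den u z
      + Im z * (\<nu> \<bullet> field_num u z))"
  have L: "hamiltonian lc \<Lambda> z \<nu> v * field_den v z = L v" if "field_den v z < 0" for v
  proof -
    have "\<nu> \<bullet> velocity v z = Im z / field_den v z * (\<nu> \<bullet> field_num v z)"
      unfolding velocity_def by (simp add: inner_complex_def algebra_simps)
    then show ?thesis using that unfolding hamiltonian_eq L_def by (simp add: field_simps)
  qed
  have V: "L v \<ge> 0" if "hamiltonian lc \<Lambda> z \<nu> v \<le> 0" "field_den v z < 0" for v
    using that L[of v] mult_nonpos_nonpos[of "hamiltonian lc \<Lambda> z \<nu> v" "field_den v z"] by simp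
  obtain u0 u1 u2 where uu: "u = (u0, u1, u2)" "u0 \<ge> 0" "u1 \<ge> 0" "u2 \<ge> 0"
    using u by (auto simp: control_set_def)
  have "L u = u0 * L e1 + u1 * L e2 + u2 * L e3"
    unfolding L_def uu(1) field_den_vertices field_num_vertices
    by (simp add: inner_complex_def algebra_simps)
  also have "\<dots> \<ge> 0" using V H neg uu by simp
  finally have "L u \<ge> 0" .
  then show ?thesis using L[of u] field_den_neg[OF neg u]
    by (metis mult_neg_pos not_le mult.commute linorder_not_less)
qed

lemma star_of_field_den:
  assumes "Im z > 0" "field_den e1 z < 0" "field_den e2 z < 0" "field_den e3 z < 0"
  shows "z \<in> upper_half_plane_star"
proof -
  have "field_den e1 z = 1/3 - ((Re z)\<^sup>2 + (Im z)\<^sup>2)"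
    by (simp add: field_den_def e1_def ctrl_a_def ctrl_b_def ctrl_c_def)
  moreover have e2: "field_den e2 z = 2 / sqrt 3 * (Re z - 1 / sqrt 3)"
    and e3: "field_den e3 z = 2 / sqrt 3 * (- Re z - 1 / sqrt 3)"
    by (simp_all add: field_den_def e2_def e3_def ctrl_a_def ctrl_b_def ctrl_c_def field_simps)
  have "w < 0" if "2 / sqrt 3 * w < 0" for w
    using that by (simp add: divide_less_0_iff mult_less_0_iff)
  from this[of "Re z - 1 / sqrt 3"] this[of "- Re z - 1 / sqrt 3"]
  have "\<bar>Re z\<bar> < 1 / sqrt 3" using assms(3,4) unfolding e2 e3 by linarith
  ultimately show ?thesis using assms
    by (simp add: upper_half_plane_star_def upper_half_plane_def)
qed

section \<open>Rotated copies of the first piece\<close>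

context polygon_piece
begin

text \<open>The data over piece number \<open>j\<close>, with time counted from the beginning of the piece.\<close>

definition z_iter :: "nat \<Rightarrow> real \<Rightarrow> complex" where
  "z_iter j t = (rotate_z ^^ j) (piece_z C t)"

definition u_iter :: "nat \<Rightarrow> control" where
  "u_iter j = (rotate_control ^^ j) e3"

primrec g_iter :: "nat \<Rightarrow> real \<Rightarrow> real^2^2" where
  "g_iter 0 t = piece_g C t"
| "g_iter (Suc j) t = holonomy ** g_iter j t ** R"

definition \<Lambda>_iter :: "nat \<Rightarrow> real \<Rightarrow> real^2^2" where
  "\<Lambda>_iter j t = adj2 (g_iter j t) ** \<Lambda>0 ** g_iter j t"

primrec \<nu>_iter :: "nat \<Rightarrow> real \<Rightarrow> complex" where
  "\<nu>_iter 0 t = piece_\<nu> t"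
| "\<nu>_iter (Suc j) t = rotate_costate (z_iter j t) (\<nu>_iter j t)"

primrec \<nu>'_iter :: "nat \<Rightarrow> real \<Rightarrow> complex" where
  "\<nu>'_iter 0 t = piece_\<nu>' t"
| "\<nu>'_iter (Suc j) t = \<nu>'_iter j t * (cnj (automorphy (z_iter j t)))\<^sup>2 / 4
     - \<nu>_iter j t * cnj (automorphy (z_iter j t)) * of_real (sqrt 3) * cnj (velocity (u_iter j) (z_iter j t)) / 2"

lemma z_iter_0 [simp]: "z_iter 0 t = piece_z C t"
  and z_iter_Suc [simp]: "z_iter (Suc j) t = rotate_z (z_iter j t)"
  by (simp_all add: z_iter_def)

lemma u_iter_0 [simp]: "u_iter 0 = e3"
  and u_iter_Suc [simp]: "u_iter (Suc j) = rotate_control (u_iter j)"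
  by (simp_all add: u_iter_def)

lemma u_iter_in_control_set: "u_iter j \<in> control_set"
  by (induction j) (auto intro: vertices_in_control_set rotate_control_in_control_set)

lemma Im_z_iter_pos: "Im (z_iter j t) > 0"
  by (induction j) (auto simp: Im_piece_z_pos[OF C_pos] intro: Im_rotate_z_pos)

lemma z_iter_has_derivative:
  "(z_iter j has_vector_derivative velocity (u_iter j) (z_iter j t)) (at t within S)"
proof (induction j)
  case 0
  then show ?case using piece_z_has_derivative by (simp add: z_iter_def[abs_def])
next
  case (Suc j)
  have "((rotate_z \<circ> z_iter j) has_vector_derivative
      velocity (u_iter j) (z_iter j t) * (4 / (automorphy (z_iter j t))\<^sup>2)) (at t within S)"
    using Im_z_iter_pos[of j t]
    by (intro field_vector_diff_chain_within Suc rotate_z_has_derivative) simp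
  moreover have "z_iter (Suc j) = rotate_z \<circ> z_iter j" by (simp add: fun_eq_iff)
  moreover have "velocity (u_iter (Suc j)) (z_iter (Suc j) t) =
      velocity (u_iter j) (z_iter j t) * (4 / (automorphy (z_iter j t))\<^sup>2)"
    by (simp add: velocity_rotate[OF Im_z_iter_pos])
  ultimately show ?case by (simp only:)
qed

lemma det_g_iter: "det (g_iter j t) = 1"
  by (induction j) (simp_all add: det_piece_g[OF C_pos] det_mul det_holonomy, simp add: R_eq mat2_simps)

lemma X_z_iter_Suc: "X (z_iter (Suc j) t) = matrix_inv R ** X (z_iter j t) ** R"
  using X_rotate_z[OF Im_z_iter_pos] by simp

lemma g_iter_has_derivative:
  "(g_iter j has_vector_derivative g_iter j t ** X (z_iter j t)) (at t within S)"
proof (induction j)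
  case 0
  have "g_iter 0 = piece_g C" by (simp add: fun_eq_iff)
  then show ?case using piece_g_has_derivative[OF C_pos] by simp
next
  case (Suc j)
  have "((\<lambda>t. holonomy ** g_iter j t ** R) has_vector_derivative holonomy ** (g_iter j t ** X (z_iter j t)) ** R) (at t within S)"
    by (intro bounded_linear.has_vector_derivative[OF bounded_bilinear.bounded_linear_left[OF bounded_bilinear_matrix_mult]]
         bounded_linear.has_vector_derivative[OF bounded_bilinear.bounded_linear_right[OF bounded_bilinear_matrix_mult]] Suc)
  moreover have "holonomy ** (g_iter j t ** X (z_iter j t)) ** R =
      (holonomy ** g_iter j t) ** (R ** matrix_inv R) ** X (z_iter j t) ** R"
    by (simp add: R_inverse matrix_mul_assoc)
  moreover have "\<dots> = g_iter (Suc j) t ** X (z_iter (Suc j) t)"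
    unfolding X_z_iter_Suc by (simp add: matrix_mul_assoc)
  moreover have "g_iter (Suc j) = (\<lambda>t. holonomy ** g_iter j t ** R)" by (simp add: fun_eq_iff)
  ultimately show ?case by simp
qed

text \<open>The holonomy disappears because it commutes with \<open>\<Lambda>0\<close>.\<close>

lemma \<Lambda>_iter_Suc: "\<Lambda>_iter (Suc j) t = matrix_inv R ** \<Lambda>_iter j t ** R"
proof -
  have "adj2 holonomy ** \<Lambda>0 ** holonomy = adj2 holonomy ** holonomy ** \<Lambda>0"
    using holonomy_\<Lambda>0_commute by (simp flip: matrix_mul_assoc)
  also have "\<dots> = \<Lambda>0" using adj2_inverse(2)[OF det_holonomy] by simp
  finally have "adj2 holonomy ** \<Lambda>0 ** holonomy = \<Lambda>0" .
  moreover have "\<Lambda>_iter (Suc j) t =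
      adj2 R ** (adj2 (g_iter j t) ** (adj2 holonomy ** \<Lambda>0 ** holonomy) ** g_iter j t) ** R"
    by (simp add: \<Lambda>_iter_def adj2_mult matrix_mul_assoc)
  ultimately show ?thesis by (simp add: \<Lambda>_iter_def adj2_R)
qed

lemma \<Lambda>_iter_0: "\<Lambda>_iter 0 t = piece_\<Lambda> t"
  by (simp add: \<Lambda>_iter_def piece_\<Lambda>_def)

lemma trace_\<Lambda>_iter: "trace (\<Lambda>_iter j t) = 0"
proof -
  have "trace (\<Lambda>_iter j t) = trace (g_iter j t ** (adj2 (g_iter j t) ** \<Lambda>0))"
    unfolding \<Lambda>_iter_def by (rule trace_mul_sym)
  also have "\<dots> = trace \<Lambda>0"
    using adj2_inverse(1)[OF det_g_iter] by (simp add: matrix_mul_assoc)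
  finally show ?thesis by (simp add: \<Lambda>0_def mat2_simps)
qed

lemma \<Lambda>_iter_has_derivative:
  "(\<Lambda>_iter j has_vector_derivative bracket (\<Lambda>_iter j t) (X (z_iter j t))) (at t within S)"
proof -
  define G where "G = g_iter j t"
  define Y where "Y = X (z_iter j t)"
  have "((\<lambda>t. adj2 (g_iter j t) ** \<Lambda>0 ** g_iter j t) has_vector_derivative
     (adj2 G ** \<Lambda>0) ** (G ** Y) + (adj2 (G ** Y) ** \<Lambda>0) ** G) (at t within S)"
    unfolding G_def Y_def
    by (intro has_vector_derivative_matrix_mult g_iter_has_derivative
         bounded_linear.has_vector_derivative[OF bounded_bilinear.bounded_linear_left[OF bounded_bilinear_matrix_mult]]
         bounded_linear.has_vector_derivative[OF bounded_linear_adj2])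
  moreover have "(adj2 G ** \<Lambda>0) ** (G ** Y) + (adj2 (G ** Y) ** \<Lambda>0) ** G = bracket (\<Lambda>_iter j t) Y"
    unfolding bracket_def \<Lambda>_iter_def adj2_mult
    using trace_X[of "z_iter j t"]
    by (simp add: G_def[symmetric] Y_def[symmetric] adj2_tracefree matrix_mult_minus matrix_mul_assoc)
  ultimately show ?thesis by (simp add: \<Lambda>_iter_def[abs_def] Y_def)
qed

text \<open>The rotation of controls is onto: its inverse is its square.\<close>

lemma field_den_iter_neg:
  assumes t: "t \<in> {0..\<tau>}" and v: "v \<in> control_set"
  shows "field_den v (z_iter j t) < 0"
  using v
proof (induction j arbitrary: v)
  case 0
  then show ?case
    using field_den_neg field_den_e1_neg[OF t] field_den_e2_neg[OF t] field_den_e3_neg by simp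
next
  case (Suc j)
  define w where "w = rotate_control (rotate_control v)"
  have "w \<in> control_set" "v = rotate_control w"
    using Suc.prems by (simp_all add: w_def rotate_control_in_control_set rotate_control_cube)
  then show ?case
    using Suc.IH[of w] automorphy_nonzero[of "z_iter j t"] Im_z_iter_pos[of j t]
    by (simp add: field_den_rotate divide_less_0_iff)
qed

lemma hamiltonian_iter_le:
  assumes t: "t \<in> {0..\<tau>}" and v: "v \<in> control_set"
  shows "hamiltonian (-1) (\<Lambda>_iter j t) (z_iter j t) (\<nu>_iter j t) v \<le> 0"
  using v
proof (induction j arbitrary: v)
  case 0
  then show ?case
    using hamiltonian_le_0[OF field_den_e1_neg[OF t] field_den_e2_neg[OF t] field_den_e3_neg, of v "-1" "piece_\<Lambda> t" "piece_\<nu> t"]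
      hamiltonian_piece_e1[OF t] hamiltonian_piece_e2[OF t] hamiltonian_piece_e3[of t]
    by (simp add: \<Lambda>_iter_0)
next
  case (Suc j)
  define w where "w = rotate_control (rotate_control v)"
  have "w \<in> control_set" "v = rotate_control w"
    using Suc.prems by (simp_all add: w_def rotate_control_in_control_set rotate_control_cube)
  then show ?case
    using Suc.IH[of w] by (simp add: \<Lambda>_iter_Suc hamiltonian_rotate[OF Im_z_iter_pos])
qed

lemma hamiltonian_iter_0: "hamiltonian (-1) (\<Lambda>_iter j t) (z_iter j t) (\<nu>_iter j t) (u_iter j) = 0"
  by (induction j)
     (simp_all add: \<Lambda>_iter_0 hamiltonian_piece_e3 \<Lambda>_iter_Suc hamiltonian_rotate[OF Im_z_iter_pos])

lemma hamiltonian_max_iter: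
  assumes t: "t \<in> {0..\<tau>}"
  shows "hamiltonian_max (-1) (\<Lambda>_iter j t) (z_iter j t) (\<nu>_iter j t) = 0"
  unfolding hamiltonian_max_def
proof (rule cSup_eq_maximum)
  show "0 \<in> hamiltonian (-1) (\<Lambda>_iter j t) (z_iter j t) (\<nu>_iter j t) ` control_set"
    using hamiltonian_iter_0[of j t] u_iter_in_control_set[of j] by (metis image_eqI)
qed (use hamiltonian_iter_le[OF t] in auto)

lemma hamilton_costate_iter:
  assumes t: "t \<in> {0..\<tau>}"
  shows "hamilton_costate (-1) (\<Lambda>_iter j t) (z_iter j t) (\<nu>_iter j t) (u_iter j) (\<nu>'_iter j t)"
proof (induction j)
  case 0
  then show ?case using piece_hamilton_costate by (simp add: \<Lambda>_iter_0)
next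
  case (Suc j)
  have "field_den (u_iter j) (z_iter j t) \<noteq> 0"
    using field_den_iter_neg[OF t u_iter_in_control_set[of j], of j] by simp
  from hamilton_costate_rotate[OF Suc Im_z_iter_pos this]
  show ?case by (simp add: \<Lambda>_iter_Suc)
qed

lemma \<nu>_iter_has_derivative:
  "(\<nu>_iter j has_vector_derivative \<nu>'_iter j t) (at t within S)"
proof (induction j)
  case 0
  have "\<nu>_iter 0 = piece_\<nu>" by (simp add: fun_eq_iff)
  then show ?case using piece_\<nu>_has_derivative by simp
next
  case (Suc j)
  define v where "v = velocity (u_iter j) (z_iter j t)"
  define a where "a = cnj (automorphy (z_iter j t))"
  have "((\<lambda>t. cnj (automorphy (z_iter j t))) has_vector_derivative
      cnj (0 - of_real (sqrt 3) * v)) (at t within S)"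
    unfolding automorphy_def v_def
    by (intro bounded_linear.has_vector_derivative[OF bounded_linear_cnj] has_vector_derivative_diff
        has_vector_derivative_const has_vector_derivative_mult_right z_iter_has_derivative)
  note 1 = has_vector_derivative_mult[OF this this, folded a_def]
  have "(\<nu>_iter j t * (a * cnj (0 - of_real (sqrt 3) * v) + cnj (0 - of_real (sqrt 3) * v) * a)
      + \<nu>'_iter j t * (a * a)) * (1/4) = \<nu>'_iter (Suc j) t"
    by (simp add: a_def v_def power2_eq_square algebra_simps)
  with has_vector_derivative_mult_left[OF has_vector_derivative_mult[OF Suc 1], of "1/4"]
  have "((\<lambda>t. \<nu>_iter j t * (cnj (automorphy (z_iter j t)) * cnj (automorphy (z_iter j t))) * (1/4))
      has_vector_derivative \<nu>'_iter (Suc j) t) (at t within S)"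
    by (simp only: a_def)
  moreover have "\<nu>_iter (Suc j) = (\<lambda>t. \<nu>_iter j t * (cnj (automorphy (z_iter j t)) * cnj (automorphy (z_iter j t))) * (1/4))"
    by (simp add: fun_eq_iff rotate_costate_def power2_eq_square)
  ultimately show ?case by simp
qed

lemma z_iter_match: "z_iter (Suc j) 0 = z_iter j \<tau>"
  by (induction j) (simp_all add: piece_z_end)

lemma g_iter_match: "g_iter (Suc j) 0 = g_iter j \<tau>"
  by (induction j) (simp_all add: piece_g_0 holonomy_mult_R)

lemma \<Lambda>_iter_match: "\<Lambda>_iter (Suc j) 0 = \<Lambda>_iter j \<tau>"
  unfolding \<Lambda>_iter_def g_iter_match ..

lemma \<nu>_iter_match: "\<nu>_iter (Suc j) 0 = \<nu>_iter j \<tau>"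
proof (induction j)
  case 0
  then show ?case by (simp add: piece_\<nu>_end)
next
  case (Suc j)
  have "\<nu>_iter (Suc (Suc j)) 0 = rotate_costate (z_iter (Suc j) 0) (\<nu>_iter (Suc j) 0)"
    by (rule \<nu>_iter.simps)
  then show ?case unfolding Suc z_iter_match by simp
qed

lemma continuous_z_iter: "continuous_on S (z_iter j)"
  and continuous_g_iter: "continuous_on S (g_iter j)"
  and continuous_\<Lambda>_iter: "continuous_on S (\<Lambda>_iter j)"
  and continuous_\<nu>_iter: "continuous_on S (\<nu>_iter j)"
  by (rule continuous_on_vector_derivative; rule z_iter_has_derivative g_iter_has_derivative
        \<Lambda>_iter_has_derivative \<nu>_iter_has_derivative)+

lemma continuous_X_z_iter: "continuous_on S (\<lambda>t. X (z_iter j t))"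
  by (rule continuous_on_X[OF continuous_z_iter]) (rule Im_z_iter_pos)

lemma continuous_velocity_iter:
  assumes "S \<subseteq> {0..\<tau>}"
  shows "continuous_on S (\<lambda>t. velocity (u_iter j) (z_iter j t))"
proof -
  have "field_den (u_iter j) (z_iter j t) \<noteq> 0" if "t \<in> S" for t
    using field_den_iter_neg[OF subsetD[OF assms that] u_iter_in_control_set[of j], of j] by simp
  then show ?thesis
    unfolding velocity_def field_den_def field_num_def
    by (intro continuous_intros continuous_z_iter) auto
qed

lemma continuous_\<nu>'_iter: "continuous_on {0..\<tau>} (\<nu>'_iter j)"
proof (induction j)
  case 0
  have "continuous_on {0..\<tau>} piece_\<Lambda>" using continuous_\<Lambda>_iter[of _ 0] by (simp add: \<Lambda>_iter_0[abs_def])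
  moreover have "continuous_on {0..\<tau>} piece_\<nu>"
    by (rule continuous_on_vector_derivative) (rule piece_\<nu>_has_derivative)
  moreover have "continuous_on {0..\<tau>} (piece_z C)" using continuous_z_iter[of _ 0] by (simp add: z_iter_def[abs_def])
  moreover have "continuous_on {0..\<tau>} energy"
    using C_pos unfolding energy_def[abs_def] by (intro continuous_intros) auto
  moreover have "Im (piece_z C t) \<noteq> 0" for t using Im_piece_z_pos[OF C_pos, of t] by simp
  ultimately have "continuous_on {0..\<tau>} piece_\<nu>'"
    unfolding piece_\<nu>'_def[abs_def] Let_def Complex_eq
    by (intro continuous_on_add continuous_on_mult continuous_on_of_real continuous_on_diff continuous_on_minus
        continuous_on_divide continuous_on_component continuous_on_Re continuous_on_Im continuous_on_const) auto
  then show ?case by (simp add: \<nu>'_iter.simps[abs_def])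
next
  case (Suc j)
  then have "continuous_on {0..\<tau>} (\<lambda>t. \<nu>'_iter j t * (cnj (automorphy (z_iter j t)))\<^sup>2 / 4
     - \<nu>_iter j t * cnj (automorphy (z_iter j t)) * of_real (sqrt 3) * cnj (velocity (u_iter j) (z_iter j t)) / 2)"
    unfolding automorphy_def
    by (intro continuous_intros continuous_z_iter continuous_\<nu>_iter continuous_velocity_iter) auto
  then show ?case by simp
qed

lemma lipschitz_iter:
  "\<exists>L. L-lipschitz_on {0..\<tau>} (\<lambda>t. ((g_iter j t, \<Lambda>_iter j t), (z_iter j t, \<nu>_iter j t)))"
proof -
  have "\<exists>L. L-lipschitz_on {0..\<tau>} (z_iter j)"
    by (rule lipschitz_of_continuous_derivative[OF z_iter_has_derivative]) (rule continuous_velocity_iter, simp)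
  moreover have "\<exists>L. L-lipschitz_on {0..\<tau>} (g_iter j)"
    by (rule lipschitz_of_continuous_derivative[OF g_iter_has_derivative])
       (intro continuous_on_matrix_mult continuous_g_iter continuous_X_z_iter)
  moreover have "\<exists>L. L-lipschitz_on {0..\<tau>} (\<Lambda>_iter j)"
    by (rule lipschitz_of_continuous_derivative[OF \<Lambda>_iter_has_derivative])
       (unfold bracket_def, intro continuous_intros continuous_on_matrix_mult continuous_\<Lambda>_iter continuous_X_z_iter)
  moreover have "\<exists>L. L-lipschitz_on {0..\<tau>} (\<nu>_iter j)"
    by (rule lipschitz_of_continuous_derivative[OF \<nu>_iter_has_derivative]) (rule continuous_\<nu>'_iter)
  ultimately obtain Lz Lg L\<Lambda> L\<nu> where
    "Lz-lipschitz_on {0..\<tau>} (z_iter j)" "Lg-lipschitz_on {0..\<tau>} (g_iter j)"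
    "L\<Lambda>-lipschitz_on {0..\<tau>} (\<Lambda>_iter j)" "L\<nu>-lipschitz_on {0..\<tau>} (\<nu>_iter j)" by blast
  from lipschitz_on_Pair[OF lipschitz_on_Pair[OF this(2,3)] lipschitz_on_Pair[OF this(1,4)]]
  show ?thesis by blast
qed

end

section \<open>The homotopy class\<close>

lemma trace_adj2_mult: "trace (adj2 B ** A) = B$2$2 * A$1$1 - B$1$2 * A$2$1 - B$2$1 * A$1$2 + B$1$1 * A$2$2"
  by (rule mat2_cases[of A], rule mat2_cases[of B]) (simp add: adj2_def mat2_simps algebra_simps)

lemma det_convex_combination:
  "det ((1 - \<sigma>) *\<^sub>R A + \<sigma> *\<^sub>R B) =
     (1 - \<sigma>)\<^sup>2 * det A + \<sigma> * (1 - \<sigma>) * trace (adj2 B ** A) + \<sigma>\<^sup>2 * det B"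
  by (rule mat2_cases[of A], rule mat2_cases[of B])
     (simp add: adj2_def mat2_simps algebra_simps power2_eq_square)

lemma continuous_on_det2 [continuous_intros]:
  fixes f :: "'a::topological_space \<Rightarrow> real^2^2"
  assumes "continuous_on S f"
  shows "continuous_on S (\<lambda>x. det (f x))"
  unfolding det_2 by (intro continuous_intros assms)

text \<open>On the segment from \<open>p x\<close> to \<open>q x\<close> the determinant is
  \<open>(1 - 2 \<sigma>)\<^sup>2 + \<sigma> (1 - \<sigma>) (trace (q\<^sup>-\<^sup>1 p) + 2)\<close>. It is positive, and division by its square root leads
  back to \<open>SL\<^sub>2\<close>.\<close>

lemma homotopic_paths_SL2:
  assumes p: "path p" "path_image p \<subseteq> SL2" and q: "path q" "path_image q \<subseteq> SL2"
    and ends: "pathstart q = pathstart p" "pathfinish q = pathfinish p"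
    and tr: "\<And>x. x \<in> {0..1} \<Longrightarrow> trace (adj2 (q x) ** p x) > - 2"
  shows "homotopic_paths SL2 p q"
proof -
  define M where "M = (\<lambda>z. (1 - fst z) *\<^sub>R p (snd z) + fst z *\<^sub>R q (snd z))"
  define K where "K = (\<lambda>z. (1 / sqrt (det (M z))) *\<^sub>R M z)"
  have det1: "det (p x) = 1" "det (q x) = 1" if "x \<in> {0..1}" for x
    using p(2) q(2) that unfolding path_image_def SL2_def by blast+
  have pos: "det (M z) > 0" if z: "z \<in> {0..1} \<times> {0..1}" for z
  proof -
    define \<sigma> where "\<sigma> = fst z"
    define T where "T = trace (adj2 (q (snd z)) ** p (snd z))"
    have \<sigma>: "0 \<le> \<sigma>" "\<sigma> \<le> 1" and x: "snd z \<in> {0..1}" using z by (auto simp: \<sigma>_def)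
    have T: "T + 2 > 0" using tr[OF x] by (simp add: T_def)
    have "det (M z) = (1 - \<sigma>)\<^sup>2 + \<sigma> * (1 - \<sigma>) * T + \<sigma>\<^sup>2"
      unfolding M_def det_convex_combination T_def using det1[OF x] by (simp add: \<sigma>_def)
    also have "\<dots> = (1 - 2 * \<sigma>)\<^sup>2 + \<sigma> * (1 - \<sigma>) * (T + 2)"
      by (simp add: power2_eq_square algebra_simps)
    finally have eq: "det (M z) = (1 - 2 * \<sigma>)\<^sup>2 + \<sigma> * (1 - \<sigma>) * (T + 2)" .
    show ?thesis
    proof (cases "\<sigma> = 0 \<or> \<sigma> = 1")
      case True
      then show ?thesis using eq by auto
    next
      case False
      then have "\<sigma> * (1 - \<sigma>) * (T + 2) > 0" using \<sigma> T by simp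
      then show ?thesis using eq by (smt (verit) zero_le_power2)
    qed
  qed
  have cM: "continuous_on ({0..1} \<times> {0..1}) M"
  proof -
    have "continuous_on ({0..1::real} \<times> {0..1}) (\<lambda>z. p (snd z))" "continuous_on ({0..1::real} \<times> {0..1}) (\<lambda>z. q (snd z))"
      using p(1) q(1) unfolding path_def
      by (auto intro!: continuous_on_compose2[OF _ continuous_on_snd[OF continuous_on_id]])
    then show ?thesis unfolding M_def by (intro continuous_intros)
  qed
  have "continuous_on ({0..1} \<times> {0..1}) K"
    unfolding K_def using pos by (intro continuous_intros cM) (auto simp: less_le)
  moreover have "K \<in> {0..1} \<times> {0..1} \<rightarrow> SL2"
  proof
    fix z :: "real \<times> real" assume z: "z \<in> {0..1} \<times> {0..1}"
    have "det (c *\<^sub>R A) = c\<^sup>2 * det A" for c and A :: "real^2^2"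
      by (rule mat2_cases[of A]) (simp add: mat2_simps power2_eq_square algebra_simps)
    then show "K z \<in> SL2" using pos[OF z] by (simp add: K_def SL2_def power_divide)
  qed
  moreover have "K (0, x) = p x" "K (1, x) = q x" if "x \<in> {0..1}" for x
    using det1[OF that] by (simp_all add: K_def M_def)
  moreover have "pathstart (K \<circ> Pair \<sigma>) = pathstart p" "pathfinish (K \<circ> Pair \<sigma>) = pathfinish p" for \<sigma>
    using ends det1[of 0] det1[of 1] unfolding pathstart_def pathfinish_def
    by (simp_all add: K_def M_def flip: scaleR_add_left)
  ultimately show ?thesis unfolding homotopic_paths by (intro exI[of _ K]) auto
qed

lemma theta_third: "k \<ge> 1 \<Longrightarrow> 0 < theta k \<and> theta k < pi / 3"
  by (simp add: theta_def field_simps)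

locale smoothed_polygon_curve = polygon_piece +
  fixes k :: nat
  assumes k: "k \<ge> 1" and E_theta: "E = 2 * cos (theta k)"
begin

definition pieces :: nat where "pieces = 3 * k + 1"

abbreviation tf :: real where "tf \<equiv> real pieces * \<tau>"

abbreviation \<theta> :: real where "\<theta> \<equiv> theta k"

lemma pieces_pos: "pieces > 0" by (simp add: pieces_def)

lemma pieces_theta: "real pieces * \<theta> = real k * pi"
  by (simp add: theta_def pieces_def field_simps)

lemma theta_bounds: "0 < \<theta>" "\<theta> < pi / 3"
  using theta_third[OF k] by simp_all

lemma sin_theta_pos: "sin \<theta> > 0"
  using theta_bounds by (intro sin_gt_zero) auto

text \<open>The holonomy preserves an ellipse with this ratio of its axes.\<close>

definition ratio :: real where "ratio = E * C\<^sup>2 / (2 * sqrt 3 * sin \<theta>)"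

lemma ratio_pos: "ratio > 0"
  using E_bounds C_pos sin_theta_pos by (simp add: ratio_def)

text \<open>The one-parameter group of rotations of an ellipse with axis ratio \<open>\<mu>\<close>, clockwise for positive
  \<open>\<phi>\<close>.\<close>

definition elliptic :: "real \<Rightarrow> real \<Rightarrow> real^2^2" where
  "elliptic \<mu> \<phi> = mat2 (cos \<phi>) (\<mu> * sin \<phi>) (- sin \<phi> / \<mu>) (cos \<phi>)"

lemma elliptic_add: "\<mu> > 0 \<Longrightarrow> elliptic \<mu> (\<phi> + \<psi>) = elliptic \<mu> \<phi> ** elliptic \<mu> \<psi>"
  by (simp add: elliptic_def mat2_simps cos_add sin_add field_simps)

lemma det_elliptic: "\<mu> > 0 \<Longrightarrow> det (elliptic \<mu> \<phi>) = 1"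
  using sin_cos_squared_add[of \<phi>] by (simp add: elliptic_def mat2_simps power2_eq_square)

lemma det_rot: "det (rot \<phi>) = 1"
  using sin_cos_squared_add[of \<phi>] by (simp add: rot_def mat2_simps power2_eq_square)

lemma holonomy_elliptic: "holonomy = elliptic ratio \<theta>"
proof -
  have 1: "E / 2 = cos \<theta>" by (simp add: E_theta)
  have 2: "E * C\<^sup>2 / (2 * sqrt 3) = ratio * sin \<theta>" using sin_theta_pos by (simp add: ratio_def)
  have "cos \<theta> * cos \<theta> + 3 * \<rho> * (ratio * sin \<theta>) * (ratio * sin \<theta>) = 1"
    using det_holonomy unfolding holonomy_eq 1 2 by (simp add: mat2_simps mult_ac)
  then have "(3 * \<rho> * (ratio * sin \<theta>)) * (ratio * sin \<theta>) = sin \<theta> * sin \<theta>"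
    using sin_cos_squared_add[of \<theta>] unfolding power2_eq_square by linarith
  then have "3 * \<rho> * (ratio * sin \<theta>) = sin \<theta> / ratio"
    using sin_theta_pos ratio_pos by (simp add: field_simps)
  then show ?thesis unfolding holonomy_eq 1 2 elliptic_def by simp
qed

lemma g_iter_eq: "g_iter j t = elliptic ratio (real j * \<theta>) ** piece_g C t ** rot (real j * (pi / 3))"
proof (induction j)
  case 0
  then show ?case by (simp add: elliptic_def rot_def flip: mat2_mat)
next
  case (Suc j)
  have "g_iter (Suc j) t = (elliptic ratio \<theta> ** elliptic ratio (real j * \<theta>)) ** piece_g C t **
      (rot (real j * (pi / 3)) ** rot (pi / 3))"
    unfolding g_iter.simps Suc holonomy_elliptic by (simp add: R_eq_rot matrix_mul_assoc)
  also have "elliptic ratio \<theta> ** elliptic ratio (real j * \<theta>) = elliptic ratio (real (Suc j) * \<theta>)"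
    unfolding elliptic_add[OF ratio_pos, symmetric] by (simp add: algebra_simps)
  also have "rot (real j * (pi / 3)) ** rot (pi / 3) = rot (real (Suc j) * (pi / 3))"
    unfolding rot_add[symmetric] by (simp add: algebra_simps add_divide_distrib)
  finally show ?case .
qed

lemma sin_cos_pieces_theta: "sin (real pieces * \<theta>) = 0" "cos (real pieces * \<theta>) = (- 1) ^ k"
  unfolding pieces_theta by simp_all

lemma rot_pieces: "rot (real pieces * (pi / 3)) = (- 1) ^ k *\<^sub>R R"
proof -
  have "real pieces * (pi / 3) = pi / 3 + real k * pi" by (simp add: pieces_def field_simps)
  then show ?thesis unfolding R_eq_rot rot_def by (simp only: cos_add sin_add) (simp add: mat2_simps)
qed

lemma g_iter_pieces: "g_iter pieces 0 = R"
proof -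
  have "elliptic ratio (real pieces * \<theta>) = (- 1) ^ k *\<^sub>R mat 1"
    by (simp add: elliptic_def sin_cos_pieces_theta mat2_simps)
  moreover have "((- 1) ^ k * (- 1) ^ k :: real) = 1" by (simp flip: power_mult_distrib)
  ultimately show ?thesis
    unfolding g_iter_eq piece_g_0 rot_pieces unfolding R_eq by (simp add: mat2_simps)
qed

text \<open>Compares the first piece with the product of the one-parameter groups through the holonomy and
  through \<open>R\<close>. In the expansion of the trace only two terms can be negative, and they are at least
  \<open>- 1 / 2\<close> and \<open>- 1\<close>.\<close>

lemma trace_piece_bound:
  assumes t: "t \<in> {0..\<tau>}"
  defines "\<phi> \<equiv> t / \<tau> * \<theta>" and "\<psi> \<equiv> t / \<tau> * (pi / 3)"
  shows "trace (adj2 (elliptic ratio \<phi> ** rot \<psi>) ** piece_g C t) > - 2"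
proof -
  have s: "0 \<le> t / \<tau>" "t / \<tau> \<le> 1" using t \<tau>_pos by auto
  have \<phi>: "0 \<le> \<phi>" "\<phi> \<le> \<theta>" and \<psi>: "0 \<le> \<psi>" "\<psi> \<le> pi / 3"
    using s(1) theta_bounds mult_right_mono[OF s(2), of \<theta>] mult_right_mono[OF s(2), of "pi / 3"]
      mult_nonneg_nonneg[OF s(1), of \<theta>] mult_nonneg_nonneg[OF s(1), of "pi / 3"]
    unfolding \<phi>_def \<psi>_def by simp_all
  have nonneg: "sin \<phi> \<ge> 0" "cos \<phi> \<ge> 0" "sin \<psi> \<ge> 0" "cos \<psi> \<ge> 0"
    using \<phi> \<psi> theta_bounds by (auto intro!: sin_ge_zero cos_ge_zero)
  have sin_le: "sin \<phi> \<le> sin \<theta>" using \<phi> theta_bounds by (subst sin_mono_le_eq) auto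
  define e where "e = exp (C * t)"
  have e: "1 \<le> e" "e \<le> E" "exp (- (C * t)) = 1 / e"
    using exp_bounds[OF t] by (simp_all add: e_def exp_minus inverse_eq_divide)
  have EC: "E * C\<^sup>2 = 4 - E" using C_sq E_bounds by (simp add: field_simps)
  define p where "p = (e - 1) / sqrt 3"
  define r where "r = (1 - 1 / e) * sqrt 3 / C\<^sup>2"
  define d where "d = 1 - (e - 2 + 1 / e) / C\<^sup>2"
  have p0: "p \<ge> 0" and r0: "r \<ge> 0" using e C_pos by (simp_all add: p_def r_def)
  have d0: "d \<ge> 0"
  proof -
    have "e - 2 + 1 / e = (e - 1)\<^sup>2 / e" using e by (simp add: field_simps power2_eq_square)
    also have "\<dots> \<le> (e - 1)\<^sup>2 / 1" using e by (intro divide_left_mono) auto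
    also have "\<dots> \<le> 1" using e E_bounds by (simp add: power_le_one)
    finally have "e - 2 + 1 / e \<le> C\<^sup>2" using C_gt by linarith
    then show ?thesis using C_pos by (simp add: d_def)
  qed
  have A: "piece_g C t = mat2 1 (- p) r d"
    by (simp add: piece_g_def e(3) p_def r_def d_def minus_divide_left flip: e_def)
  have mr: "ratio * r * sin \<phi> \<le> 1 / 2"
  proof -
    have "ratio * r = E * (1 - 1 / e) / (2 * sin \<theta>)"
      using C_pos sin_theta_pos by (simp add: ratio_def r_def field_simps)
    then have "ratio * r * sin \<phi> = E * (1 - 1 / e) / 2 * (sin \<phi> / sin \<theta>)" by simp
    also have "\<dots> \<le> E * (1 - 1 / E) / 2 * 1"
      using e E_bounds sin_le nonneg sin_theta_pos
      by (intro mult_mono divide_right_mono mult_left_mono diff_left_mono divide_left_mono) auto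
    also have "\<dots> \<le> 1 / 2" using E_bounds by (simp add: field_simps)
    finally show ?thesis .
  qed
  have pm: "p / ratio * sin \<phi> \<le> 1"
  proof -
    have "p / ratio = 2 * (e - 1) * sin \<theta> / (4 - E)"
      using C_pos sin_theta_pos E_bounds by (simp add: ratio_def p_def field_simps flip: EC)
    then have "p / ratio * sin \<phi> = 2 * (e - 1) / (4 - E) * (sin \<theta> * sin \<phi>)" by simp
    also have "\<dots> \<le> 1 * (1 * 1)"
      using e E_bounds nonneg sin_theta_pos sin_le_one
      by (intro mult_mono) (auto simp: field_simps)
    finally show ?thesis by simp
  qed
  have "trace (adj2 (elliptic ratio \<phi> ** rot \<psi>) ** piece_g C t) =
     (sin \<phi> * sin \<psi> / ratio + cos \<phi> * cos \<psi>) + cos \<phi> * sin \<psi> * r + cos \<phi> * sin \<psi> * p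
       + (cos \<phi> * cos \<psi> + ratio * sin \<phi> * sin \<psi>) * d - ratio * r * sin \<phi> * cos \<psi> - p / ratio * sin \<phi> * cos \<psi>"
    unfolding trace_adj2_mult A elliptic_def rot_def mat2_mult mat2_nth
    by (simp add: algebra_simps)
  moreover have "(sin \<phi> * sin \<psi> / ratio + cos \<phi> * cos \<psi>) \<ge> 0" "cos \<phi> * sin \<psi> * r \<ge> 0" "cos \<phi> * sin \<psi> * p \<ge> 0"
     "(cos \<phi> * cos \<psi> + ratio * sin \<phi> * sin \<psi>) * d \<ge> 0"
    using nonneg ratio_pos p0 r0 d0 by simp_all
  moreover have "ratio * r * sin \<phi> * cos \<psi> \<le> 1/2 * 1" "p / ratio * sin \<phi> * cos \<psi> \<le> 1 * 1"
    using mr pm nonneg by (intro mult_mono; simp)+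
  ultimately show ?thesis by linarith
qed

definition curve_g :: "real \<Rightarrow> real^2^2" where "curve_g = glue \<tau> g_iter"

lemma curve_g_eq:
  "\<lbrakk>real j * \<tau> \<le> t; t \<le> real (Suc j) * \<tau>\<rbrakk> \<Longrightarrow> curve_g t = g_iter j (t - real j * \<tau>)"
  unfolding curve_g_def by (rule glue_eq[of \<tau> g_iter, OF \<tau>_pos g_iter_match])

lemma curve_g_0: "curve_g 0 = mat 1"
  using curve_g_eq[of 0 0] \<tau>_pos by (simp add: piece_g_0)

lemma curve_g_end: "curve_g tf = R"
  using curve_g_eq[of pieces tf] \<tau>_pos by (simp add: g_iter_pieces)

lemma lipschitz_g_iter: "\<exists>L. L-lipschitz_on {0..\<tau>} (g_iter j)"
  by (rule lipschitz_of_continuous_derivative[OF g_iter_has_derivative])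
     (intro continuous_on_matrix_mult continuous_g_iter continuous_X_z_iter)

lemma continuous_curve_g: "continuous_on {0..tf} curve_g"
  using glue_lipschitz[of \<tau> g_iter pieces, OF \<tau>_pos g_iter_match lipschitz_g_iter]
  unfolding curve_g_def by (auto intro: lipschitz_on_continuous_on)

lemma det_curve_g: "det (curve_g t) = 1"
  unfolding curve_g_def glue_def by (rule det_g_iter)

text \<open>The curve is first deformed to \<open>elliptic ratio \<phi> ** rot \<psi>\<close> with linear \<open>\<phi>\<close> and \<open>\<psi>\<close>. Then the
  ellipse is deformed to a circle; the end points stay fixed since at the final time the elliptic factor
  is \<open>1\<close> or \<open>- 1\<close> for every ratio. For ratio \<open>1\<close> the product is a rotation with the net angle
  \<open>pi / 3\<close>.\<close>

lemma homotopic_curve_g: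
  "homotopic_paths SL2 (curve_g \<circ> (\<lambda>s. tf * s)) ((\<lambda>t. mexp ((pi * t / (3 * tf)) *\<^sub>R J)) \<circ> (\<lambda>s. tf * s))"
proof -
  define P where "P = (\<lambda>\<mu> x. elliptic \<mu> (real pieces * x * \<theta>) ** rot (real pieces * x * (pi / 3)))"
  have P0: "P \<mu> 0 = mat 1" for \<mu> by (simp add: P_def elliptic_def rot_def mat2_simps)
  have P1: "P \<mu> 1 = R" for \<mu>
  proof -
    have "elliptic \<mu> (real pieces * 1 * \<theta>) = (- 1) ^ k *\<^sub>R mat 1"
      by (simp add: elliptic_def sin_cos_pieces_theta mat2_simps)
    moreover have "((- 1) ^ k * (- 1) ^ k :: real) = 1" by (simp flip: power_mult_distrib)
    ultimately show ?thesis unfolding P_def using rot_pieces unfolding R_eq by (simp add: mat2_simps)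
  qed
  have detP: "det (P \<mu> x) = 1" if "\<mu> > 0" for \<mu> x
    using that by (simp add: P_def det_mul det_elliptic det_rot)
  have "homotopic_paths SL2 (curve_g \<circ> (\<lambda>s. tf * s)) (P ratio)"
  proof (rule homotopic_paths_SL2)
    have "(\<lambda>s. tf * s) ` {0..1} \<subseteq> {0..tf}"
      using \<tau>_pos by (auto intro!: mult_left_le)
    then show "path (curve_g \<circ> (\<lambda>s. tf * s))"
      unfolding path_def
      by (intro continuous_on_compose continuous_intros continuous_on_subset[OF continuous_curve_g])
    show "path (P ratio)" unfolding path_def P_def elliptic_def rot_def
      using ratio_pos by (intro continuous_intros continuous_on_matrix_mult) auto
    show "trace (adj2 (P ratio x) ** (curve_g \<circ> (\<lambda>s. tf * s)) x) > - 2" if x: "x \<in> {0..1}" for x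
    proof -
      have "tf * x \<in> {0..real pieces * \<tau>}" using x \<tau>_pos by (auto intro!: mult_left_le)
      then obtain j where j: "j < pieces" "real j * \<tau> \<le> tf * x" "tf * x \<le> real (Suc j) * \<tau>"
        using piece_cases[OF \<tau>_pos _ pieces_pos] by metis
      define t where "t = tf * x - real j * \<tau>"
      have t: "t \<in> {0..\<tau>}" using j by (auto simp: t_def algebra_simps)
      have nx: "real pieces * x = real j + t / \<tau>" using \<tau>_pos by (simp add: t_def field_simps)
      define Q where "Q = elliptic ratio (t / \<tau> * \<theta>) ** rot (t / \<tau> * (pi / 3))"
      define a where "a = elliptic ratio (real j * \<theta>)"
      define b where "b = rot (real j * (pi / 3))"
      have "P ratio x = a ** Q ** b"
      proof -
        have "rot (real pieces * x * (pi / 3)) = rot (t / \<tau> * (pi / 3)) ** b"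
          unfolding nx b_def rot_add[symmetric] by (simp add: algebra_simps)
        moreover have "elliptic ratio (real pieces * x * \<theta>) = a ** elliptic ratio (t / \<tau> * \<theta>)"
          unfolding nx a_def elliptic_add[OF ratio_pos, symmetric] by (simp add: algebra_simps)
        ultimately show ?thesis by (simp add: P_def Q_def matrix_mul_assoc)
      qed
      moreover have "(curve_g \<circ> (\<lambda>s. tf * s)) x = a ** piece_g C t ** b"
        using curve_g_eq[OF j(2,3)] by (simp add: g_iter_eq t_def a_def b_def)
      moreover have "adj2 a ** a = mat 1" "b ** adj2 b = mat 1"
        using adj2_inverse det_elliptic[OF ratio_pos] det_rot by (simp_all add: a_def b_def)
      moreover have "adj2 (a ** Q ** b) ** (a ** piece_g C t ** b) =
          adj2 b ** (adj2 Q ** (adj2 a ** a) ** piece_g C t ** b)"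
        by (simp add: adj2_mult matrix_mul_assoc)
      ultimately have "trace (adj2 (P ratio x) ** (curve_g \<circ> (\<lambda>s. tf * s)) x) =
          trace (adj2 b ** (adj2 Q ** piece_g C t ** b))" by simp
      also have "\<dots> = trace ((adj2 Q ** piece_g C t ** b) ** adj2 b)" by (rule trace_mul_sym)
      also have "(adj2 Q ** piece_g C t ** b) ** adj2 b = adj2 Q ** piece_g C t"
        using \<open>b ** adj2 b = mat 1\<close> by (simp flip: matrix_mul_assoc)
      finally show ?thesis using trace_piece_bound[OF t] by (simp add: Q_def)
    qed
  qed (auto simp: path_image_def SL2_def det_curve_g detP[OF ratio_pos] pathstart_def pathfinish_def
        P0 P1 curve_g_0 curve_g_end)
  moreover have "homotopic_paths SL2 (P ratio) (P 1)"
  proof -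
    define K where "K = (\<lambda>z. P ((1 - fst z) * ratio + fst z) (snd z))"
    have pos: "(1 - fst z) * ratio + fst z > 0" if "z \<in> {0..1} \<times> {0..1}" for z :: "real \<times> real"
      using that ratio_pos by (cases "fst z = 1") (auto intro!: add_pos_nonneg)
    have "continuous_on ({0..1} \<times> {0..1}) K"
      unfolding K_def P_def elliptic_def rot_def
      using pos by (intro continuous_intros continuous_on_matrix_mult) (auto simp: less_le)
    moreover have "K \<in> {0..1} \<times> {0..1} \<rightarrow> SL2" using pos by (auto simp: K_def SL2_def intro!: detP)
    ultimately show ?thesis
      unfolding homotopic_paths
      by (intro exI[of _ K]) (auto simp: K_def pathstart_def pathfinish_def P0 P1)
  qed
  moreover have "P 1 = (\<lambda>t. mexp ((pi * t / (3 * tf)) *\<^sub>R J)) \<circ> (\<lambda>s. tf * s)"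
  proof
    fix x
    have "elliptic 1 \<phi> = rot (- \<phi>)" for \<phi> by (simp add: elliptic_def rot_def)
    then have "P 1 x = rot (- (real pieces * x * \<theta>) + real pieces * x * (pi / 3))"
      unfolding P_def rot_add by simp
    also have "- (real pieces * x * \<theta>) + real pieces * x * (pi / 3) = x * (real pieces * (pi / 3) - real pieces * \<theta>)"
      by (simp add: algebra_simps)
    also have "real pieces * (pi / 3) - real pieces * \<theta> = pi / 3" unfolding pieces_theta by (simp add: pieces_def field_simps)
    finally show "P 1 x = ((\<lambda>t. mexp ((pi * t / (3 * tf)) *\<^sub>R J)) \<circ> (\<lambda>s. tf * s)) x"
      using pieces_pos \<tau>_pos by (simp add: mexp_J mult.commute)
  qed
  ultimately show ?thesis using homotopic_paths_trans by metis
qed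

end

section \<open>Trajectories and the polygon\<close>

lemma AE_lebesgue_on_everywhere:
  fixes a b :: real
  assumes "\<And>t. t \<in> {a..b} \<Longrightarrow> P t"
  shows "AE t in lebesgue_on {a..b}. P t"
  using assms by (intro AE_I2) simp

lemma trajectory_velocity: "trajectory T u g z \<longleftrightarrow> T > 0 \<and>
     u \<in> borel_measurable (lebesgue_on {0..T}) \<and> u ` {0..T} \<subseteq> control_set \<and>
     g ` {0..T} \<subseteq> SL2 \<and> z ` {0..T} \<subseteq> upper_half_plane \<and>
     abs_continuous_on 0 T (\<lambda>t. (g t, z t)) \<and>
     (AE t in lebesgue_on {0..T}. (z has_vector_derivative velocity (u t) (z t)) (at t within {0..T}) \<and>
        (g has_vector_derivative (g t ** X (z t))) (at t within {0..T}))"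
  unfolding trajectory_def Complex_f1_f2 ..

lemma abs_continuous_on_fst: "abs_continuous_on a b (\<lambda>t. (f t, g t)) \<Longrightarrow> abs_continuous_on a b f"
  and abs_continuous_on_snd: "abs_continuous_on a b (\<lambda>t. (f t, g t)) \<Longrightarrow> abs_continuous_on a b g"
  using dist_fst_le[of "(f _, g _)" "(f _, g _)"] dist_snd_le[of "(f _, g _)" "(f _, g _)"]
  by (auto elim!: abs_continuous_on_Lipschitz_bound[where L = 1])

lemma trajectoryD:
  assumes tr: "trajectory T u g z"
  shows "abs_continuous_on 0 T g" "abs_continuous_on 0 T z"
    and "t \<in> {0..T} \<Longrightarrow> Im (z t) > 0" "t \<in> {0..T} \<Longrightarrow> det (g t) = 1"
    and "AE t in lebesgue_on {0..T}. (z has_vector_derivative velocity (u t) (z t)) (at t within {0..T})"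
    and "AE t in lebesgue_on {0..T}. (g has_vector_derivative g t ** X (z t)) (at t within {0..T})"
proof -
  note T = tr[unfolded trajectory_velocity]
  then have ac: "abs_continuous_on 0 T (\<lambda>t. (g t, z t))" by blast
  show "abs_continuous_on 0 T g" by (rule abs_continuous_on_fst[OF ac])
  show "abs_continuous_on 0 T z" by (rule abs_continuous_on_snd[OF ac])
  show "Im (z t) > 0" if "t \<in> {0..T}" using T that unfolding upper_half_plane_def by blast
  show "det (g t) = 1" if "t \<in> {0..T}" using T that unfolding SL2_def by blast
  have ae: "AE t in lebesgue_on {0..T}. (z has_vector_derivative velocity (u t) (z t)) (at t within {0..T}) \<and>
        (g has_vector_derivative (g t ** X (z t))) (at t within {0..T})" using T by blast
  show "AE t in lebesgue_on {0..T}. (z has_vector_derivative velocity (u t) (z t)) (at t within {0..T})"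
    using ae by (rule eventually_mono) blast
  show "AE t in lebesgue_on {0..T}. (g has_vector_derivative g t ** X (z t)) (at t within {0..T})"
    using ae by (rule eventually_mono) blast
qed

lemma trajectory_flow:
  assumes tr: "trajectory T u g z" and "c \<ge> 0" "c + l \<le> T"
    and u: "\<And>r. \<lbrakk>0 \<le> r; r < l\<rbrakk> \<Longrightarrow> u (c + r) = v"
  shows "flow l v (\<lambda>r. z (c + r))"
proof -
  note ac = trajectoryD(2)[OF tr] and im = trajectoryD(3)[OF tr] and ae = trajectoryD(5)[OF tr]
  have "negligible ((+) (- c) ` {t \<in> {0..T}. \<not> (z has_vector_derivative velocity (u t) (z t)) (at t within {0..T})} \<union> {l})"
    by (intro negligible_Un negligible_translation negligible_sing ae[unfolded AE_lebesgue_on_iff_negligible])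
  then have "negligible {r \<in> {0..l}. \<not> ((\<lambda>r. z (c + r)) has_vector_derivative velocity v (z (c + r))) (at r within {0..l})}"
  proof (rule negligible_subset, intro subsetI UnCI)
    fix r assume 1: "r \<in> {r \<in> {0..l}. \<not> ((\<lambda>r. z (c + r)) has_vector_derivative velocity v (z (c + r))) (at r within {0..l})}"
      and "r \<notin> {l}"
    then have r: "0 \<le> r" "r < l" by auto
    have "\<not> (z has_vector_derivative velocity (u (c + r)) (z (c + r))) (at (c + r) within {0..T})"
    proof
      assume "(z has_vector_derivative velocity (u (c + r)) (z (c + r))) (at (c + r) within {0..T})"
      then have "(z has_vector_derivative velocity v (z (c + r))) (at (c + r) within (+) c ` {0..l})"
        unfolding u[OF r] by (rule has_vector_derivative_within_subset) (use assms in auto)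
      moreover have "((+) c has_vector_derivative 1) (at r within {0..l})"
        by (auto intro!: derivative_eq_intros)
      ultimately have "((z \<circ> (+) c) has_vector_derivative 1 *\<^sub>R velocity v (z (c + r))) (at r within {0..l})"
        by (intro vector_diff_chain_within)
      with 1 show False by (simp add: o_def)
    qed
    moreover have "c + r \<in> {0..T}" using r assms by auto
    ultimately have "(- c) + (c + r) \<in> (+) (- c) ` {t \<in> {0..T}. \<not> (z has_vector_derivative velocity (u t) (z t)) (at t within {0..T})}"
      by (intro imageI) simp
    then show "r \<in> (+) (- c) ` {t \<in> {0..T}. \<not> (z has_vector_derivative velocity (u t) (z t)) (at t within {0..T})}"
      by simp
  qed
  moreover have "abs_continuous_on 0 l (\<lambda>r. z (c + r))"
    by (rule abs_continuous_on_subset_shift[OF ac]) (use assms in auto)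
  ultimately show ?thesis
    using im assms by (auto simp: flow_def AE_lebesgue_on_iff_negligible)
qed

lemma flow_rotate_iterate: "flow T u z \<Longrightarrow> flow T ((rotate_control ^^ i) u) (\<lambda>t. (rotate_z ^^ i) (z t))"
  by (induction i) (auto dest: flow_rotate)

lemma rotate_z_funpow_triple: "Im z > 0 \<Longrightarrow> (rotate_z ^^ (3 * i)) z = z"
proof (induction i)
  case (Suc i)
  have "3 * Suc i = Suc (Suc (Suc (3 * i)))" by simp
  then have "(rotate_z ^^ (3 * Suc i)) z = rotate_z (rotate_z (rotate_z ((rotate_z ^^ (3 * i)) z)))"
    by (simp only: funpow.simps o_apply)
  with Suc show ?case by (simp add: rotate_z_cube)
qed simp

text \<open>Once \<open>z\<close> is known, \<open>g\<close> solves a linear equation with continuous coefficients.\<close>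

lemma trajectory_g_unique:
  assumes tr: "trajectory T u g z" and tr': "trajectory T u g' z'"
    and z: "\<And>t. t \<in> {0..T} \<Longrightarrow> z t = z' t" and init: "g 0 = g' 0" and t: "t \<in> {0..T}"
  shows "g t = g' t"
proof -
  have d: "(g has_vector_derivative g t ** X (z t)) (at t within {0..T})"
    if tr: "trajectory T u g z" and t: "t \<in> {0..T}" for g z t
  proof -
    note ac = trajectoryD(1,2)[OF tr] and im = trajectoryD(3)[OF tr] and ae = trajectoryD(6)[OF tr]
    have "continuous_on {0..T} (\<lambda>t. g t ** X (z t))"
      using ac[THEN abs_continuous_on_imp_continuous_on]
      by (intro continuous_on_matrix_mult continuous_on_X im)
    from has_vector_derivative_AE_continuous[OF ac(1) this ae t] show ?thesis .
  qed
  show ?thesis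
  proof (rule matrix_ode_unique[where \<Xi> = "\<lambda>t. X (z t)" and T = T])
    show "(g' has_vector_derivative g' t ** X (z t)) (at t within {0..T})" if "t \<in> {0..T}" for t
      using d[OF tr' that] by (simp add: z[OF that])
    show "det (g' t) = 1" if "t \<in> {0..T}" for t
      by (rule trajectoryD(4)[OF tr' that])
  qed (use d[OF tr] init t trace_X in auto)
qed

lemma piece_trajectory:
  assumes C: "C > 0" and T: "T > 0"
  shows "trajectory T (\<lambda>_. e3) (piece_g C) (piece_z C)"
proof -
  have cz: "continuous_on {0..T} (piece_z C)"
    by (rule continuous_on_vector_derivative) (rule piece_z_has_derivative)
  have cg: "continuous_on {0..T} (piece_g C)"
    by (rule continuous_on_vector_derivative) (rule piece_g_has_derivative[OF C])
  have "\<exists>L. L-lipschitz_on {0..T} (piece_z C)"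
    by (rule lipschitz_of_continuous_derivative[OF piece_z_has_derivative])
       (unfold velocity_piece_z Complex_eq, intro continuous_intros, auto)
  moreover have "\<exists>L. L-lipschitz_on {0..T} (piece_g C)"
    by (rule lipschitz_of_continuous_derivative[OF piece_g_has_derivative[OF C]])
       (intro continuous_on_matrix_mult cg continuous_on_X[OF cz] Im_piece_z_pos C)
  ultimately obtain L where "L-lipschitz_on {0..T} (\<lambda>t. (piece_g C t, piece_z C t))"
    using lipschitz_on_Pair by blast
  then have "abs_continuous_on 0 T (\<lambda>t. (piece_g C t, piece_z C t))"
    by (rule abs_continuous_on_Lipschitz)
  then show ?thesis
    unfolding trajectory_velocity
    using T vertices_in_control_set(3) det_piece_g[OF C] Im_piece_z_pos[OF C]
    by (auto simp: SL2_def upper_half_plane_def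
        intro!: AE_lebesgue_on_everywhere piece_z_has_derivative piece_g_has_derivative[OF C])
qed

lemma piece_trajectory_unique:
  assumes tr: "trajectory T (\<lambda>_. e3) g z" and C: "C > 0"
    and init: "g 0 = mat 1" "z 0 = Complex 0 (C / sqrt 3)" and t: "t \<in> {0..T}"
  shows "z t = piece_z C t" "g t = piece_g C t"
proof -
  have T: "T > 0" using tr by (simp add: trajectory_def)
  have "flow T e3 (\<lambda>r. z (0 + r))" by (rule trajectory_flow[OF tr]) auto
  then have fl: "flow T e3 z" by simp
  have z: "z t = piece_z C t" if "t \<in> {0..T}" for t
    by (rule flow_e3_unique[OF fl C _ that]) (simp add: init piece_z_0)
  show "z t = piece_z C t" by (rule z[OF t])
  show "g t = piece_g C t"
    by (rule trajectory_g_unique[OF tr piece_trajectory[OF C T] z _ t]) (simp_all add: init piece_g_0)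
qed

lemma polygon_control_piece:
  assumes "\<tau> > 0" "real j * \<tau> \<le> t" "t < real (Suc j) * \<tau>"
  shows "polygon_control \<tau> t = (rotate_control ^^ j) e3"
  unfolding polygon_control_def nat_floor_piece[OF assms] rotate_control_funpow ..

lemma polygon_control_in_control_set: "polygon_control \<tau> t \<in> control_set"
proof -
  define i where "i = nat \<lfloor>t / \<tau>\<rfloor> mod 3"
  have "i = 0 \<or> i = 1 \<or> i = 2" by (auto simp: i_def)
  then show ?thesis
    using vertices_in_control_set by (auto simp: polygon_control_def numeral_2_eq_2 simp flip: i_def)
qed

lemma polygon_control_measurable: "polygon_control \<tau> \<in> borel_measurable (lebesgue_on S)"
proof -
  have "(\<lambda>t::real. \<lfloor>t / \<tau>\<rfloor>) \<in> borel \<rightarrow>\<^sub>M count_space UNIV"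
    by measurable
  then have "(\<lambda>t. [e3, e1, e2] ! (nat \<lfloor>t / \<tau>\<rfloor> mod 3)) \<in> borel_measurable borel"
    by (rule measurable_compose) simp
  then have "polygon_control \<tau> \<in> borel_measurable lborel"
    unfolding polygon_control_def[abs_def] by simp
  then show ?thesis by (intro measurable_restrict_space1 measurable_completion)
qed

lemma adj2_mat: "adj2 (mat a) = mat a"
  by (simp add: adj2_def mat2_mat)

context smoothed_polygon_curve
begin

definition curve_z :: "real \<Rightarrow> complex" where "curve_z = glue \<tau> z_iter"
definition curve_\<Lambda> :: "real \<Rightarrow> real^2^2" where "curve_\<Lambda> = glue \<tau> \<Lambda>_iter"
definition curve_\<nu> :: "real \<Rightarrow> complex" where "curve_\<nu> = glue \<tau> \<nu>_iter"

lemma curve_eqs: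
  assumes "real j * \<tau> \<le> t" "t \<le> real (Suc j) * \<tau>"
  shows "curve_z t = z_iter j (t - real j * \<tau>)" "curve_\<Lambda> t = \<Lambda>_iter j (t - real j * \<tau>)"
    "curve_\<nu> t = \<nu>_iter j (t - real j * \<tau>)"
  unfolding curve_z_def curve_\<Lambda>_def curve_\<nu>_def
  using glue_eq[of \<tau> z_iter, OF \<tau>_pos z_iter_match assms] glue_eq[of \<tau> \<Lambda>_iter, OF \<tau>_pos \<Lambda>_iter_match assms]
    glue_eq[of \<tau> \<nu>_iter, OF \<tau>_pos \<nu>_iter_match assms] by simp_all

lemma curve_derivatives:
  assumes "real j * \<tau> < t" "t < real (Suc j) * \<tau>"
  shows "(curve_g has_vector_derivative curve_g t ** X (curve_z t)) (at t within S)"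
    "(curve_z has_vector_derivative velocity (polygon_control \<tau> t) (curve_z t)) (at t within S)"
    "(curve_\<Lambda> has_vector_derivative bracket (curve_\<Lambda> t) (X (curve_z t))) (at t within S)"
    "(curve_\<nu> has_vector_derivative \<nu>'_iter j (t - real j * \<tau>)) (at t within S)"
proof -
  have le: "real j * \<tau> \<le> t" "t \<le> real (Suc j) * \<tau>" using assms by auto
  have u: "polygon_control \<tau> t = u_iter j"
    unfolding u_iter_def by (rule polygon_control_piece) (use \<tau>_pos assms in auto)
  note d = glue_has_vector_derivative[OF \<tau>_pos assms]
  show "(curve_g has_vector_derivative curve_g t ** X (curve_z t)) (at t within S)"
    unfolding curve_g_eq[OF le] curve_eqs[OF le] unfolding curve_g_def
    by (intro d g_iter_has_derivative)
  show "(curve_z has_vector_derivative velocity (polygon_control \<tau> t) (curve_z t)) (at t within S)"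
    unfolding curve_eqs[OF le] u unfolding curve_z_def by (intro d z_iter_has_derivative)
  show "(curve_\<Lambda> has_vector_derivative bracket (curve_\<Lambda> t) (X (curve_z t))) (at t within S)"
    unfolding curve_eqs[OF le] unfolding curve_\<Lambda>_def by (intro d \<Lambda>_iter_has_derivative)
  show "(curve_\<nu> has_vector_derivative \<nu>'_iter j (t - real j * \<tau>)) (at t within S)"
    unfolding curve_\<nu>_def by (intro d \<nu>_iter_has_derivative)
qed

lemma curve_lipschitz:
  "\<exists>L. L-lipschitz_on {0..tf} (\<lambda>t. ((curve_g t, curve_\<Lambda> t), (curve_z t, curve_\<nu> t)))"
proof -
  define F where "F = (\<lambda>j t. ((g_iter j t, \<Lambda>_iter j t), (z_iter j t, \<nu>_iter j t)))"
  have eq: "(\<lambda>t. ((curve_g t, curve_\<Lambda> t), (curve_z t, curve_\<nu> t))) = glue \<tau> F"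
    by (simp add: fun_eq_iff F_def glue_def curve_g_def curve_\<Lambda>_def curve_z_def curve_\<nu>_def)
  have "F (Suc j) 0 = F j \<tau>" for j
    by (simp only: F_def g_iter_match \<Lambda>_iter_match z_iter_match \<nu>_iter_match)
  moreover have "\<exists>L. L-lipschitz_on {0..\<tau>} (F j)" for j
    unfolding F_def by (rule lipschitz_iter)
  ultimately show ?thesis unfolding eq by (intro glue_lipschitz \<tau>_pos)
qed

lemma Im_curve_z_pos: "Im (curve_z t) > 0"
  unfolding curve_z_def glue_def by (rule Im_z_iter_pos)

lemma curve_star: "t \<in> {0..tf} \<Longrightarrow> curve_z t \<in> upper_half_plane_star"
proof -
  assume "t \<in> {0..tf}"
  then obtain j where j: "j < pieces" "real j * \<tau> \<le> t" "t \<le> real (Suc j) * \<tau>"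
    using piece_cases[OF \<tau>_pos _ pieces_pos] by metis
  then have "t - real j * \<tau> \<in> {0..\<tau>}" by (simp add: algebra_simps)
  note neg = field_den_iter_neg[OF this]
  show ?thesis
    unfolding curve_eqs[OF j(2,3)]
    by (intro star_of_field_den Im_z_iter_pos neg vertices_in_control_set)
qed

lemma curve_trajectory: "trajectory tf (polygon_control \<tau>) curve_g curve_z"
  unfolding trajectory_velocity
proof (intro conjI)
  obtain L where "L-lipschitz_on {0..tf} (\<lambda>t. ((curve_g t, curve_\<Lambda> t), (curve_z t, curve_\<nu> t)))"
    using curve_lipschitz by blast
  then have ac: "abs_continuous_on 0 tf (\<lambda>t. ((curve_g t, curve_\<Lambda> t), (curve_z t, curve_\<nu> t)))"
    by (rule abs_continuous_on_Lipschitz)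
  have "abs_continuous_on 0 tf (\<lambda>t. (fst (fst ((curve_g t, curve_\<Lambda> t), (curve_z t, curve_\<nu> t))),
      fst (snd ((curve_g t, curve_\<Lambda> t), (curve_z t, curve_\<nu> t)))))"
    by (rule abs_continuous_on_linear[OF ac, of "\<lambda>p. (fst (fst p), fst (snd p))"])
       (intro bounded_linear_Pair bounded_linear_compose[OF bounded_linear_fst bounded_linear_fst]
          bounded_linear_compose[OF bounded_linear_fst bounded_linear_snd])
  then show "abs_continuous_on 0 tf (\<lambda>t. (curve_g t, curve_z t))" by simp
  show "AE t in lebesgue_on {0..tf}.
      (curve_z has_vector_derivative velocity (polygon_control \<tau> t) (curve_z t)) (at t within {0..tf}) \<and>
      (curve_g has_vector_derivative curve_g t ** X (curve_z t)) (at t within {0..tf})"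
    by (rule AE_off_switching_times[OF \<tau>_pos pieces_pos]) (intro conjI curve_derivatives)
  show "curve_z ` {0..tf} \<subseteq> upper_half_plane"
    using Im_curve_z_pos by (auto simp: upper_half_plane_def)
  show "curve_g ` {0..tf} \<subseteq> SL2" using det_curve_g by (auto simp: SL2_def)
qed (use \<tau>_pos pieces_pos polygon_control_in_control_set polygon_control_measurable in auto)

lemma curve_z_0: "curve_z 0 = Complex 0 (C / sqrt 3)"
  using curve_eqs(1)[of 0 0] \<tau>_pos by (simp add: piece_z_0)

lemma trajectory_unique:
  assumes tr: "trajectory tf (polygon_control \<tau>) g z"
    and init: "g 0 = mat 1" "z 0 = Complex 0 (C / sqrt 3)" and t: "t \<in> {0..tf}"
  shows "z t = curve_z t" "g t = curve_g t"
proof -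
  note im = trajectoryD(3)[OF tr]
  have step: "z (real j * \<tau> + r) = z_iter j r"
    if j: "j < pieces" and z0: "z (real j * \<tau>) = z_iter j 0" and r: "r \<in> {0..\<tau>}" for j r
  proof -
    have jn: "real j * \<tau> + \<tau> \<le> tf"
    proof -
      have "real (Suc j) * \<tau> \<le> real pieces * \<tau>" using j \<tau>_pos by (intro mult_right_mono) auto
      then show ?thesis by (simp add: algebra_simps)
    qed
    have "flow \<tau> (u_iter j) (\<lambda>r. z (real j * \<tau> + r))"
      by (rule trajectory_flow[OF tr _ jn])
         (use \<tau>_pos polygon_control_piece in \<open>auto simp: u_iter_def algebra_simps\<close>)
    \<comment> \<open>The third power of the rotation is the identity, so \<open>2 * j\<close> rotations undo \<open>j\<close> rotations.\<close>
    from flow_rotate_iterate[OF this, of "2 * j"]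
    have "flow \<tau> ((rotate_control ^^ (2 * j)) (u_iter j)) (\<lambda>r. (rotate_z ^^ (2 * j)) (z (real j * \<tau> + r)))" .
    moreover have "(rotate_control ^^ (2 * j)) (u_iter j) = e3"
    proof -
      have "(rotate_control ^^ (2 * j)) (u_iter j) = (rotate_control ^^ (3 * j)) e3"
        unfolding u_iter_def by (simp flip: funpow_add o_apply[of "rotate_control ^^ (2 * j)"])
      then show ?thesis by (simp add: rotate_control_funpow)
    qed
    moreover have "(rotate_z ^^ (2 * j)) (z (real j * \<tau> + 0)) = piece_z C 0"
    proof -
      have "(rotate_z ^^ (2 * j)) (z_iter j 0) = (rotate_z ^^ (3 * j)) (piece_z C 0)"
        unfolding z_iter_def by (simp flip: funpow_add o_apply[of "rotate_z ^^ (2 * j)"])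
      then show ?thesis using z0 rotate_z_funpow_triple[OF Im_piece_z_pos[OF C_pos]] by simp
    qed
    ultimately have "(rotate_z ^^ (2 * j)) (z (real j * \<tau> + r)) = piece_z C r"
      using flow_e3_unique[OF _ C_pos _ r] by metis
    then have "(rotate_z ^^ j) ((rotate_z ^^ (2 * j)) (z (real j * \<tau> + r))) = z_iter j r"
      by (simp add: z_iter_def)
    moreover have "(rotate_z ^^ j) ((rotate_z ^^ (2 * j)) w) = (rotate_z ^^ (3 * j)) w" for w
      by (simp flip: funpow_add o_apply[of "rotate_z ^^ j"])
    moreover have "real j * \<tau> + r \<in> {0..tf}" using r jn \<tau>_pos by auto
    ultimately show ?thesis using rotate_z_funpow_triple[OF im] by metis
  qed
  have nodes: "j \<le> pieces \<Longrightarrow> z (real j * \<tau>) = z_iter j 0" for j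
  proof (induction j)
    case 0
    then show ?case by (simp add: init piece_z_0)
  next
    case (Suc j)
    then have "z (real j * \<tau> + \<tau>) = z_iter j \<tau>"
      using \<tau>_pos by (intro step) auto
    then show ?case unfolding z_iter_match by (simp add: algebra_simps)
  qed
  have z: "z t = curve_z t" if t: "t \<in> {0..tf}" for t
  proof -
    obtain j where j: "j < pieces" "real j * \<tau> \<le> t" "t \<le> real (Suc j) * \<tau>"
      using piece_cases[OF \<tau>_pos t pieces_pos] by metis
    then have "t - real j * \<tau> \<in> {0..\<tau>}" by (simp add: algebra_simps)
    from step[OF j(1) nodes this] j show ?thesis by (simp add: curve_eqs(1))
  qed
  show "z t = curve_z t" by (rule z[OF t])
  show "g t = curve_g t"
    by (rule trajectory_g_unique[OF tr curve_trajectory z _ t]) (simp_all add: init curve_g_0)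
qed

lemma z_iter_pieces: "z_iter pieces 0 = rotate_z (piece_z C 0)"
  using rotate_z_funpow_triple[OF Im_piece_z_pos[OF C_pos], of k 0] by (simp add: z_iter_def pieces_def)

text \<open>The automorphy factors along an orbit of length three have product \<open>- 8\<close>, and \<open>(- 8)\<^sup>2 = 4 ^ 3\<close>.\<close>

lemma \<nu>_iter_triple: "\<nu>_iter (3 * i) t = piece_\<nu> t"
proof (induction i)
  case (Suc i)
  define w where "w = z_iter (3 * i) t"
  have w: "Im w > 0" by (simp add: w_def Im_z_iter_pos)
  have eq: "3 * Suc i = Suc (Suc (Suc (3 * i)))" by simp
  have "\<nu>_iter (3 * Suc i) t = rotate_costate (rotate_z (rotate_z w)) (rotate_costate (rotate_z w)
      (rotate_costate w (piece_\<nu> t)))"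
    unfolding eq \<nu>_iter.simps z_iter_Suc w_def[symmetric] Suc ..
  also have "\<dots> = piece_\<nu> t * (cnj (automorphy w * automorphy (rotate_z w) * automorphy (rotate_z (rotate_z w))))\<^sup>2 / 64"
    by (simp add: rotate_costate_def power2_eq_square)
  also have "\<dots> = piece_\<nu> t" unfolding automorphy_cocycle[OF w] by simp
  finally show ?case .
qed simp

text \<open>Transversality is the matching condition once more: since \<open>pieces\<close> is \<open>1\<close> modulo \<open>3\<close>, the
  end values are those at the beginning of the second piece.\<close>

theorem curve_pontryagin_extremal:
  assumes tr: "trajectory tf (polygon_control \<tau>) g z"
    and init: "g 0 = mat 1" "z 0 = Complex 0 (C / sqrt 3)"
  shows "pontryagin_extremal (-1) tf (polygon_control \<tau>) g z curve_\<Lambda> curve_\<nu>"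
proof -
  have tf: "tf > 0" using \<tau>_pos pieces_pos by simp
  have zc: "z t = curve_z t" and gc: "g t = curve_g t" if "t \<in> {0..tf}" for t
    using trajectory_unique[OF tr init that] by simp_all
  have piece: "\<exists>j r. r \<in> {0..\<tau>} \<and> polygon_control \<tau> t = u_iter j \<and> z t = z_iter j r \<and> curve_\<Lambda> t = \<Lambda>_iter j r \<and>
      curve_\<nu> t = \<nu>_iter j r \<and> (curve_\<nu> has_vector_derivative \<nu>'_iter j r) (at t within {0..tf}) \<and> t \<in> {0..tf}"
    if "j < pieces" "real j * \<tau> < t" "t < real (Suc j) * \<tau>" for j t
  proof -
    have "real (Suc j) * \<tau> \<le> real pieces * \<tau>" using that \<tau>_pos by (intro mult_right_mono) auto
    moreover have "0 \<le> real j * \<tau>" using \<tau>_pos by simp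
    ultimately have t: "t \<in> {0..tf}" using that by auto
    have "t - real j * \<tau> \<in> {0..\<tau>}" using that by (simp add: algebra_simps)
    moreover have "polygon_control \<tau> t = u_iter j"
      unfolding u_iter_def by (rule polygon_control_piece) (use \<tau>_pos that in auto)
    moreover have "z t = z_iter j (t - real j * \<tau>)" "curve_\<Lambda> t = \<Lambda>_iter j (t - real j * \<tau>)"
      "curve_\<nu> t = \<nu>_iter j (t - real j * \<tau>)"
      using zc[OF t] curve_eqs[of j t] that by simp_all
    ultimately show ?thesis using t curve_derivatives(4)[OF that(2,3)] by blast
  qed
  have endpoints: "0 \<in> {0..tf}" "tf \<in> {0..tf}" using tf by auto
  have curve_tf: "curve_z tf = z_iter pieces 0" "curve_\<Lambda> tf = \<Lambda>_iter pieces 0" "curve_\<nu> tf = \<nu>_iter pieces 0"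
    using curve_eqs[of pieces tf] \<tau>_pos by (simp_all add: algebra_simps)
  have curve_0: "curve_z 0 = z_iter 0 0" "curve_\<Lambda> 0 = \<Lambda>_iter 0 0" "curve_\<nu> 0 = \<nu>_iter 0 0"
    using curve_eqs[of 0 0] \<tau>_pos by simp_all
  have "homotopic_paths SL2 (g \<circ> (\<lambda>s. tf * s)) (curve_g \<circ> (\<lambda>s. tf * s))"
  proof (rule homotopic_paths_sym, rule homotopic_paths_eq)
    show "path (curve_g \<circ> (\<lambda>s. tf * s))" "path_image (curve_g \<circ> (\<lambda>s. tf * s)) \<subseteq> SL2"
      using homotopic_paths_imp_path[OF homotopic_curve_g] homotopic_paths_imp_subset[OF homotopic_curve_g]
      by blast+
    fix s :: real assume "s \<in> {0..1}"
    then have "tf * s \<in> {0..tf}" using tf by (auto intro!: mult_left_le)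
    then show "(curve_g \<circ> (\<lambda>s. tf * s)) s = (g \<circ> (\<lambda>s. tf * s)) s" using gc by simp
  qed
  then have hom: "homotopic_paths SL2 (g \<circ> (\<lambda>s. tf * s)) ((\<lambda>t. mexp ((pi * t / (3 * tf)) *\<^sub>R J)) \<circ> (\<lambda>s. tf * s))"
    using homotopic_curve_g by (rule homotopic_paths_trans)
  have "z tf = moebius (matrix_inv R) (z 0)"
    using zc[OF endpoints(1)] zc[OF endpoints(2)] curve_tf(1) curve_0(1) z_iter_pieces by (simp add: rotate_z_def)
  moreover have "z ` {0..tf} \<subseteq> upper_half_plane_star" using zc curve_star by auto
  moreover have "g tf = R" using gc[OF endpoints(2)] curve_g_end by simp
  ultimately have adm: "admissible tf (polygon_control \<tau>) g z"
    unfolding admissible_def using tr init hom by blast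
  have "\<exists>L. L-lipschitz_on {0..tf} (\<lambda>t. ((g t, curve_\<Lambda> t), (z t, curve_\<nu> t)))"
  proof -
    obtain L where "L-lipschitz_on {0..tf} (\<lambda>t. ((curve_g t, curve_\<Lambda> t), (curve_z t, curve_\<nu> t)))"
      using curve_lipschitz by blast
    then have "L-lipschitz_on {0..tf} (\<lambda>t. ((g t, curve_\<Lambda> t), (z t, curve_\<nu> t)))"
      using zc gc by (simp add: lipschitz_on_def)
    then show ?thesis by blast
  qed
  moreover have "AE t in lebesgue_on {0..tf}.
        (curve_\<Lambda> has_vector_derivative bracket (curve_\<Lambda> t) (X (z t))) (at t within {0..tf}) \<and>
        ((\<lambda>s. Re (curve_\<nu> s)) has_real_derivative
           - deriv (\<lambda>x. hamiltonian (-1) (curve_\<Lambda> t) (Complex x (Im (z t))) (curve_\<nu> t) (polygon_control \<tau> t)) (Re (z t)))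
          (at t within {0..tf}) \<and>
        ((\<lambda>s. Im (curve_\<nu> s)) has_real_derivative
           - deriv (\<lambda>y. hamiltonian (-1) (curve_\<Lambda> t) (Complex (Re (z t)) y) (curve_\<nu> t) (polygon_control \<tau> t)) (Im (z t)))
          (at t within {0..tf})"
  proof (rule AE_off_switching_times[OF \<tau>_pos pieces_pos], goal_cases)
    case (1 j t)
    from piece[OF 1] obtain i r where r: "r \<in> {0..\<tau>}" "polygon_control \<tau> t = u_iter i" "z t = z_iter i r"
      "curve_\<Lambda> t = \<Lambda>_iter i r" "curve_\<nu> t = \<nu>_iter i r"
      "(curve_\<nu> has_vector_derivative \<nu>'_iter i r) (at t within {0..tf})" "t \<in> {0..tf}" by blast
    have "((\<lambda>s. Re (curve_\<nu> s)) has_real_derivative Re (\<nu>'_iter i r)) (at t within {0..tf})"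
      "((\<lambda>s. Im (curve_\<nu> s)) has_real_derivative Im (\<nu>'_iter i r)) (at t within {0..tf})"
      using r(6) by (simp_all add: has_vector_derivative_complex_iff)
    moreover have "(curve_\<Lambda> has_vector_derivative bracket (curve_\<Lambda> t) (X (z t))) (at t within {0..tf})"
      unfolding zc[OF r(7)] by (rule curve_derivatives(3)[OF 1(2,3)])
    ultimately show ?case
      unfolding r(2-5) using hamilton_costate_partials[OF hamilton_costate_iter[OF r(1), of i]] by simp
  qed
  moreover have "curve_\<Lambda> ` {0..tf} \<subseteq> sl2"
    unfolding curve_\<Lambda>_def glue_def using trace_\<Lambda>_iter by (auto simp: sl2_def)
  ultimately have "lifted_trajectory (-1) tf (polygon_control \<tau>) g z curve_\<Lambda> curve_\<nu>"
    unfolding lifted_trajectory_def using adm by blast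
  moreover have "AE t in lebesgue_on {0..tf}.
        hamiltonian (-1) (curve_\<Lambda> t) (z t) (curve_\<nu> t) (polygon_control \<tau> t) = hamiltonian_max (-1) (curve_\<Lambda> t) (z t) (curve_\<nu> t) \<and>
        hamiltonian_max (-1) (curve_\<Lambda> t) (z t) (curve_\<nu> t) = 0"
  proof (rule AE_off_switching_times[OF \<tau>_pos pieces_pos], goal_cases)
    case (1 j t)
    from piece[OF 1] obtain i r where r: "r \<in> {0..\<tau>}" "polygon_control \<tau> t = u_iter i" "z t = z_iter i r"
      "curve_\<Lambda> t = \<Lambda>_iter i r" "curve_\<nu> t = \<nu>_iter i r" by blast
    then show ?case by (simp add: hamiltonian_max_iter hamiltonian_iter_0)
  qed
  moreover have "curve_\<Lambda> tf = matrix_inv R ** curve_\<Lambda> 0 ** R"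
    unfolding curve_tf curve_0 unfolding \<Lambda>_iter_def g_iter_pieces
    by (simp add: piece_g_0 adj2_R adj2_mat)
  moreover have "adjoint (frechet_derivative (moebius (matrix_inv R)) (at (z 0))) (curve_\<nu> tf) = curve_\<nu> 0"
  proof -
    have z0: "z 0 = piece_z C 0" "Im (z 0) > 0"
      by (simp_all add: init piece_z_0 C_pos)
    define c where "c = 4 / (automorphy (z 0))\<^sup>2"
    have "(rotate_z has_derivative (*) c) (at (z 0))"
      using rotate_z_has_derivative[of "z 0" UNIV] z0 unfolding has_field_derivative_def c_def by simp
    moreover have "rotate_z = moebius (matrix_inv R)" by (simp add: rotate_z_def fun_eq_iff)
    ultimately have "frechet_derivative (moebius (matrix_inv R)) (at (z 0)) = (*) c"
      using frechet_derivative_at by metis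
    moreover have "adjoint ((*) c) = (*) (cnj c)"
      by (rule adjoint_unique) (simp add: inner_complex_def algebra_simps)
    moreover have "\<nu>_iter pieces 0 = rotate_costate (z 0) (piece_\<nu> 0)"
      unfolding pieces_def using \<nu>_iter_triple[of k 0] rotate_z_funpow_triple[OF z0(2), of k] z0
      by (simp add: z_iter_def)
    moreover have "cnj c * rotate_costate (z 0) (piece_\<nu> 0) = piece_\<nu> 0"
      using automorphy_nonzero[of "z 0"] z0(2) by (simp add: c_def rotate_costate_def)
    ultimately show ?thesis by (simp add: curve_0 curve_tf(3))
  qed
  ultimately show ?thesis unfolding pontryagin_extremal_def by (simp add: zero_prod_def)
qed

end

text \<open>By uniqueness the two conditions on the end of the first piece are statements on the explicit
  solution. The imaginary part of the first one gives the duration; the second one gives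
  \<open>E = 2 * cos \<theta> < 2\<close>, where \<open>k \<ge> 1\<close> excludes \<open>\<theta> = 0\<close>.\<close>

lemma polygon_data_parameters:
  assumes pd: "polygon_data k y \<tau>" and k: "k \<ge> 1"
  shows "smoothed_polygon_curve (sqrt 3 * y) \<tau> k"
proof -
  define C where "C = sqrt 3 * y"
  have y: "y = C / sqrt 3" by (simp add: C_def)
  from pd have y01: "0 < y" "y < 1" and \<tau>: "\<tau> > 0" by (auto simp: polygon_data_def)
  from pd obtain g z where tr: "trajectory \<tau> (\<lambda>_. e3) g z" and init: "g 0 = mat 1" "z 0 = Complex 0 y"
    and end1: "z \<tau> = rotate_z (Complex 0 y)" and end2: "trace (matrix_inv R ** g \<tau>) = 2 * cos (theta k)"
    by (auto simp: polygon_data_def rotate_z_def)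
  have C: "C > 0" using y01 by (simp add: C_def)
  have "z \<tau> = piece_z C \<tau>" "g \<tau> = piece_g C \<tau>"
    using piece_trajectory_unique[OF tr C init(1)] init(2) \<tau> y by auto
  then have "Im (piece_z C \<tau>) = Im (rotate_z (Complex 0 y))" and trace: "trace (matrix_inv R ** piece_g C \<tau>) = 2 * cos (theta k)"
    using end1 end2 by simp_all
  then have "C * exp (C * \<tau>) / sqrt 3 = 4 * y / (1 + C\<^sup>2)"
    unfolding Im_rotate_z norm_automorphy by (simp add: piece_z_def C_def power_mult_distrib)
  moreover have "1 + C\<^sup>2 > 0" by (simp add: add_pos_nonneg)
  ultimately have eC: "exp (C * \<tau>) * (1 + C\<^sup>2) = 4"
  proof -
    have "a * K = 4" if "C * a / sqrt 3 = 4 * (C / sqrt 3) / K" "K > 0" for a K :: real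
      using that C by (simp add: field_simps)
    from this[OF \<open>C * exp (C * \<tau>) / sqrt 3 = 4 * y / (1 + C\<^sup>2)\<close>[unfolded y] \<open>1 + C\<^sup>2 > 0\<close>]
    show ?thesis .
  qed
  then have eq: "exp (C * \<tau>) = 2 * cos (theta k)"
    using trace trace_inv_R_piece_g[OF C eC] by simp
  have "cos (theta k) < 1"
    using theta_third[OF k] cos_monotone_0_pi[of 0 "theta k"] by simp
  then have "4 < 2 * (1 + C\<^sup>2)"
    using eC eq \<open>1 + C\<^sup>2 > 0\<close> mult_strict_right_mono[of "exp (C * \<tau>)" 2 "1 + C\<^sup>2"] by simp
  moreover have "C\<^sup>2 < 3" using y01 by (simp add: C_def power_mult_distrib power_less_one_iff)
  ultimately interpret polygon_piece C \<tau>
    by unfold_locales (use C eC in auto)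
  show ?thesis
    unfolding C_def[symmetric] by unfold_locales (use k eq in \<open>auto simp: E_def\<close>)
qed

lemma smoothed_polygon_exists:
  assumes k: "k \<ge> 1"
  shows "\<exists>y \<tau> g z. smoothed_polygon k y \<tau> g z"
proof -
  define c where "c = cos (theta k)"
  have "c < 1" "1/2 < c"
    using theta_third[OF k] cos_monotone_0_pi[of 0 "theta k"] cos_monotone_0_pi[of "theta k" "pi / 3"]
    by (auto simp: c_def cos_60)
  define C where "C = sqrt (2 / c - 1)"
  have C2: "C\<^sup>2 = 2 / c - 1" using \<open>1/2 < c\<close> \<open>c < 1\<close> by (simp add: C_def)
  have C: "C > 0" "1 < C\<^sup>2" "C\<^sup>2 < 3"
    using \<open>1/2 < c\<close> \<open>c < 1\<close> unfolding C2 by (simp_all add: C_def field_simps)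
  define \<tau> where "\<tau> = ln (2 * c) / C"
  have e: "exp (C * \<tau>) = 2 * c" using C \<open>1/2 < c\<close> by (simp add: \<tau>_def)
  interpret polygon_piece C \<tau>
    by unfold_locales (use C e \<open>1/2 < c\<close> in \<open>simp_all add: C2\<close>)
  interpret smoothed_polygon_curve C \<tau> k
    by unfold_locales (use k e in \<open>simp_all add: E_def c_def\<close>)
  define y where "y = C / sqrt 3"
  have "C < sqrt 3" using C by (intro real_less_rsqrt)
  then have "0 < y" "y < 1" using C by (simp_all add: y_def)
  moreover have "trajectory \<tau> (\<lambda>_. e3) (piece_g C) (piece_z C)"
    by (rule piece_trajectory[OF C_pos \<tau>_pos])
  moreover have "piece_z C \<tau> = moebius (matrix_inv R) (Complex 0 y)"
    unfolding y_def piece_z_0[symmetric] rotate_z_def[symmetric] by (rule piece_z_end)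
  moreover have "trace (matrix_inv R ** piece_g C \<tau>) = 2 * cos (theta k)"
    using trace_inv_R_piece_g[OF C_pos] \<tau> e by (simp add: c_def)
  ultimately have "polygon_data k y \<tau>"
    unfolding polygon_data_def using \<tau>_pos piece_g_0 piece_z_0 y_def by metis
  then have "smoothed_polygon k y \<tau> curve_g curve_z"
    unfolding smoothed_polygon_def using curve_trajectory curve_g_0 curve_z_0 by (simp add: pieces_def y_def)
  then show ?thesis by blast
qed

theorem theorem4p4p1:
  fixes k :: nat
  assumes "k \<ge> 1"
  shows "(\<exists>y \<tau> g z. smoothed_polygon k y \<tau> g z) \<and>
    (\<forall>y \<tau> g z. smoothed_polygon k y \<tau> g z \<longrightarrow>
       (\<exists>\<Lambda> \<nu>. pontryagin_extremal (-1) (real (3 * k + 1) * \<tau>) (polygon_control \<tau>) g z \<Lambda> \<nu>))"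
proof (intro conjI allI impI)
  show "\<exists>y \<tau> g z. smoothed_polygon k y \<tau> g z" using assms by (rule smoothed_polygon_exists)
next
  fix y \<tau> g z assume sp: "smoothed_polygon k y \<tau> g z"
  then have "polygon_data k y \<tau>" by (simp add: smoothed_polygon_def)
  then interpret smoothed_polygon_curve "sqrt 3 * y" \<tau> k using assms by (rule polygon_data_parameters)
  have "pontryagin_extremal (-1) (real pieces * \<tau>) (polygon_control \<tau>) g z curve_\<Lambda> curve_\<nu>"
    using sp by (intro curve_pontryagin_extremal) (simp_all add: smoothed_polygon_def pieces_def)
  then show "\<exists>\<Lambda> \<nu>. pontryagin_extremal (-1) (real (3 * k + 1) * \<tau>) (polygon_control \<tau>) g z \<Lambda> \<nu>"
    by (auto simp: pieces_def)
qed

end
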